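(* Let $Q$ be an irreducible Dirichlet form on $L^2(X,m)$, $(X,m)$ a $\sigma$-finite measure space. Then the following are equivalent: (i) $Q$ is recurrent; (ii) for all $u\in D(L_e)$ with $L_eu\in L^1(X,m)$, $\int_X L_eu\,dm=0$; (iii) the constant function $1$ belongs to $D(L_e)$ and $L_e1=0$.
   Context: A Dirichlet form is a densely defined, nonnegative, closed, symmetric bilinear form on $L^2(X,m)$ satisfying the contraction property, with generator $L$ and semigroup $T_t=e^{-tL}$ (extended to $L^1$). For $f\in L^1_+(X,m)$, $Gf:=\lim_{n\to\infty}\int_0^nT_sf\,ds$ ($m$-a.e., possibly infinite). $Q$ is recurrent if for every $f\in L^1_+(X,m)$ either $Gf=0$ a.e. or $Gf=\infty$ a.e. A measurable set $A$ is $Q$-invariant if for all $f\in D(Q)$, $1_Af\in D(Q)$ and $Q(f)=Q(1_Af)+Q(1_{X\setminus A}f)$; $Q$ is irreducible if every $Q$-invariant $A$ has $m(A)=0$ or $m(X\setminus A)=0$. The extended Dirichlet space $D(Q)_e$ consists of all $m$-a.e. finite measurable $f$ for which there is a $Q$-Cauchy sequence $(f_n)\subseteq D(Q)$ with $f_n\to f$ a.e.; $Q(f):=\lim Q(f_n)$, extended to a bilinear form by polarization. $L_e$ has domain $D(L_e)=\{v\in D(Q)_e\mid\exists w\in L^2(X,m):\ \langle w,u\rangle=Q(v,u)\ \forall u\in D(Q)\}$ and $L_ev=w$. *)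

theory Defs
  imports "HOL-Analysis.Analysis"
begin

text \<open>Elements of L^p(X,m) are represented by real-valued functions on space M;
  all notions below are invariant under m-a.e. equality.\<close>

definition L2 :: "'a measure \<Rightarrow> ('a \<Rightarrow> real) set" where
  "L2 M = {f. f \<in> borel_measurable M \<and> integrable M (\<lambda>x. (f x)\<^sup>2)}"

definition L1 :: "'a measure \<Rightarrow> ('a \<Rightarrow> real) set" where
  "L1 M = {f. integrable M f}"

definition ip :: "'a measure \<Rightarrow> ('a \<Rightarrow> real) \<Rightarrow> ('a \<Rightarrow> real) \<Rightarrow> real" where
  "ip M f g = (\<integral>x. f x * g x \<partial>M)"

definition l2norm :: "'a measure \<Rightarrow> ('a \<Rightarrow> real) \<Rightarrow> real" where
  "l2norm M f = sqrt (\<integral>x. (f x)\<^sup>2 \<partial>M)"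

definition l1norm :: "'a measure \<Rightarrow> ('a \<Rightarrow> real) \<Rightarrow> real" where
  "l1norm M f = (\<integral>x. \<bar>f x\<bar> \<partial>M)"

definition dirichlet_form ::
  "'a measure \<Rightarrow> ('a \<Rightarrow> real) set \<Rightarrow> (('a \<Rightarrow> real) \<Rightarrow> ('a \<Rightarrow> real) \<Rightarrow> real) \<Rightarrow> bool" where
  "dirichlet_form M D Q \<longleftrightarrow>
     D \<subseteq> L2 M
   \<comment> \<open>well defined on a.e.-classes\<close>
   \<and> (\<forall>f\<in>D. \<forall>g. g \<in> borel_measurable M \<and> (AE x in M. f x = g x) \<longrightarrow>
          g \<in> D \<and> (\<forall>h\<in>D. Q g h = Q f h))
   \<comment> \<open>linear subspace\<close>
   \<and> (\<lambda>x. 0) \<in> D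
   \<and> (\<forall>f\<in>D. \<forall>g\<in>D. (\<lambda>x. f x + g x) \<in> D)
   \<and> (\<forall>f\<in>D. \<forall>c::real. (\<lambda>x. c * f x) \<in> D)
   \<comment> \<open>symmetric, bilinear, nonnegative\<close>
   \<and> (\<forall>f\<in>D. \<forall>g\<in>D. Q f g = Q g f)
   \<and> (\<forall>f\<in>D. \<forall>g\<in>D. \<forall>h\<in>D. Q (\<lambda>x. f x + g x) h = Q f h + Q g h)
   \<and> (\<forall>f\<in>D. \<forall>h\<in>D. \<forall>c::real. Q (\<lambda>x. c * f x) h = c * Q f h)
   \<and> (\<forall>f\<in>D. Q f f \<ge> 0)
   \<comment> \<open>densely defined\<close>
   \<and> (\<forall>f\<in>L2 M. \<forall>e>0. \<exists>g\<in>D. l2norm M (\<lambda>x. f x - g x) < e)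
   \<comment> \<open>closed: D complete w.r.t. the form norm Q(f) + \<parallel>f\<parallel>^2\<close>
   \<and> (\<forall>u. (\<forall>n. u n \<in> D) \<and>
          (\<forall>e>0. \<exists>N. \<forall>n\<ge>N. \<forall>m\<ge>N.
             Q (\<lambda>x. u n x - u m x) (\<lambda>x. u n x - u m x) + (l2norm M (\<lambda>x. u n x - u m x))\<^sup>2 < e)
        \<longrightarrow> (\<exists>v\<in>D. (\<lambda>n. Q (\<lambda>x. u n x - v x) (\<lambda>x. u n x - v x)
                          + (l2norm M (\<lambda>x. u n x - v x))\<^sup>2) \<longlonglongrightarrow> 0))
   \<comment> \<open>contraction property (normal contractions)\<close>
   \<and> (\<forall>f\<in>D. \<forall>C::real \<Rightarrow> real. C 0 = 0 \<and> (\<forall>s t. \<bar>C s - C t\<bar> \<le> \<bar>s - t\<bar>) \<longrightarrow>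
          (\<lambda>x. C (f x)) \<in> D \<and> Q (\<lambda>x. C (f x)) (\<lambda>x. C (f x)) \<le> Q f f)"

definition gen_rel ::
  "'a measure \<Rightarrow> ('a \<Rightarrow> real) set \<Rightarrow> (('a \<Rightarrow> real) \<Rightarrow> ('a \<Rightarrow> real) \<Rightarrow> real)
     \<Rightarrow> ('a \<Rightarrow> real) \<Rightarrow> ('a \<Rightarrow> real) \<Rightarrow> bool" where
  "gen_rel M D Q v w \<longleftrightarrow> v \<in> D \<and> w \<in> L2 M \<and> (\<forall>u\<in>D. ip M w u = Q v u)"

text \<open>T is the semigroup e^{-tL} on L^2, extended to L^1.
  On L^2 it is characterised as the (unique) solution of the abstract Cauchy problem
  u(0) = f, u'(t) = -L u(t) (t>0), u continuous on [0,\<infinity>);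
  on L^1 it is the (unique) L^1-contractive extension.\<close>
definition semigroup_of ::
  "'a measure \<Rightarrow> ('a \<Rightarrow> real) set \<Rightarrow> (('a \<Rightarrow> real) \<Rightarrow> ('a \<Rightarrow> real) \<Rightarrow> real)
     \<Rightarrow> (real \<Rightarrow> ('a \<Rightarrow> real) \<Rightarrow> ('a \<Rightarrow> real)) \<Rightarrow> bool" where
  "semigroup_of M D Q T \<longleftrightarrow>
     (\<forall>f\<in>L2 M. \<forall>t\<ge>0. T t f \<in> L2 M)
   \<and> (\<forall>f\<in>L2 M. AE x in M. T 0 f x = f x)
   \<and> (\<forall>f\<in>L2 M. \<forall>t\<ge>0.
        ((\<lambda>s. l2norm M (\<lambda>x. T s f x - T t f x)) \<longlongrightarrow> 0) (at t within {0..}))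
   \<and> (\<forall>f\<in>L2 M. \<forall>t>0. \<exists>w. gen_rel M D Q (T t f) w \<and>
        ((\<lambda>h. l2norm M (\<lambda>x. (T (t + h) f x - T t f x) / h + w x)) \<longlongrightarrow> 0) (at 0))
   \<and> (\<forall>f\<in>L1 M. \<forall>t\<ge>0. T t f \<in> L1 M)
   \<and> (\<forall>f\<in>L1 M. \<forall>g\<in>L1 M. \<forall>t\<ge>0.
        l1norm M (\<lambda>x. T t f x - T t g x) \<le> l1norm M (\<lambda>x. f x - g x))"

text \<open>F is (a version of) the L^1-valued integral \<integral>_0^n T_s f ds, characterised weakly.\<close>
definition is_int_semigroup ::
  "'a measure \<Rightarrow> (real \<Rightarrow> ('a \<Rightarrow> real) \<Rightarrow> ('a \<Rightarrow> real)) \<Rightarrow> ('a \<Rightarrow> real) \<Rightarrow> real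
     \<Rightarrow> ('a \<Rightarrow> real) \<Rightarrow> bool" where
  "is_int_semigroup M T f r F \<longleftrightarrow> F \<in> L1 M \<and>
     (\<forall>g \<in> borel_measurable M. (\<exists>B. \<forall>x\<in>space M. \<bar>g x\<bar> \<le> B) \<longrightarrow>
        (\<integral>x. F x * g x \<partial>M) = (LBINT s:{0..r}. (\<integral>x. T s f x * g x \<partial>M)))"

definition is_Green ::
  "'a measure \<Rightarrow> (real \<Rightarrow> ('a \<Rightarrow> real) \<Rightarrow> ('a \<Rightarrow> real)) \<Rightarrow> ('a \<Rightarrow> real) \<Rightarrow> ('a \<Rightarrow> ereal) \<Rightarrow> bool" where
  "is_Green M T f G \<longleftrightarrow> (\<exists>F. (\<forall>n::nat. is_int_semigroup M T f (real n) (F n)) \<and>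
      (AE x in M. (\<lambda>n. ereal (F n x)) \<longlonglongrightarrow> G x))"

definition recurrent ::
  "'a measure \<Rightarrow> (real \<Rightarrow> ('a \<Rightarrow> real) \<Rightarrow> ('a \<Rightarrow> real)) \<Rightarrow> bool" where
  "recurrent M T \<longleftrightarrow> (\<forall>f\<in>L1 M. (AE x in M. f x \<ge> 0) \<longrightarrow>
     (\<forall>G. is_Green M T f G \<longrightarrow> (AE x in M. G x = 0) \<or> (AE x in M. G x = \<infinity>)))"

definition invariant_set ::
  "'a measure \<Rightarrow> ('a \<Rightarrow> real) set \<Rightarrow> (('a \<Rightarrow> real) \<Rightarrow> ('a \<Rightarrow> real) \<Rightarrow> real) \<Rightarrow> 'a set \<Rightarrow> bool" where
  "invariant_set M D Q A \<longleftrightarrow> A \<in> sets M \<and>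
     (\<forall>f\<in>D. (\<lambda>x. indicator A x * f x) \<in> D \<and>
        Q f f = Q (\<lambda>x. indicator A x * f x) (\<lambda>x. indicator A x * f x)
              + Q (\<lambda>x. indicator (space M - A) x * f x) (\<lambda>x. indicator (space M - A) x * f x))"

definition irreducible_form ::
  "'a measure \<Rightarrow> ('a \<Rightarrow> real) set \<Rightarrow> (('a \<Rightarrow> real) \<Rightarrow> ('a \<Rightarrow> real) \<Rightarrow> real) \<Rightarrow> bool" where
  "irreducible_form M D Q \<longleftrightarrow> (\<forall>A. invariant_set M D Q A \<longrightarrow>
      emeasure M A = 0 \<or> emeasure M (space M - A) = 0)"

definition approx_seq ::
  "'a measure \<Rightarrow> ('a \<Rightarrow> real) set \<Rightarrow> (('a \<Rightarrow> real) \<Rightarrow> ('a \<Rightarrow> real) \<Rightarrow> real)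
     \<Rightarrow> ('a \<Rightarrow> real) \<Rightarrow> (nat \<Rightarrow> 'a \<Rightarrow> real) \<Rightarrow> bool" where
  "approx_seq M D Q f fs \<longleftrightarrow> (\<forall>n. fs n \<in> D) \<and>
     (\<forall>e>0. \<exists>N. \<forall>n\<ge>N. \<forall>m\<ge>N. Q (\<lambda>x. fs n x - fs m x) (\<lambda>x. fs n x - fs m x) < e) \<and>
     (AE x in M. (\<lambda>n. fs n x) \<longlonglongrightarrow> f x)"

definition ext_space ::
  "'a measure \<Rightarrow> ('a \<Rightarrow> real) set \<Rightarrow> (('a \<Rightarrow> real) \<Rightarrow> ('a \<Rightarrow> real) \<Rightarrow> real) \<Rightarrow> ('a \<Rightarrow> real) set" where
  "ext_space M D Q = {f. f \<in> borel_measurable M \<and> (\<exists>fs. approx_seq M D Q f fs)}"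

definition extQ1 ::
  "'a measure \<Rightarrow> ('a \<Rightarrow> real) set \<Rightarrow> (('a \<Rightarrow> real) \<Rightarrow> ('a \<Rightarrow> real) \<Rightarrow> real) \<Rightarrow> ('a \<Rightarrow> real) \<Rightarrow> real" where
  "extQ1 M D Q f = (THE c. \<forall>fs. approx_seq M D Q f fs \<longrightarrow> (\<lambda>n. Q (fs n) (fs n)) \<longlonglongrightarrow> c)"

definition extQ ::
  "'a measure \<Rightarrow> ('a \<Rightarrow> real) set \<Rightarrow> (('a \<Rightarrow> real) \<Rightarrow> ('a \<Rightarrow> real) \<Rightarrow> real)
     \<Rightarrow> ('a \<Rightarrow> real) \<Rightarrow> ('a \<Rightarrow> real) \<Rightarrow> real" where
  "extQ M D Q f g = (extQ1 M D Q (\<lambda>x. f x + g x) - extQ1 M D Q (\<lambda>x. f x - g x)) / 4"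

definition ext_gen_rel ::
  "'a measure \<Rightarrow> ('a \<Rightarrow> real) set \<Rightarrow> (('a \<Rightarrow> real) \<Rightarrow> ('a \<Rightarrow> real) \<Rightarrow> real)
     \<Rightarrow> ('a \<Rightarrow> real) \<Rightarrow> ('a \<Rightarrow> real) \<Rightarrow> bool" where
  "ext_gen_rel M D Q v w \<longleftrightarrow> v \<in> ext_space M D Q \<and> w \<in> L2 M \<and>
     (\<forall>u\<in>D. ip M w u = extQ M D Q v u)"

end

theory Submission
  imports Defs "HOL-Probability.Giry_Monad"
begin

text \<open>
  All three conditions are compared with the existence of \<open>u\<^sub>n \<in> D\<close>, \<open>0 \<le> u\<^sub>n \<le> 1\<close>, with
  \<open>u\<^sub>n \<rightarrow> 1\<close> a.e. and \<open>Q u\<^sub>n \<rightarrow> 0\<close>, which is a reformulation of (iii) once \<open>Q\<close> is known to be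
  lower semicontinuous under a.e. convergence.

  For a strictly positive integrable \<open>g \<le> 1\<close>, let \<open>u\<^sub>n\<close> solve \<open>L u\<^sub>n + u\<^sub>n / (n + 1) = g (1 - u\<^sub>n)\<close>.
  These solutions increase to some \<open>u \<le> 1\<close> in the extended space with \<open>L\<^sub>e u = g (1 - u)\<close>, and
  \<open>u = 1\<close> a.e. implies (iii). Under (ii), \<open>\<integral> g (1 - u) = 0\<close>, so \<open>u = 1\<close>. Under (i), testing the equation
  with the semigroup gives \<open>\<integral> (G g) g (1 - u) \<le> \<integral> g < \<infinity>\<close>, and \<open>G g = \<infinity>\<close> again forces \<open>u = 1\<close>.

  Conversely, (iii) gives (ii) by Cauchy-Schwarz against \<open>u\<^sub>n\<close>. For (iii) to (i), resolvents of indicators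
  of sets where \<open>G f\<close> is bounded vanish on \<open>{G f = \<infinity>}\<close>, so this set is invariant and by irreducibility
  null or conull. If it is null, \<open>h = min f 1 / (1 + G f)\<close> has resolvents \<open>v = (L + \<alpha>)\<^sup>-\<^sup>1 h\<close> of energy at
  most \<open>\<integral> f\<close> uniformly in \<open>\<alpha>\<close>, hence \<open>(\<integral> h u\<^sub>n)\<^sup>2 \<le> (\<integral> f) Q u\<^sub>n \<rightarrow> 0\<close> and \<open>f = 0\<close>.
\<close>

section \<open>Square-integrable functions and calculus of the form\<close>

text \<open>No spectral calculus is involved. Resolvents come from minimising an energy, and the
  semigroup is known only through its Cauchy problem and its L1 contractivity, so its positivity has
  to be derived; linearity of \<open>T\<close> is not part of its description. The link between
  potentials and the form is the identity \<open>\<integral> (T s f) (L u) ds = \<integral> f u -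
  \<integral> (T r f) u\<close> over \<open>0 \<le> s \<le> r\<close>, combined with positivity and
  the L1 bound.

  The main obstacle is that a sequence defining an element of the extended space carries no L2
  bound, so closedness of \<open>Q\<close> alone does not show that \<open>extQ1\<close> is
  independent of the sequence. Lower semicontinuity under a.e. convergence fills this gap.

  The term \<open>1 / (n + 1)\<close> makes the equilibrium equation coercive, since
  \<open>g\<close> may have infimum 0. Strict positivity of \<open>g\<close> turns
  \<open>g (1 - u) = 0\<close> into \<open>u = 1\<close>. The divisor \<open>1 + G f\<close> is
  chosen so that \<open>h (G f) \<le> f\<close>, which keeps the potentials of \<open>f\<close>
  bounded when paired with \<open>h\<close>.\<close>

lemma L2_measurable [measurable_dest]: "f \<in> L2 M \<Longrightarrow> f \<in> borel_measurable M"
  and L2_integrable_square: "f \<in> L2 M \<Longrightarrow> integrable M (\<lambda>x. (f x)\<^sup>2)"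
  by (auto simp: L2_def)

lemma L2_mult_integrable:
  assumes "f \<in> L2 M" "g \<in> L2 M"
  shows "integrable M (\<lambda>x. f x * g x)"
proof (rule Bochner_Integration.integrable_bound[of M "\<lambda>x. (f x)\<^sup>2 + (g x)\<^sup>2"])
  show "integrable M (\<lambda>x. (f x)\<^sup>2 + (g x)\<^sup>2)"
    using assms by (auto simp: L2_def)
  show "(\<lambda>x. f x * g x) \<in> borel_measurable M"
    using assms by (auto simp: L2_def)
  have "\<bar>a * b\<bar> \<le> a\<^sup>2 + b\<^sup>2" for a b :: real
    using sum_squares_bound[of "\<bar>a\<bar>" "\<bar>b\<bar>"] abs_ge_zero[of "a * b"]
    unfolding abs_mult power2_abs by linarith
  then show "AE x in M. norm (f x * g x) \<le> norm ((f x)\<^sup>2 + (g x)\<^sup>2)"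
    by (auto intro!: AE_I2)
qed

lemma L2_dominated:
  assumes "f \<in> L2 M" "g \<in> borel_measurable M" "AE x in M. \<bar>g x\<bar> \<le> \<bar>f x\<bar>"
  shows "g \<in> L2 M"
proof -
  have "integrable M (\<lambda>x. (g x)\<^sup>2)"
  proof (rule Bochner_Integration.integrable_bound[OF L2_integrable_square[OF assms(1)]])
    show "AE x in M. norm ((g x)\<^sup>2) \<le> norm ((f x)\<^sup>2)"
      using assms(3) by eventually_elim (simp add: abs_le_square_iff)
  qed (use assms in measurable)
  then show ?thesis using assms(2) by (simp add: L2_def)
qed

lemma L2_zero [simp, intro]: "(\<lambda>x. 0) \<in> L2 M"
  by (simp add: L2_def)

lemma L2_scale [simp, intro]: "f \<in> L2 M \<Longrightarrow> (\<lambda>x. c * f x) \<in> L2 M"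
  by (auto simp: L2_def power_mult_distrib)

lemma L2_add [simp, intro]:
  assumes "f \<in> L2 M" "g \<in> L2 M" shows "(\<lambda>x. f x + g x) \<in> L2 M"
proof -
  have "integrable M (\<lambda>x. (f x)\<^sup>2 + (g x)\<^sup>2 + 2 * (f x * g x))"
    using assms L2_mult_integrable[OF assms] by (simp add: L2_integrable_square)
  then show ?thesis using assms by (auto simp: L2_def power2_sum algebra_simps)
qed

lemma L2_diff [simp, intro]:
  assumes "f \<in> L2 M" "g \<in> L2 M" shows "(\<lambda>x. f x - g x) \<in> L2 M"
  using L2_add[OF assms(1) L2_scale[OF assms(2), of "-1"]] by simp

lemma L2_bounded_mult:
  assumes "f \<in> L2 M" "r \<in> borel_measurable M" "\<And>x. x \<in> space M \<Longrightarrow> \<bar>r x\<bar> \<le> B"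
  shows "(\<lambda>x. r x * f x) \<in> L2 M"
proof (rule L2_dominated[OF L2_scale[OF assms(1), of B]])
  show "AE x in M. \<bar>r x * f x\<bar> \<le> \<bar>B * f x\<bar>"
  proof (rule AE_I2)
    fix x assume "x \<in> space M"
    then have "\<bar>r x\<bar> \<le> \<bar>B\<bar>" using assms(3)[of x] by linarith
    then show "\<bar>r x * f x\<bar> \<le> \<bar>B * f x\<bar>" by (simp add: abs_mult mult_right_mono)
  qed
qed (use assms in measurable)

lemma L2_bounded_integrable:
  fixes f :: "'a \<Rightarrow> real"
  assumes "integrable M f" "AE x in M. \<bar>f x\<bar> \<le> B"
  shows "f \<in> L2 M"
proof -
  have "integrable M (\<lambda>x. (f x)\<^sup>2)"
  proof (rule Bochner_Integration.integrable_bound)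
    show "integrable M (\<lambda>x. B * f x)" using assms(1) by simp
    show "AE x in M. norm ((f x)\<^sup>2) \<le> norm (B * f x)"
      using assms(2)
    proof eventually_elim
      case (elim x)
      then have "\<bar>f x\<bar> * \<bar>f x\<bar> \<le> \<bar>B\<bar> * \<bar>f x\<bar>" by (intro mult_right_mono) auto
      then show ?case by (simp add: power2_eq_square abs_mult)
    qed
  qed (use assms in measurable)
  then show ?thesis using assms by (simp add: L2_def)
qed

text \<open>Stated for real coefficients because it serves three times: for integrals, for
  \<open>Q\<close>, and in \<open>ex_resolvent\<close> for near-minimisers, where \<open>a\<close>
  bounds the remaining gap to the infimum.\<close>

lemma discriminant_le:
  fixes a b c :: real
  assumes "\<And>t. 0 \<le> a + 2 * t * b + t\<^sup>2 * c" "0 \<le> c"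
  shows "b\<^sup>2 \<le> a * c"
proof (cases "c = 0")
  case True
  have "b = 0"
  proof (rule ccontr)
    assume "b \<noteq> 0"
    \<comment> \<open>At this \<open>t\<close> the affine function has the value -1.\<close>
    then show False using assms(1)[of "- (a + 1) / (2 * b)"] True by (simp add: field_simps)
  qed
  then show ?thesis using True by simp
next
  case False
  then show ?thesis using assms(1)[of "- b / c"] assms(2)
    by (simp add: field_simps power2_eq_square)
qed

lemma integral_Cauchy_Schwarz:
  assumes "f \<in> L2 M" "g \<in> L2 M"
  shows "(\<integral>x. f x * g x \<partial>M)\<^sup>2 \<le> (\<integral>x. (f x)\<^sup>2 \<partial>M) * (\<integral>x. (g x)\<^sup>2 \<partial>M)"
proof (rule discriminant_le)
  fix t :: real
  have "0 \<le> (\<integral>x. (f x + t * g x)\<^sup>2 \<partial>M)" by simp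
  also have "\<dots> = (\<integral>x. (f x)\<^sup>2 + 2 * t * (f x * g x) + t\<^sup>2 * (g x)\<^sup>2 \<partial>M)"
    by (intro Bochner_Integration.integral_cong) (auto simp: power2_eq_square algebra_simps)
  also have "\<dots> = (\<integral>x. (f x)\<^sup>2 \<partial>M) + 2 * t * (\<integral>x. f x * g x \<partial>M) + t\<^sup>2 * (\<integral>x. (g x)\<^sup>2 \<partial>M)"
    using L2_mult_integrable[OF assms] assms[THEN L2_integrable_square] by simp
  finally show "0 \<le> (\<integral>x. (f x)\<^sup>2 \<partial>M) + 2 * t * (\<integral>x. f x * g x \<partial>M) + t\<^sup>2 * (\<integral>x. (g x)\<^sup>2 \<partial>M)" .
qed simp

text \<open>A weak triangle inequality for squared norms; the factor 2 spares square roots.\<close>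

lemma integral_square_add_le:
  assumes "f \<in> L2 M" "g \<in> L2 M"
  shows "(\<integral>x. (f x + g x)\<^sup>2 \<partial>M) \<le> 2 * (\<integral>x. (f x)\<^sup>2 \<partial>M) + 2 * (\<integral>x. (g x)\<^sup>2 \<partial>M)"
proof -
  have "(a + b)\<^sup>2 \<le> 2 * a\<^sup>2 + 2 * b\<^sup>2" for a b :: real
    using sum_squares_bound[of a b] by (simp add: power2_sum)
  then have "(\<integral>x. (f x + g x)\<^sup>2 \<partial>M) \<le> (\<integral>x. 2 * (f x)\<^sup>2 + 2 * (g x)\<^sup>2 \<partial>M)"
    using assms by (intro integral_mono L2_integrable_square L2_add) (auto simp: L2_integrable_square)
  then show ?thesis using assms by (simp add: L2_integrable_square)
qed

lemma integral_square_eq_0_AE: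
  assumes "f \<in> L2 M" "(\<integral>x. (f x)\<^sup>2 \<partial>M) \<le> 0"
  shows "AE x in M. f x = 0"
proof -
  have "(\<integral>x. (f x)\<^sup>2 \<partial>M) = 0"
    using assms(2) by (intro antisym) auto
  then show ?thesis
    using integral_nonneg_eq_0_iff_AE[OF L2_integrable_square[OF assms(1)]] by simp
qed

lemma tendsto_sandwich_zero:
  fixes f g :: "'b \<Rightarrow> real"
  assumes "eventually (\<lambda>n. 0 \<le> f n) F" "eventually (\<lambda>n. f n \<le> g n) F" "(g \<longlongrightarrow> 0) F"
  shows "(f \<longlongrightarrow> 0) F"
  by (rule tendsto_sandwich[OF assms(1,2) tendsto_const assms(3)])

lemma tendsto_zero_square:
  fixes f g :: "'b \<Rightarrow> real"
  assumes "eventually (\<lambda>n. (f n)\<^sup>2 \<le> g n) F" "(g \<longlongrightarrow> 0) F"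
  shows "(f \<longlongrightarrow> 0) F"
proof -
  have "((\<lambda>n. (f n)\<^sup>2) \<longlongrightarrow> 0) F"
    using assms by (intro tendsto_sandwich_zero[of "\<lambda>n. (f n)\<^sup>2"]) auto
  from tendsto_real_sqrt[OF this] have "((\<lambda>n. \<bar>f n\<bar>) \<longlongrightarrow> 0) F" by simp
  then show ?thesis by (simp add: tendsto_rabs_zero_iff)
qed

text \<open>Strong convergence in L2 implies weak convergence. The filter is general so that
  sequences, time continuity and difference quotients are all covered; for the latter two,
  membership in L2 is only known eventually.\<close>

lemma integral_mult_tendsto:
  assumes "\<forall>\<^sub>F n in F. f n \<in> L2 M" "h \<in> L2 M" "g \<in> L2 M"
    and "((\<lambda>n. \<integral>x. (f n x - h x)\<^sup>2 \<partial>M) \<longlongrightarrow> 0) F"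
  shows "((\<lambda>n. \<integral>x. f n x * g x \<partial>M) \<longlongrightarrow> (\<integral>x. h x * g x \<partial>M)) F"
proof (rule LIM_zero_cancel, rule tendsto_zero_square)
  show "\<forall>\<^sub>F n in F. ((\<integral>x. f n x * g x \<partial>M) - (\<integral>x. h x * g x \<partial>M))\<^sup>2 \<le> (\<integral>x. (f n x - h x)\<^sup>2 \<partial>M) * (\<integral>x. (g x)\<^sup>2 \<partial>M)"
    using assms(1)
  proof eventually_elim
    case (elim n)
    have "(\<integral>x. f n x * g x \<partial>M) - (\<integral>x. h x * g x \<partial>M) = (\<integral>x. (f n x - h x) * g x \<partial>M)"
      using elim assms(2,3) by (simp add: left_diff_distrib L2_mult_integrable)
    then show ?case using integral_Cauchy_Schwarz[OF L2_diff[OF elim assms(2)] assms(3)] by simp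
  qed
  show "((\<lambda>n. (\<integral>x. (f n x - h x)\<^sup>2 \<partial>M) * (\<integral>x. (g x)\<^sup>2 \<partial>M)) \<longlongrightarrow> 0) F"
    by (intro tendsto_mult_left_zero assms(4))
qed

lemma l2norm_square: "(l2norm M f)\<^sup>2 = (\<integral>x. (f x)\<^sup>2 \<partial>M)"
  by (simp add: l2norm_def)

section \<open>The form as a semi-inner product on \<open>D\<close>\<close>

locale dirichlet_space = sigma_finite_measure M
  for M :: "'a measure" +
  fixes D :: "('a \<Rightarrow> real) set" and Q :: "('a \<Rightarrow> real) \<Rightarrow> ('a \<Rightarrow> real) \<Rightarrow> real"
  assumes form: "dirichlet_form M D Q"
begin

abbreviation Qsq :: "('a \<Rightarrow> real) \<Rightarrow> real" where "Qsq f \<equiv> Q f f"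

abbreviation pairing :: "('a \<Rightarrow> real) \<Rightarrow> ('a \<Rightarrow> real) \<Rightarrow> real" where
  "pairing f g \<equiv> \<integral>x. f x * g x \<partial>M"

abbreviation Lsq :: "('a \<Rightarrow> real) \<Rightarrow> real" where "Lsq f \<equiv> \<integral>x. (f x)\<^sup>2 \<partial>M"

abbreviation gen :: "('a \<Rightarrow> real) \<Rightarrow> ('a \<Rightarrow> real) \<Rightarrow> bool" where "gen \<equiv> gen_rel M D Q"

lemmas form_unfolded = form[unfolded dirichlet_form_def]

lemma D_L2 [dest]: "f \<in> D \<Longrightarrow> f \<in> L2 M"
  using form_unfolded[THEN conjunct1] by blast

lemma D_measurable [measurable_dest]: "f \<in> D \<Longrightarrow> f \<in> borel_measurable M"
  by (auto dest: L2_measurable)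

lemma D_cong: "f \<in> D \<Longrightarrow> g \<in> borel_measurable M \<Longrightarrow> AE x in M. f x = g x \<Longrightarrow> g \<in> D"
  and Q_cong_left: "f \<in> D \<Longrightarrow> g \<in> borel_measurable M \<Longrightarrow> AE x in M. f x = g x \<Longrightarrow> h \<in> D \<Longrightarrow> Q g h = Q f h"
  using form_unfolded[THEN conjunct2, THEN conjunct1] by blast+

lemma D_zero [simp, intro]: "(\<lambda>x. 0) \<in> D"
  and D_add [simp, intro]: "f \<in> D \<Longrightarrow> g \<in> D \<Longrightarrow> (\<lambda>x. f x + g x) \<in> D"
  and D_scale [simp, intro]: "f \<in> D \<Longrightarrow> (\<lambda>x. c * f x) \<in> D"
  using form_unfolded[THEN conjunct2, THEN conjunct2, THEN conjunct1]
    form_unfolded[THEN conjunct2, THEN conjunct2, THEN conjunct2, THEN conjunct1]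
    form_unfolded[THEN conjunct2, THEN conjunct2, THEN conjunct2, THEN conjunct2, THEN conjunct1] by blast+

lemma Q_sym: "f \<in> D \<Longrightarrow> g \<in> D \<Longrightarrow> Q f g = Q g f"
  and Q_add_left: "f \<in> D \<Longrightarrow> g \<in> D \<Longrightarrow> h \<in> D \<Longrightarrow> Q (\<lambda>x. f x + g x) h = Q f h + Q g h"
  and Q_scale_left: "f \<in> D \<Longrightarrow> h \<in> D \<Longrightarrow> Q (\<lambda>x. c * f x) h = c * Q f h"
  and Q_nonneg [simp]: "f \<in> D \<Longrightarrow> 0 \<le> Qsq f"
  using form_unfolded[THEN conjunct2, THEN conjunct2, THEN conjunct2, THEN conjunct2, THEN conjunct2, THEN conjunct1]
    form_unfolded[THEN conjunct2, THEN conjunct2, THEN conjunct2, THEN conjunct2, THEN conjunct2, THEN conjunct2, THEN conjunct1]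
    form_unfolded[THEN conjunct2, THEN conjunct2, THEN conjunct2, THEN conjunct2, THEN conjunct2, THEN conjunct2, THEN conjunct2, THEN conjunct1]
    form_unfolded[THEN conjunct2, THEN conjunct2, THEN conjunct2, THEN conjunct2, THEN conjunct2, THEN conjunct2, THEN conjunct2, THEN conjunct2, THEN conjunct1] by blast+

lemma D_complete:
  assumes "\<And>n. u n \<in> D"
    and "\<And>e. e > 0 \<Longrightarrow> \<exists>N. \<forall>n\<ge>N. \<forall>m\<ge>N.
           Qsq (\<lambda>x. u n x - u m x) + Lsq (\<lambda>x. u n x - u m x) < e"
  obtains v where "v \<in> D" "(\<lambda>n. Qsq (\<lambda>x. u n x - v x) + Lsq (\<lambda>x. u n x - v x)) \<longlonglongrightarrow> 0"
proof -
  have "(\<forall>n. u n \<in> D) \<and> (\<forall>e>0. \<exists>N. \<forall>n\<ge>N. \<forall>m\<ge>N.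
             Qsq (\<lambda>x. u n x - u m x) + Lsq (\<lambda>x. u n x - u m x) < e)
        \<longrightarrow> (\<exists>v\<in>D. (\<lambda>n. Qsq (\<lambda>x. u n x - v x) + Lsq (\<lambda>x. u n x - v x)) \<longlonglongrightarrow> 0)"
    using spec[OF form_unfolded[THEN conjunct2, THEN conjunct2, THEN conjunct2, THEN conjunct2, THEN conjunct2, THEN conjunct2,
        THEN conjunct2, THEN conjunct2, THEN conjunct2, THEN conjunct2, THEN conjunct1], of u]
    unfolding l2norm_square .
  then have "\<exists>v\<in>D. (\<lambda>n. Qsq (\<lambda>x. u n x - v x) + Lsq (\<lambda>x. u n x - v x)) \<longlonglongrightarrow> 0"
    by (rule mp) (intro conjI allI impI assms)
  then show ?thesis by (elim bexE) (rule that)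
qed

lemma contraction_D: "f \<in> D \<Longrightarrow> C 0 = 0 \<Longrightarrow> (\<And>s t. \<bar>C s - C t\<bar> \<le> \<bar>s - t\<bar>) \<Longrightarrow> (\<lambda>x. C (f x)) \<in> D"
  and Q_contraction: "f \<in> D \<Longrightarrow> C 0 = 0 \<Longrightarrow> (\<And>s t. \<bar>C s - C t\<bar> \<le> \<bar>s - t\<bar>) \<Longrightarrow>
     Qsq (\<lambda>x. C (f x)) \<le> Qsq f"
  for C :: "real \<Rightarrow> real"
  using form_unfolded[THEN conjunct2, THEN conjunct2, THEN conjunct2, THEN conjunct2, THEN conjunct2, THEN conjunct2, THEN conjunct2, THEN conjunct2, THEN conjunct2, THEN conjunct2, THEN conjunct2] by blast+

lemma D_diff [simp, intro]: "f \<in> D \<Longrightarrow> g \<in> D \<Longrightarrow> (\<lambda>x. f x - g x) \<in> D"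
  using D_add[of f "\<lambda>x. -1 * g x"] D_scale[of g "-1"] by simp

lemma Q_diff_left: "f \<in> D \<Longrightarrow> g \<in> D \<Longrightarrow> h \<in> D \<Longrightarrow> Q (\<lambda>x. f x - g x) h = Q f h - Q g h"
  using Q_add_left[of f "\<lambda>x. -1 * g x" h] Q_scale_left[of g h "-1"] D_scale[of g "-1"] by simp

lemma Q_add_right: "f \<in> D \<Longrightarrow> g \<in> D \<Longrightarrow> h \<in> D \<Longrightarrow> Q h (\<lambda>x. f x + g x) = Q h f + Q h g"
  and Q_diff_right: "f \<in> D \<Longrightarrow> g \<in> D \<Longrightarrow> h \<in> D \<Longrightarrow> Q h (\<lambda>x. f x - g x) = Q h f - Q h g"
  and Q_scale_right: "f \<in> D \<Longrightarrow> h \<in> D \<Longrightarrow> Q h (\<lambda>x. c * f x) = c * Q h f"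
  by (simp_all add: Q_sym[of h] Q_add_left Q_diff_left Q_scale_left)

lemmas Q_linear = Q_add_left Q_diff_left Q_scale_left Q_add_right Q_diff_right Q_scale_right

lemma Q_cong:
  assumes "f \<in> D" "g \<in> borel_measurable M" "AE x in M. f x = g x"
  shows "Qsq g = Qsq f"
  using D_cong[OF assms] Q_cong_left[OF assms] Q_sym assms(1) by metis

lemma Q_Cauchy_Schwarz:
  assumes "f \<in> D" "g \<in> D" shows "(Q f g)\<^sup>2 \<le> Qsq f * Qsq g"
proof (rule discriminant_le)
  fix t :: real
  have "0 \<le> Qsq (\<lambda>x. f x + t * g x)" using assms by simp
  also have "\<dots> = Qsq f + 2 * t * Q f g + t\<^sup>2 * Qsq g"
    using assms by (simp add: Q_linear Q_sym[of g f] power2_eq_square algebra_simps)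
  finally show "0 \<le> Qsq f + 2 * t * Q f g + t\<^sup>2 * Qsq g" .
qed (use assms in simp)

lemma Q_square_diff:
  "f \<in> D \<Longrightarrow> g \<in> D \<Longrightarrow> Qsq (\<lambda>x. f x - g x) = Qsq f - 2 * Q f g + Qsq g"
  and Q_square_add:
  "f \<in> D \<Longrightarrow> g \<in> D \<Longrightarrow> Qsq (\<lambda>x. f x + g x) = Qsq f + 2 * Q f g + Qsq g"
  by (simp_all add: Q_linear Q_sym[of g f])

lemma Q_square_diff_commute:
  assumes "f \<in> D" "g \<in> D"
  shows "Qsq (\<lambda>x. f x - g x) = Qsq (\<lambda>x. g x - f x)"
  using assms by (simp add: Q_square_diff Q_sym[of g f])

text \<open>The parallelogram identity with the energy of the sum dropped.\<close>

lemma Q_square_diff_le: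
  assumes "f \<in> D" "g \<in> D"
  shows "Qsq (\<lambda>x. f x - g x) \<le> 2 * Qsq f + 2 * Qsq g"
  using Q_square_diff[OF assms] Q_square_add[OF assms] Q_nonneg[OF D_add[OF assms]] by linarith

text \<open>The map \<open>s \<mapsto> s - C s\<close> is a normal contraction too, so \<open>Q (f - C f) \<le> Q f\<close>.\<close>

lemma Q_monotone_contraction_nonneg:
  fixes C :: "real \<Rightarrow> real"
  assumes "f \<in> D" "C 0 = 0" "\<And>s t. \<bar>C s - C t\<bar> \<le> \<bar>s - t\<bar>" "mono C"
  shows "0 \<le> Q f (\<lambda>x. C (f x))"
proof -
  note Cf = contraction_D[of f C, OF assms(1-3)]
  have "\<bar>(s - C s) - (t - C t)\<bar> \<le> \<bar>s - t\<bar>" for s t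
  proof (cases "s \<le> t")
    case True
    then show ?thesis using monoD[OF assms(4) True] assms(3)[of s t] by linarith
  next
    case False
    then show ?thesis using monoD[OF assms(4), of t s] assms(3)[of s t] by linarith
  qed
  then have "Qsq (\<lambda>x. f x - C (f x)) \<le> Qsq f"
    by (intro Q_contraction[of f "\<lambda>s. s - C s"]) (use assms in auto)
  \<comment> \<open>Expanding \<open>Q (f - C f) \<le> Q f\<close> leaves
    \<open>2 * Q f (C f) \<ge> Q (C f) \<ge> 0\<close>.\<close>
  then show ?thesis
    using Q_square_diff[OF assms(1) Cf] Q_nonneg[OF Cf] by linarith
qed

lemma Q_tendsto_left:
  assumes "\<And>n. a n \<in> D" "b \<in> D" "h \<in> D" "(\<lambda>n. Qsq (\<lambda>x. a n x - b x)) \<longlonglongrightarrow> 0"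
  shows "(\<lambda>n. Q (a n) h) \<longlonglongrightarrow> Q b h"
proof -
  have "(\<lambda>n. Q (\<lambda>x. a n x - b x) h) \<longlonglongrightarrow> 0"
  proof (rule tendsto_zero_square)
    show "\<forall>\<^sub>F n in sequentially. (Q (\<lambda>x. a n x - b x) h)\<^sup>2 \<le> Qsq (\<lambda>x. a n x - b x) * Qsq h"
      using assms by (intro always_eventually allI Q_Cauchy_Schwarz) auto
    show "(\<lambda>n. Qsq (\<lambda>x. a n x - b x) * Qsq h) \<longlonglongrightarrow> 0"
      using tendsto_mult_right[OF assms(4)] by simp
  qed
  then have "(\<lambda>n. Q (a n) h - Q b h) \<longlonglongrightarrow> 0" using assms by (simp add: Q_linear)
  then show ?thesis by (rule LIM_zero_cancel)
qed

lemma Q_tendsto: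
  assumes "\<And>n. a n \<in> D" "a' \<in> D" "(\<lambda>n. Qsq (\<lambda>x. a n x - a' x)) \<longlonglongrightarrow> 0"
    and "\<And>n. b n \<in> D" "b' \<in> D" "(\<lambda>n. Qsq (\<lambda>x. b n x - b' x)) \<longlonglongrightarrow> 0"
  shows "(\<lambda>n. Q (a n) (b n)) \<longlonglongrightarrow> Q a' b'"
proof -
  have "(\<lambda>n. Q (\<lambda>x. a n x - a' x) (\<lambda>x. b n x - b' x)) \<longlonglongrightarrow> 0"
  proof (rule tendsto_zero_square)
    show "\<forall>\<^sub>F n in sequentially. (Q (\<lambda>x. a n x - a' x) (\<lambda>x. b n x - b' x))\<^sup>2 \<le>
       Qsq (\<lambda>x. a n x - a' x) * Qsq (\<lambda>x. b n x - b' x)"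
      using assms by (intro always_eventually allI Q_Cauchy_Schwarz) auto
  qed (use tendsto_mult[OF assms(3,6)] in simp)
  moreover have "(\<lambda>n. Q (a n) b') \<longlonglongrightarrow> Q a' b'" "(\<lambda>n. Q (b n) a') \<longlonglongrightarrow> Q b' a'"
    using assms by (auto intro!: Q_tendsto_left)
  ultimately have "(\<lambda>n. Q (\<lambda>x. a n x - a' x) (\<lambda>x. b n x - b' x) + Q (a n) b' + Q (b n) a' - Q a' b')
    \<longlonglongrightarrow> 0 + Q a' b' + Q b' a' - Q a' b'"
    by (intro tendsto_intros)
  moreover have "Q (b n) a' = Q a' (b n)" "Q b' a' = Q a' b'" for n
    using assms by (simp_all add: Q_sym)
  ultimately show ?thesis using assms by (simp add: Q_linear)
qed

text \<open>The Cauchy condition of \<open>approx_seq\<close> taken by itself. It has no L2 part, so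
  completeness of \<open>D\<close> in the form norm does not apply to it directly.\<close>

definition Q_Cauchy :: "(nat \<Rightarrow> 'a \<Rightarrow> real) \<Rightarrow> bool" where
  "Q_Cauchy u \<longleftrightarrow> (\<forall>e>0. \<exists>N. \<forall>n\<ge>N. \<forall>m\<ge>N. Qsq (\<lambda>x. u n x - u m x) < e)"

text \<open>A bounded increasing real sequence is Cauchy, and its increments dominate the energies.
  Applied with \<open>c\<close> the energies of resolvents and with \<open>c\<close> the integrals
  of equilibrium solutions against \<open>g\<close>.\<close>

lemma Q_Cauchy_if_increments:
  fixes c :: "nat \<Rightarrow> real"
  assumes "\<And>n. u n \<in> D" "\<And>n m. n \<le> m \<Longrightarrow> Qsq (\<lambda>x. u m x - u n x) \<le> c m - c n"
    and "\<And>n. c n \<le> K"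
  shows "Q_Cauchy u"
  unfolding Q_Cauchy_def
proof (intro allI impI)
  fix e :: real assume "e > 0"
  have "incseq c"
  proof (rule incseq_SucI)
    fix n show "c n \<le> c (Suc n)"
      using assms(2)[of n "Suc n"] Q_nonneg[OF D_diff[OF assms(1)[of "Suc n"] assms(1)[of n]]] by linarith
  qed
  then have "Cauchy c"
    by (metis assms(3) incseq_convergent LIMSEQ_imp_Cauchy)
  then obtain N where N: "\<And>n m. n \<ge> N \<Longrightarrow> m \<ge> N \<Longrightarrow> \<bar>c n - c m\<bar> < e"
    using \<open>e > 0\<close> unfolding Cauchy_def dist_real_def by blast
  have "Qsq (\<lambda>x. u n x - u m x) < e" if "n \<ge> N" "m \<ge> N" for n m
    using N[OF that] assms(2)[of n m] assms(2)[of m n] Q_square_diff_commute[OF assms(1)[of n] assms(1)[of m]]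
    by (cases "n \<le> m") auto
  then show "\<exists>N. \<forall>n\<ge>N. \<forall>m\<ge>N. Qsq (\<lambda>x. u n x - u m x) < e" by blast
qed

text \<open>Closedness for a sequence whose L2 limit is already known: the limit supplied by
  completeness agrees a.e. with \<open>f\<close>, so convergence in \<open>Q\<close> is towards
  \<open>f\<close> itself.\<close>

lemma D_closed:
  assumes "\<And>n. u n \<in> D" "Q_Cauchy u" "f \<in> L2 M" "(\<lambda>n. Lsq (\<lambda>x. u n x - f x)) \<longlonglongrightarrow> 0"
  shows "f \<in> D" and "(\<lambda>n. Qsq (\<lambda>x. u n x - f x)) \<longlonglongrightarrow> 0"
proof -
  have "\<exists>N. \<forall>n\<ge>N. \<forall>m\<ge>N. Qsq (\<lambda>x. u n x - u m x) + Lsq (\<lambda>x. u n x - u m x) < e"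
    if "e > 0" for e
  proof -
    obtain N1 where N1: "\<And>n m. n \<ge> N1 \<Longrightarrow> m \<ge> N1 \<Longrightarrow> Qsq (\<lambda>x. u n x - u m x) < e / 2"
      using assms(2) \<open>e > 0\<close> unfolding Q_Cauchy_def by (meson half_gt_zero)
    have "\<forall>\<^sub>F n in sequentially. Lsq (\<lambda>x. u n x - f x) < e / 8"
      using order_tendstoD(2)[OF assms(4), of "e / 8"] \<open>e > 0\<close> by simp
    then obtain N2 where N2: "\<And>n. n \<ge> N2 \<Longrightarrow> Lsq (\<lambda>x. u n x - f x) < e / 8"
      unfolding eventually_sequentially by blast
    have le: "Lsq (\<lambda>x. u n x - u m x) \<le> 2 * Lsq (\<lambda>x. u n x - f x) + 2 * Lsq (\<lambda>x. u m x - f x)" for n m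
      using integral_square_add_le[of "\<lambda>x. u n x - f x" M "\<lambda>x. f x - u m x"] assms(1,3)
      by (simp add: D_L2 power2_commute[of "f _"])
    have "Qsq (\<lambda>x. u n x - u m x) + Lsq (\<lambda>x. u n x - u m x) < e"
      if "n \<ge> max N1 N2" "m \<ge> max N1 N2" for n m
      using N1[of n m] N2[of n] N2[of m] le[of n m] that by simp
    then show ?thesis by blast
  qed
  then obtain v where v: "v \<in> D" and
    lim: "(\<lambda>n. Qsq (\<lambda>x. u n x - v x) + Lsq (\<lambda>x. u n x - v x)) \<longlonglongrightarrow> 0"
    using D_complete[of u] assms(1) by blast
  have limQ: "(\<lambda>n. Qsq (\<lambda>x. u n x - v x)) \<longlonglongrightarrow> 0"
    and limv: "(\<lambda>n. Lsq (\<lambda>x. u n x - v x)) \<longlonglongrightarrow> 0"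
    using v assms(1) by (auto intro!: tendsto_sandwich_zero[OF _ _ lim] always_eventually)
  have lim2: "(\<lambda>n. 2 * Lsq (\<lambda>x. u n x - f x) + 2 * Lsq (\<lambda>x. u n x - v x)) \<longlonglongrightarrow> 2 * 0 + 2 * 0"
    by (intro tendsto_intros assms(4) limv)
  have le2: "Lsq (\<lambda>x. v x - f x) \<le> 2 * Lsq (\<lambda>x. u n x - f x) + 2 * Lsq (\<lambda>x. u n x - v x)" for n
    using integral_square_add_le[of "\<lambda>x. u n x - f x" M "\<lambda>x. v x - u n x"] assms(1,3) v
    by (simp add: D_L2 power2_commute[of "v _" "u _ _"])
  have "Lsq (\<lambda>x. v x - f x) \<le> 0"
    using LIMSEQ_le_const[OF lim2] le2 by simp
  then have ae: "AE x in M. v x = f x"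
    using integral_square_eq_0_AE[of "\<lambda>x. v x - f x" M] v assms(3) by (simp add: D_L2)
  note [measurable] = assms(3)[THEN L2_measurable]
  show f: "f \<in> D" by (rule D_cong[OF v _ ae]) measurable
  have "Qsq (\<lambda>x. u n x - f x) = Qsq (\<lambda>x. u n x - v x)" for n
    using ae assms(1)[of n] f v by (intro Q_cong) (auto simp: D_measurable)
  with limQ show "(\<lambda>n. Qsq (\<lambda>x. u n x - f x)) \<longlonglongrightarrow> 0" by simp
qed

end

section \<open>Resolvents as energy minimisers\<close>

lemma one_over_Suc_tendsto_0: "(\<lambda>n. 1 / (real n + 1)) \<longlonglongrightarrow> 0"
  using LIMSEQ_inverse_real_of_nat by (simp add: inverse_eq_divide add.commute)

context dirichlet_space begin

lemma gen_rel_D: "gen v w \<Longrightarrow> v \<in> D"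
  and gen_rel_L2: "gen v w \<Longrightarrow> w \<in> L2 M"
  and gen_rel_Q: "gen v w \<Longrightarrow> u \<in> D \<Longrightarrow> Q v u = pairing w u"
  by (auto simp: gen_rel_def ip_def)

lemma gen_relI:
  "v \<in> D \<Longrightarrow> w \<in> L2 M \<Longrightarrow> (\<And>u. u \<in> D \<Longrightarrow> pairing w u = Q v u) \<Longrightarrow> gen v w"
  by (auto simp: gen_rel_def ip_def)

lemma gen_rel_cong:
  assumes "gen v w" "v' \<in> borel_measurable M" "w' \<in> borel_measurable M"
    "AE x in M. v x = v' x" "AE x in M. w x = w' x"
  shows "gen v' w'"
proof (rule gen_relI)
  note v = gen_rel_D[OF assms(1)] and w = gen_rel_L2[OF assms(1)]
  show "v' \<in> D" by (rule D_cong[OF v assms(2,4)])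
  show "w' \<in> L2 M" using assms(5) by (intro L2_dominated[OF w assms(3)]) (auto elim: AE_mp)
  fix u assume u: "u \<in> D"
  note [measurable] = assms(3) L2_measurable[OF w] D_measurable[OF u]
  have "pairing w' u = pairing w u"
    using assms(5) by (intro integral_cong_AE) auto
  also have "\<dots> = Q v' u" using gen_rel_Q[OF assms(1) u] Q_cong_left[OF v assms(2,4) u] by simp
  finally show "pairing w' u = Q v' u" .
qed

lemma gen_rel_diff:
  assumes "gen v w" "gen v' w'"
  shows "gen (\<lambda>x. v x - v' x) (\<lambda>x. w x - w' x)"
proof (rule gen_relI)
  note D = assms[THEN gen_rel_D] and L = assms[THEN gen_rel_L2]
  show "(\<lambda>x. v x - v' x) \<in> D" "(\<lambda>x. w x - w' x) \<in> L2 M" using D L by auto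
  fix u assume u: "u \<in> D"
  have "(\<integral>x. (w x - w' x) * u x \<partial>M) = (\<integral>x. w x * u x - w' x * u x \<partial>M)"
    by (simp add: left_diff_distrib)
  also have "\<dots> = Q v u - Q v' u"
    using L u by (simp add: L2_mult_integrable D_L2 gen_rel_Q[OF assms(1)] gen_rel_Q[OF assms(2)])
  finally show "(\<integral>x. (w x - w' x) * u x \<partial>M) = Q (\<lambda>x. v x - v' x) u"
    using D u by (simp add: Q_linear)
qed

text \<open>Constant weights give the resolvents; variable ones occur because the equilibrium
  equation has the zero-order coefficient \<open>g + 1 / (n + 1)\<close>. The lower bound provides
  coercivity, the upper bound integrability.\<close>

definition weight :: "('a \<Rightarrow> real) \<Rightarrow> bool" where
  "weight \<rho> \<longleftrightarrow> \<rho> \<in> borel_measurable M \<and> (\<exists>\<alpha>>0. \<exists>B. \<forall>x\<in>space M. \<alpha> \<le> \<rho> x \<and> \<rho> x \<le> B)"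

lemma weight_const: "\<beta> > 0 \<Longrightarrow> weight (\<lambda>x. \<beta>)"
  unfolding weight_def by auto

lemma weight_measurable [measurable_dest]: "weight \<rho> \<Longrightarrow> \<rho> \<in> borel_measurable M"
  by (simp add: weight_def)

lemma weight_nonneg: "weight \<rho> \<Longrightarrow> x \<in> space M \<Longrightarrow> 0 \<le> \<rho> x"
  unfolding weight_def by force

lemma weight_L2:
  assumes "weight \<rho>" "f \<in> L2 M" shows "(\<lambda>x. \<rho> x * f x) \<in> L2 M"
proof -
  obtain \<alpha> B where B: "\<alpha> > 0" "\<And>x. x \<in> space M \<Longrightarrow> \<alpha> \<le> \<rho> x \<and> \<rho> x \<le> B"
    using assms(1) by (auto simp: weight_def)
  then have "\<bar>\<rho> x\<bar> \<le> B" if "x \<in> space M" for x using B(2)[OF that] by linarith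
  with assms show ?thesis by (intro L2_bounded_mult) (auto simp: weight_def)
qed

lemma weight_integrable:
  "weight \<rho> \<Longrightarrow> f \<in> L2 M \<Longrightarrow> g \<in> L2 M \<Longrightarrow> integrable M (\<lambda>x. \<rho> x * (f x * g x))"
  using L2_mult_integrable[OF weight_L2] by (simp add: mult.assoc)

text \<open>The solution \<open>v\<close> of \<open>L v = \<rho> (f - v)\<close> minimises \<open>energy \<rho> f\<close>; for constant weight \<open>\<rho> = \<beta>\<close> it is
  the resolvent \<open>\<beta> (L + \<beta>)\<^sup>-\<^sup>1 f\<close>.\<close>

definition energy :: "('a \<Rightarrow> real) \<Rightarrow> ('a \<Rightarrow> real) \<Rightarrow> ('a \<Rightarrow> real) \<Rightarrow> real" where
  "energy \<rho> f z = Qsq z + (\<integral>x. \<rho> x * ((z x - f x) * (z x - f x)) \<partial>M)"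

lemma energy_nonneg: "weight \<rho> \<Longrightarrow> z \<in> D \<Longrightarrow> 0 \<le> energy \<rho> f z"
  unfolding energy_def by (intro add_nonneg_nonneg integral_nonneg_AE AE_I2 mult_nonneg_nonneg[OF weight_nonneg zero_le_square])
    auto

text \<open>The energy is exactly quadratic along lines. The linear coefficient is the defect in the
  Euler-Lagrange equation \<open>Q z p = \<integral> \<rho> (f - z) p\<close>, and the quadratic one
  is the energy of \<open>p\<close> for zero data.\<close>

lemma energy_expand:
  assumes "weight \<rho>" "f \<in> L2 M" "z \<in> D" "p \<in> D"
  shows "energy \<rho> f (\<lambda>x. z x + t * p x) =
    energy \<rho> f z + 2 * t * (Q z p + (\<integral>x. \<rho> x * ((z x - f x) * p x) \<partial>M)) + t\<^sup>2 * energy \<rho> (\<lambda>x. 0) p"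
proof -
  have z: "(\<lambda>x. z x - f x) \<in> L2 M" and p: "p \<in> L2 M" using assms by auto
  have "(\<integral>x. \<rho> x * ((z x + t * p x - f x) * (z x + t * p x - f x)) \<partial>M) =
    (\<integral>x. \<rho> x * ((z x - f x) * (z x - f x)) + 2 * t * (\<rho> x * ((z x - f x) * p x)) + t\<^sup>2 * (\<rho> x * (p x * p x)) \<partial>M)"
    by (intro Bochner_Integration.integral_cong) (auto simp: algebra_simps power2_eq_square)
  also have "\<dots> = (\<integral>x. \<rho> x * ((z x - f x) * (z x - f x)) \<partial>M) + 2 * t * (\<integral>x. \<rho> x * ((z x - f x) * p x) \<partial>M)
    + t\<^sup>2 * (\<integral>x. \<rho> x * (p x * p x) \<partial>M)"
    using weight_integrable[OF assms(1) z z] weight_integrable[OF assms(1) z p] weight_integrable[OF assms(1) p p]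
    by simp
  moreover have "Qsq (\<lambda>x. z x + t * p x) = Qsq z + 2 * t * Q z p + t\<^sup>2 * Qsq p"
    using assms by (simp add: Q_linear Q_sym[of p z] power2_eq_square algebra_simps)
  ultimately show ?thesis by (simp add: energy_def algebra_simps)
qed

text \<open>Coercivity: the lower bound of the weight controls the L2 part, so the energy for zero
  data dominates the squared form norm.\<close>

lemma energy_zero_bound:
  assumes "weight \<rho>"
  obtains K where "K > 0" "\<And>p. p \<in> D \<Longrightarrow> Qsq p + Lsq p \<le> K * energy \<rho> (\<lambda>x. 0) p"
proof -
  obtain \<alpha> B where \<alpha>: "\<alpha> > 0" "\<And>x. x \<in> space M \<Longrightarrow> \<alpha> \<le> \<rho> x \<and> \<rho> x \<le> B"
    using assms by (auto simp: weight_def)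
  have "Qsq p + Lsq p \<le> (1 + 1 / \<alpha>) * energy \<rho> (\<lambda>x. 0) p" if p: "p \<in> D" for p
  proof -
    have "\<alpha> * Lsq p = (\<integral>x. \<alpha> * (p x)\<^sup>2 \<partial>M)" by simp
    also have "\<dots> \<le> (\<integral>x. \<rho> x * (p x * p x) \<partial>M)"
      using assms p \<alpha>(2)
      by (intro integral_mono weight_integrable)
        (auto simp: L2_integrable_square power2_eq_square[symmetric] intro!: mult_right_mono)
    finally have "Lsq p \<le> 1 / \<alpha> * (\<integral>x. \<rho> x * (p x * p x) \<partial>M)"
      using \<alpha>(1) by (simp add: field_simps)
    moreover have "0 \<le> 1 / \<alpha> * Qsq p" "0 \<le> (\<integral>x. \<rho> x * (p x * p x) \<partial>M)"
      using \<alpha>(1) p assms by (auto intro!: integral_nonneg_AE AE_I2 mult_nonneg_nonneg simp: weight_nonneg)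
    ultimately show ?thesis unfolding energy_def by (simp add: algebra_simps)
  qed
  moreover have "1 + 1 / \<alpha> > 0" using \<alpha>(1) by (simp add: add_pos_pos)
  ultimately show ?thesis using that by blast
qed

text \<open>The direct method: a minimising sequence is Cauchy by the parallelogram argument, and
  completeness of \<open>D\<close> supplies the minimiser.\<close>

lemma ex_resolvent:
  assumes "weight \<rho>" "f \<in> L2 M"
  obtains v where "gen v (\<lambda>x. \<rho> x * (f x - v x))"
proof -
  define I where "I = (INF z\<in>D. energy \<rho> f z)"
  have bdd: "bdd_below (energy \<rho> f ` D)"
    using energy_nonneg[OF assms(1)] by (intro bdd_belowI2[of _ 0]) auto
  have I: "I \<le> energy \<rho> f z" if "z \<in> D" for z
    unfolding I_def by (rule cINF_lower[OF bdd that])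
  have "\<exists>z\<in>D. energy \<rho> f z < I + 1 / (real n + 1)" for n
  proof -
    have "(INF z\<in>D. energy \<rho> f z) < I + 1 / (real n + 1)" by (simp add: I_def)
    then show ?thesis using D_zero by (subst (asm) cINF_less_iff[OF _ bdd]) auto
  qed
  then obtain z where z: "\<And>n. z n \<in> D" and zI: "\<And>n. energy \<rho> f (z n) < I + 1 / (real n + 1)"
    by metis
  obtain K where K: "K > 0" "\<And>p. p \<in> D \<Longrightarrow> Qsq p + Lsq p \<le> K * energy \<rho> (\<lambda>x. 0) p"
    by (rule energy_zero_bound[OF assms(1)]) blast
  \<comment> \<open>The midpoint of \<open>z n\<close> and \<open>z m\<close> has energy at least
    \<open>I\<close>; both excess energies therefore bound the energy of the difference.\<close>
  have par: "energy \<rho> (\<lambda>x. 0) (\<lambda>x. z n x - z m x) \<le> 2 * (1 / (real n + 1)) + 2 * (1 / (real m + 1))" for n m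
  proof -
    let ?p = "\<lambda>x. z n x - z m x"
    have p: "?p \<in> D" using z by simp
    note e = energy_expand[OF assms z[of m] p]
    have "I \<le> energy \<rho> f (\<lambda>x. z m x + (1 / 2) * ?p x)" by (intro I D_add D_scale z p)
    then show ?thesis
      using e[of "1 / 2"] e[of 1] zI[of n] zI[of m] by (simp add: power2_eq_square)
  qed
  have "\<exists>N. \<forall>n\<ge>N. \<forall>m\<ge>N. Qsq (\<lambda>x. z n x - z m x) + Lsq (\<lambda>x. z n x - z m x) < e"
    if "e > 0" for e
  proof -
    obtain N where N: "1 / (real N + 1) < e / (4 * K)"
      using reals_Archimedean[of "e / (4 * K)"] \<open>e > 0\<close> K(1) by (auto simp: inverse_eq_divide add.commute)
    have "Qsq (\<lambda>x. z n x - z m x) + Lsq (\<lambda>x. z n x - z m x) < e"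
      if "n \<ge> N" "m \<ge> N" for n m
    proof -
      have "1 / (real n + 1) \<le> 1 / (real N + 1)" "1 / (real m + 1) \<le> 1 / (real N + 1)"
        using that by (auto simp: divide_simps)
      then have "energy \<rho> (\<lambda>x. 0) (\<lambda>x. z n x - z m x) < 4 * (e / (4 * K))" using par[of n m] N by linarith
      then have "K * energy \<rho> (\<lambda>x. 0) (\<lambda>x. z n x - z m x) < e" using K(1) by (simp add: field_simps)
      then show ?thesis using K(2)[of "\<lambda>x. z n x - z m x"] z by fastforce
    qed
    then show ?thesis by blast
  qed
  then obtain v where v: "v \<in> D" and
    lim: "(\<lambda>n. Qsq (\<lambda>x. z n x - v x) + Lsq (\<lambda>x. z n x - v x)) \<longlonglongrightarrow> 0"
    using D_complete[of z] z by blast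
  have limQ: "(\<lambda>n. Qsq (\<lambda>x. z n x - v x)) \<longlonglongrightarrow> 0"
    and lim2: "(\<lambda>n. Lsq (\<lambda>x. z n x - v x)) \<longlonglongrightarrow> 0"
    using v z by (auto intro!: tendsto_sandwich_zero[OF _ _ lim] always_eventually)
  have "gen v (\<lambda>x. \<rho> x * (f x - v x))"
  proof (rule gen_relI[OF v])
    show "(\<lambda>x. \<rho> x * (f x - v x)) \<in> L2 M" using v assms by (intro weight_L2 L2_diff) auto
    fix p assume p: "p \<in> D"
    \<comment> \<open>The defect of \<open>z n\<close> in the tested equation. Near-minimality makes
      its square at most a multiple of \<open>1 / (n + 1)\<close>, so only this linear expression
      has to pass to the limit, and the energy itself need not.\<close>
    define b where "b n = Q (z n) p + (\<integral>x. \<rho> x * ((z n x - f x) * p x) \<partial>M)" for n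
    have "(b n)\<^sup>2 \<le> 1 / (real n + 1) * energy \<rho> (\<lambda>x. 0) p" for n
    proof (rule discriminant_le)
      fix t :: real
      have "I \<le> energy \<rho> f (\<lambda>x. z n x + t * p x)" using z p by (intro I) auto
      then show "0 \<le> 1 / (real n + 1) + 2 * t * b n + t\<^sup>2 * energy \<rho> (\<lambda>x. 0) p"
        using energy_expand[OF assms z[of n] p, of t] zI[of n] unfolding b_def by linarith
    qed (use energy_nonneg assms p in auto)
    then have "b \<longlonglongrightarrow> 0"
      by (intro tendsto_zero_square[of b "\<lambda>n. 1 / (real n + 1) * energy \<rho> (\<lambda>x. 0) p"] always_eventually allI
          tendsto_mult_left_zero one_over_Suc_tendsto_0) assumption
    moreover have "b \<longlonglongrightarrow> Q v p + ((\<integral>x. v x * (\<rho> x * p x) \<partial>M) - (\<integral>x. f x * (\<rho> x * p x) \<partial>M))"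
    proof -
      have rp: "(\<lambda>x. \<rho> x * p x) \<in> L2 M" using p assms(1) by (intro weight_L2) auto
      have b_eq: "b n = Q (z n) p + ((\<integral>x. z n x * (\<rho> x * p x) \<partial>M) - (\<integral>x. f x * (\<rho> x * p x) \<partial>M))" for n
        using L2_mult_integrable[OF D_L2[OF z[of n]] rp] L2_mult_integrable[OF assms(2) rp]
        unfolding b_def
        by (subst Bochner_Integration.integral_diff[symmetric])
          (auto intro!: Bochner_Integration.integral_cong simp: algebra_simps)
      have "(\<lambda>n. \<integral>x. z n x * (\<rho> x * p x) \<partial>M) \<longlonglongrightarrow> (\<integral>x. v x * (\<rho> x * p x) \<partial>M)"
        using z v rp lim2 by (intro integral_mult_tendsto always_eventually allI) auto
      moreover have "(\<lambda>n. Q (z n) p) \<longlonglongrightarrow> Q v p"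
        using z v p limQ by (intro Q_tendsto_left) auto
      ultimately show ?thesis unfolding b_eq[abs_def] by (intro tendsto_intros)
    qed
    ultimately have "Q v p + ((\<integral>x. v x * (\<rho> x * p x) \<partial>M) - (\<integral>x. f x * (\<rho> x * p x) \<partial>M)) = 0"
      by (metis LIMSEQ_unique)
    moreover have "(\<integral>x. \<rho> x * (f x - v x) * p x \<partial>M) = (\<integral>x. f x * (\<rho> x * p x) \<partial>M) - (\<integral>x. v x * (\<rho> x * p x) \<partial>M)"
    proof -
      have rp: "(\<lambda>x. \<rho> x * p x) \<in> L2 M" using p assms(1) by (intro weight_L2) auto
      show ?thesis
        using L2_mult_integrable[OF D_L2[OF v] rp] L2_mult_integrable[OF assms(2) rp]
        by (subst Bochner_Integration.integral_diff[symmetric])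
          (auto intro!: Bochner_Integration.integral_cong simp: algebra_simps)
    qed
    ultimately show "(\<integral>x. \<rho> x * (f x - v x) * p x \<partial>M) = Q v p" by simp
  qed
  then show ?thesis by (rule that)
qed

text \<open>Pythagoras at the minimiser, where the linear term of \<open>energy_expand\<close>
  vanishes. A competitor of no greater energy must then coincide with \<open>v\<close> a.e.\<close>

lemma energy_resolvent:
  assumes "weight \<rho>" "f \<in> L2 M" "gen v (\<lambda>x. \<rho> x * (f x - v x))" "z \<in> D"
  shows "energy \<rho> f z = energy \<rho> f v + energy \<rho> (\<lambda>x. 0) (\<lambda>x. z x - v x)"
proof -
  note v = gen_rel_D[OF assms(3)]
  have p: "(\<lambda>x. z x - v x) \<in> D" using v assms(4) by simp
  have "Q v (\<lambda>x. z x - v x) = - (\<integral>x. \<rho> x * ((v x - f x) * (z x - v x)) \<partial>M)"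
    unfolding gen_rel_Q[OF assms(3) p] by (subst integral_minus[symmetric])
      (auto intro!: Bochner_Integration.integral_cong simp: algebra_simps)
  then show ?thesis using energy_expand[OF assms(1,2) v p, of 1] by simp
qed

lemma energy_zero_AE:
  assumes "weight \<rho>" "p \<in> D" "energy \<rho> (\<lambda>x. 0) p \<le> 0"
  shows "AE x in M. p x = 0"
proof -
  obtain K where K: "K > 0" "Qsq p + Lsq p \<le> K * energy \<rho> (\<lambda>x. 0) p"
    using energy_zero_bound[OF assms(1)] assms(2) by blast
  have "K * energy \<rho> (\<lambda>x. 0) p \<le> 0" using K(1) assms(3) by (simp add: mult_le_0_iff)
  then have "Lsq p \<le> 0" using K(2) Q_nonneg[OF assms(2)] by linarith
  then show ?thesis using assms(2) by (intro integral_square_eq_0_AE) auto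
qed

text \<open>Clipping \<open>v\<close> to \<open>[a, b]\<close> is a normal contraction because the
  interval contains 0, and it brings \<open>v\<close> nowhere further from \<open>f\<close>. The
  clipped function is thus also a minimiser, hence equal to \<open>v\<close>.\<close>

lemma resolvent_between:
  assumes "weight \<rho>" "f \<in> L2 M" "gen v (\<lambda>x. \<rho> x * (f x - v x))"
    and "a \<le> 0" "0 \<le> b" "AE x in M. a \<le> f x \<and> f x \<le> b"
  shows "AE x in M. a \<le> v x \<and> v x \<le> b"
proof -
  note v = gen_rel_D[OF assms(3)]
  define C where "C s = max a (min b s)" for s :: real
  have C: "C 0 = 0" "\<bar>C s - C t\<bar> \<le> \<bar>s - t\<bar>" for s t
    using assms(4,5) by (auto simp: C_def max_def min_def abs_if)
  have Cv: "(\<lambda>x. C (v x)) \<in> D" by (rule contraction_D[OF v C])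
  have "(\<integral>x. \<rho> x * ((C (v x) - f x) * (C (v x) - f x)) \<partial>M) \<le> (\<integral>x. \<rho> x * ((v x - f x) * (v x - f x)) \<partial>M)"
  proof (rule integral_mono_AE)
    show "AE x in M. \<rho> x * ((C (v x) - f x) * (C (v x) - f x)) \<le> \<rho> x * ((v x - f x) * (v x - f x))"
      using assms(6) AE_space
    proof eventually_elim
      case (elim x)
      then have "\<bar>C (v x) - f x\<bar> \<le> \<bar>v x - f x\<bar>" by (auto simp: C_def max_def min_def abs_if)
      then have "(C (v x) - f x) * (C (v x) - f x) \<le> (v x - f x) * (v x - f x)"
        unfolding abs_le_square_iff power2_eq_square .
      then show ?case using weight_nonneg[OF assms(1)] elim(2) by (intro mult_left_mono) auto
    qed
  qed (use assms Cv v in \<open>auto intro!: weight_integrable\<close>)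
  with Q_contraction[of v C, OF v C] have "energy \<rho> f (\<lambda>x. C (v x)) \<le> energy \<rho> f v"
    unfolding energy_def by linarith
  then have "AE x in M. C (v x) - v x = 0"
    using energy_resolvent[OF assms(1-3) Cv] Cv v by (intro energy_zero_AE[OF assms(1)]) auto
  then show ?thesis
    by eventually_elim (use assms(4,5) in \<open>auto simp: C_def max_def min_def split: if_splits\<close>)
qed

text \<open>Chooses a representative for which the bounds hold at every point, so that later
  domination arguments need no exceptional sets.\<close>

lemma ex_bounded_resolvent:
  assumes "weight \<rho>" "f \<in> L2 M" "a \<le> 0" "0 \<le> b" "AE x in M. a \<le> f x \<and> f x \<le> b"
  obtains v where "gen v (\<lambda>x. \<rho> x * (f x - v x))" "\<And>x. a \<le> v x \<and> v x \<le> b"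
proof -
  obtain v where v: "gen v (\<lambda>x. \<rho> x * (f x - v x))" using ex_resolvent[OF assms(1,2)] .
  note [measurable] = D_measurable[OF gen_rel_D[OF v]] L2_measurable[OF assms(2)] weight_measurable[OF assms(1)]
  have ae: "AE x in M. v x = max a (min b (v x))"
    using resolvent_between[OF assms(1,2) v assms(3-5)] by eventually_elim auto
  have "gen (\<lambda>x. max a (min b (v x))) (\<lambda>x. \<rho> x * (f x - max a (min b (v x))))"
    using ae by (intro gen_rel_cong[OF v]) auto
  then show ?thesis by (rule that) (use assms(3,4) in auto)
qed

lemma resolvent_unique:
  assumes "weight \<rho>" "gen v (\<lambda>x. \<rho> x * (f x - v x))" "gen v' (\<lambda>x. \<rho> x * (f x - v' x))"
  shows "AE x in M. v x = v' x"
proof -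
  have "(\<lambda>x. \<rho> x * (f x - v x) - \<rho> x * (f x - v' x)) = (\<lambda>x. \<rho> x * (0 - (v x - v' x)))"
    by (auto simp: algebra_simps)
  with gen_rel_diff[OF assms(2,3)] have "gen (\<lambda>x. v x - v' x) (\<lambda>x. \<rho> x * (0 - (v x - v' x)))"
    by simp
  \<comment> \<open>The difference is a resolvent of 0, so it lies between 0 and 0.\<close>
  from resolvent_between[OF assms(1) _ this, of 0 0] show ?thesis by (auto elim!: AE_mp)
qed

text \<open>Each equation is tested with the other solution; symmetry of \<open>Q\<close> makes the
  resolvent self-adjoint.\<close>

lemma resolvent_symmetric:
  assumes "f \<in> L2 M" "g \<in> L2 M" "\<beta> > 0"
    and "gen v (\<lambda>x. \<beta> * (f x - v x))" "gen u (\<lambda>x. \<beta> * (g x - u x))"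
  shows "pairing f u = pairing g v"
proof -
  note v = gen_rel_D[OF assms(4)] and u = gen_rel_D[OF assms(5)]
  have int: "integrable M (\<lambda>x. f x * u x)" "integrable M (\<lambda>x. g x * v x)" "integrable M (\<lambda>x. v x * u x)"
    using assms(1,2) u v by (auto intro!: L2_mult_integrable)
  have "Q v u = \<beta> * (\<integral>x. f x * u x - v x * u x \<partial>M)"
    unfolding gen_rel_Q[OF assms(4) u] by (subst integral_mult_right_zero[symmetric]) (simp add: algebra_simps)
  moreover have "Q u v = \<beta> * (\<integral>x. g x * v x - v x * u x \<partial>M)"
    unfolding gen_rel_Q[OF assms(5) v] by (subst integral_mult_right_zero[symmetric]) (simp add: algebra_simps)
  ultimately have "\<beta> * (pairing f u - pairing v u) = \<beta> * (pairing g v - pairing v u)"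
    using Q_sym[OF u v] int by simp
  then show ?thesis using assms(3) by simp
qed

text \<open>L1 contractivity by duality: the integral of \<open>\<bar>v\<bar>\<close> over a set of
  finite measure is the pairing of \<open>v\<close> with a sign function, and symmetry moves the
  resolvent onto that function, where it stays between -1 and 1. The bound does not depend on the
  set.\<close>

lemma resolvent_integrable:
  assumes "f \<in> L2 M" "integrable M f" "\<beta> > 0" "gen v (\<lambda>x. \<beta> * (f x - v x))"
  shows "integrable M v"
proof -
  note v = gen_rel_D[OF assms(4)]
  note [measurable] = D_measurable[OF v]
  obtain A :: "nat \<Rightarrow> 'a set" where A: "range A \<subseteq> sets M" "(\<Union>i. A i) = space M"
    "\<And>i. emeasure M (A i) \<noteq> \<infinity>" "incseq A"
    using sigma_finite_incseq by blast
  have [measurable]: "A i \<in> sets M" for i using A(1) by auto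
  have bound: "(\<integral>\<^sup>+x. ennreal \<bar>v x\<bar> * indicator (A i) x \<partial>M) \<le> ennreal (\<integral>x. \<bar>f x\<bar> \<partial>M)" for i
  proof -
    \<comment> \<open>The sign of \<open>v\<close>, cut to a set of finite measure so that it lies
      in L2.\<close>
    define s where "s x = (if 0 \<le> v x then 1 else - 1) * indicat_real (A i) x" for x
    have s_int: "integrable M s"
    proof (rule Bochner_Integration.integrable_bound)
      show "integrable M (indicat_real (A i))" using A(3)[of i] by (simp add: less_top)
      show "s \<in> borel_measurable M" unfolding s_def by measurable
    qed (auto simp: s_def indicator_def)
    have s1: "\<bar>s x\<bar> \<le> 1" for x by (auto simp: s_def indicator_def)
    have s: "s \<in> L2 M" using s_int s1 by (intro L2_bounded_integrable[of _ _ 1]) auto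
    have s1': "-1 \<le> s x \<and> s x \<le> 1" for x using s1[of x] by auto
    obtain y where y: "gen y (\<lambda>x. \<beta> * (s x - y x))" "\<And>x. -1 \<le> y x \<and> y x \<le> 1"
      using ex_bounded_resolvent[OF weight_const[OF assms(3)] s, of "-1" 1] s1' by auto
    have eq: "pairing f y = pairing s v"
      by (rule resolvent_symmetric[OF assms(1) s assms(3,4) y(1)])
    have sv: "s x * v x = \<bar>v x\<bar> * indicator (A i) x" for x by (auto simp: s_def indicator_def)
    have "(\<integral>\<^sup>+x. ennreal \<bar>v x\<bar> * indicator (A i) x \<partial>M) = (\<integral>\<^sup>+x. ennreal (s x * v x) \<partial>M)"
      by (intro nn_integral_cong) (auto simp: sv indicator_def)
    also have "\<dots> = ennreal (pairing s v)"
      using s v by (intro nn_integral_eq_integral L2_mult_integrable) (auto simp: sv)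
    also have "\<dots> \<le> ennreal (\<integral>x. \<bar>f x\<bar> \<partial>M)"
    proof (rule ennreal_leI, unfold eq[symmetric], rule integral_mono)
      show "integrable M (\<lambda>x. f x * y x)" using assms(1) gen_rel_D[OF y(1)] by (auto intro!: L2_mult_integrable)
      show "integrable M (\<lambda>x. \<bar>f x\<bar>)" using assms(2) by simp
      fix x
      have "\<bar>y x\<bar> \<le> 1" using y(2)[of x] by auto
      then have "\<bar>f x\<bar> * \<bar>y x\<bar> \<le> \<bar>f x\<bar> * 1" by (intro mult_left_mono) auto
      then show "f x * y x \<le> \<bar>f x\<bar>" using abs_ge_self[of "f x * y x"] by (simp add: abs_mult)
    qed
    finally show ?thesis .
  qed
  have "(\<integral>\<^sup>+x. ennreal \<bar>v x\<bar> \<partial>M) = (\<integral>\<^sup>+x. (SUP i. ennreal \<bar>v x\<bar> * indicator (A i) x) \<partial>M)"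
  proof (rule nn_integral_cong)
    fix x assume "x \<in> space M"
    then obtain i where i: "x \<in> A i" using A(2) by auto
    show "ennreal \<bar>v x\<bar> = (SUP i. ennreal \<bar>v x\<bar> * indicator (A i) x)"
      by (rule antisym, rule SUP_upper2[of i]) (use i in \<open>auto intro!: SUP_least simp: indicator_def\<close>)
  qed
  also have "\<dots> = (SUP i. \<integral>\<^sup>+x. ennreal \<bar>v x\<bar> * indicator (A i) x \<partial>M)"
  proof (rule nn_integral_monotone_convergence_SUP)
    show "incseq (\<lambda>i x. ennreal \<bar>v x\<bar> * indicator (A i) x)"
      using A(4) by (auto simp: incseq_def le_fun_def indicator_def intro!: mult_left_mono)
  qed measurable
  also have "\<dots> \<le> ennreal (\<integral>x. \<bar>f x\<bar> \<partial>M)" by (intro SUP_least bound)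
  also have "\<dots> < \<infinity>" by simp
  finally show ?thesis
    by (intro integrableI_bounded) auto
qed

text \<open>The resolvents \<open>\<beta> (L + \<beta>)\<^sup>-\<^sup>1 f\<close> with
  \<open>\<beta> = n + 1\<close> converge to \<open>f\<close> in the form norm. Minimality shows
  that their energies increase and that increments dominate the energies of differences, so
  \<open>D_closed\<close> applies.\<close>

lemma resolvent_approximation:
  assumes "f \<in> D" "\<And>n. gen (v n) (\<lambda>x. (real n + 1) * (f x - v n x))"
  shows "Q_Cauchy v" and "(\<lambda>n. Lsq (\<lambda>x. v n x - f x)) \<longlonglongrightarrow> 0"
    and "(\<lambda>n. Qsq (\<lambda>x. v n x - f x)) \<longlonglongrightarrow> 0"
    and "\<And>n. Qsq (v n) \<le> Qsq f"
proof -
  note v = gen_rel_D[OF assms(2)] and f = D_L2[OF assms(1)]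
  define q where "q n = Qsq (v n)" for n
  define a where "a n = Lsq (\<lambda>x. v n x - f x)" for n
  have w: "weight (\<lambda>x. real n + 1)" for n by (intro weight_const) auto
  have energy: "energy (\<lambda>x. real n + 1) f z = Qsq z + (real n + 1) * Lsq (\<lambda>x. z x - f x)" for n z
    by (simp add: energy_def power2_eq_square)
  have a0: "0 \<le> a n" for n by (simp add: a_def)
  have min: "q n + (real n + 1) * a n + Qsq (\<lambda>x. z x - v n x) \<le> Qsq z + (real n + 1) * Lsq (\<lambda>x. z x - f x)"
    if "z \<in> D" for z n
  proof -
    have "0 \<le> (\<integral>x. (real n + 1) * ((z x - v n x) * (z x - v n x)) \<partial>M)" by (simp add: integral_nonneg_AE)
    then show ?thesis
      using energy_resolvent[OF w f assms(2) that, of n] unfolding energy q_def a_def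
      unfolding energy_def by simp
  qed
  \<comment> \<open>The competitor \<open>f\<close> has distance 0 from the data, so its energy is
    just \<open>Qsq f\<close>.\<close>
  have qf: "q n + (real n + 1) * a n \<le> Qsq f" for n
    using min[OF assms(1), of n] Q_nonneg[OF D_diff[OF assms(1) v[of n]]] by simp
  show "Qsq (v n) \<le> Qsq f" for n
    using qf[of n] mult_nonneg_nonneg[OF _ a0, of "real n + 1" n] unfolding q_def by linarith
  have incr: "Qsq (\<lambda>x. v m x - v n x) \<le> q m - q n" if "n \<le> m" for n m
  proof -
    \<comment> \<open>Each of the two solutions competes in the problem of the other. The sum of the
      two inequalities shows that the distance to \<open>f\<close> decreases as the parameter
      grows.\<close>
    have 1: "q n + (real n + 1) * a n + Qsq (\<lambda>x. v m x - v n x) \<le> q m + (real n + 1) * a m"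
      using min[OF v[of m], of n] by (simp add: q_def a_def)
    have 2: "q m + (real m + 1) * a m + Qsq (\<lambda>x. v n x - v m x) \<le> q n + (real m + 1) * a n"
      using min[OF v[of n], of m] by (simp add: q_def a_def)
    have "a m \<le> a n" if "n < m"
    proof (rule ccontr)
      assume "\<not> a m \<le> a n"
      then have "(real m - real n) * (a m - a n) > 0" using that by simp
      moreover have "(real m - real n) * (a m - a n) \<le> 0"
        using 1 2 Q_nonneg[OF D_diff[OF v[of m] v[of n]]] Q_nonneg[OF D_diff[OF v[of n] v[of m]]]
        by (simp add: algebra_simps)
      ultimately show False by linarith
    qed
    then have "a m \<le> a n" using that by (cases "n = m") auto
    then have "(real n + 1) * a m \<le> (real n + 1) * a n" by (intro mult_left_mono) auto
    with 1 show ?thesis by linarith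
  qed
  have "q n \<le> Qsq f" for n using qf[of n] mult_nonneg_nonneg[OF _ a0, of "real n + 1" n] by linarith
  with incr v show C: "Q_Cauchy v" by (intro Q_Cauchy_if_increments[of v q]) auto
  have "a n \<le> Qsq f * inverse (real (Suc n))" for n
    using qf[of n] Q_nonneg[OF v[of n]] by (simp add: q_def field_simps)
  moreover have "(\<lambda>n. Qsq f * inverse (real (Suc n))) \<longlonglongrightarrow> 0"
    by (intro tendsto_mult_right_zero LIMSEQ_inverse_real_of_nat)
  ultimately have "a \<longlonglongrightarrow> 0"
    using a0 by (intro tendsto_sandwich_zero[of a _ "\<lambda>n. Qsq f * inverse (real (Suc n))"]) (auto intro!: always_eventually)
  then show L: "(\<lambda>n. Lsq (\<lambda>x. v n x - f x)) \<longlonglongrightarrow> 0" unfolding a_def .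
  show "(\<lambda>n. Qsq (\<lambda>x. v n x - f x)) \<longlonglongrightarrow> 0"
    by (rule D_closed(2)[OF v C f L])
qed

end

section \<open>Lower semicontinuity and the extended form\<close>

text \<open>A normal contraction that is bounded and vanishes near 0, so it maps \<open>L\<^sup>2\<close> into \<open>L\<^sup>1\<close>.\<close>

definition soft_clip :: "real \<Rightarrow> real \<Rightarrow> real" where
  "soft_clip k s = (let t = max (- k) (min k s) in t - max (- (1 / k)) (min (1 / k) t))"

lemma soft_clip_0 [simp]: "k > 0 \<Longrightarrow> soft_clip k 0 = 0"
  by (simp add: soft_clip_def)

lemma soft_clip_contraction: "k \<ge> 1 \<Longrightarrow> \<bar>soft_clip k s - soft_clip k t\<bar> \<le> \<bar>s - t\<bar>"
proof -
  assume "k \<ge> 1"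
  define a where "a = max (- k) (min k s)"
  define b where "b = max (- k) (min k t)"
  define d where "d = 1 / k"
  have d: "d > 0" using \<open>k \<ge> 1\<close> by (simp add: d_def)
  have "\<bar>a - b\<bar> \<le> \<bar>s - t\<bar>" unfolding a_def b_def by (auto simp: max_def min_def abs_if)
  moreover have "\<bar>(a - max (- d) (min d a)) - (b - max (- d) (min d b))\<bar> \<le> \<bar>a - b\<bar>"
    using d by (auto simp: max_def min_def abs_if)
  ultimately show ?thesis unfolding soft_clip_def Let_def a_def b_def d_def by linarith
qed

lemma soft_clip_bounded: "k \<ge> 1 \<Longrightarrow> \<bar>soft_clip k s\<bar> \<le> k"
proof -
  assume k: "k \<ge> 1"
  define d where "d = 1 / k"
  have "d > 0" "d \<le> k" using k by (auto simp: d_def field_simps intro: order_trans)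
  then show ?thesis using k unfolding soft_clip_def Let_def d_def[symmetric] by (auto simp: max_def min_def abs_if)
qed

lemma soft_clip_le_abs: "k \<ge> 1 \<Longrightarrow> \<bar>soft_clip k s\<bar> \<le> \<bar>s\<bar>"
  using soft_clip_contraction[of k s 0] by simp

text \<open>Outside the dead zone \<open>1 \<le> k * \<bar>s\<bar>\<close>, which permits one more
  factor \<open>\<bar>s\<bar>\<close>; inside it the left side is 0.\<close>

lemma soft_clip_le_square:
  assumes k: "k \<ge> 1" shows "\<bar>soft_clip k s\<bar> \<le> k * s\<^sup>2"
proof (cases "\<bar>s\<bar> \<le> 1 / k")
  case True
  define d where "d = 1 / k"
  have "d > 0" "d \<le> k" using k by (auto simp: d_def field_simps intro: order_trans)
  then have "soft_clip k s = 0"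
    using k True unfolding soft_clip_def Let_def d_def[symmetric] by (auto simp: max_def min_def abs_if split: if_splits)
  then show ?thesis using k by simp
next
  case False
  then have "1 \<le> k * \<bar>s\<bar>" using k by (simp add: field_simps)
  then have "1 * \<bar>s\<bar> \<le> (k * \<bar>s\<bar>) * \<bar>s\<bar>" by (intro mult_right_mono) auto
  then show ?thesis using soft_clip_le_abs[OF k, of s] by (simp add: power2_eq_square)
qed

lemma soft_clip_tendsto: "(\<lambda>n. soft_clip (real n + 1) s) \<longlonglongrightarrow> s"
proof -
  have "\<forall>\<^sub>F n in sequentially. \<bar>soft_clip (real n + 1) s - s\<bar> \<le> 1 / (real n + 1)"
  proof -
    obtain N where N: "\<bar>s\<bar> \<le> real N" using real_arch_simple by blast
    have "\<bar>soft_clip (real n + 1) s - s\<bar> \<le> 1 / (real n + 1)" if "n \<ge> N" for n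
    proof -
      have k: "\<bar>s\<bar> \<le> real n + 1" using N that by linarith
      have "1 / (real n + 1) > 0" by simp
      with k show ?thesis unfolding soft_clip_def Let_def by (auto simp: max_def min_def abs_if)
    qed
    then show ?thesis unfolding eventually_sequentially by blast
  qed
  then have "(\<lambda>n. \<bar>soft_clip (real n + 1) s - s\<bar>) \<longlonglongrightarrow> 0"
    by (intro tendsto_sandwich_zero[OF _ _ one_over_Suc_tendsto_0]) auto
  then show ?thesis by (simp add: tendsto_rabs_zero_iff LIM_zero_cancel)
qed

lemma soft_clip_measurable [measurable]: "soft_clip k \<in> borel_measurable borel"
  unfolding soft_clip_def Let_def by measurable

lemma isCont_soft_clip: "isCont (soft_clip k) s"
  unfolding soft_clip_def Let_def by (intro continuous_intros)

context dirichlet_space begin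

text \<open>\<open>Q (v n) (p m)\<close> is the pairing of \<open>p m\<close> with the generator
  applied to \<open>v n\<close>, so convergence against these functions is enough. Cauchy-Schwarz
  bounds the square by \<open>Qsq f * c\<close> uniformly, and letting \<open>n\<close> grow
  replaces \<open>v n\<close> by \<open>f\<close>.\<close>

lemma Q_le_if_resolvent_tendsto:
  assumes "f \<in> D" "\<And>m. p m \<in> D" "\<And>m. Qsq (p m) \<le> c"
    and "\<And>n. gen (v n) (\<lambda>x. (real n + 1) * (f x - v n x))"
    and "\<And>n. (\<lambda>m. \<integral>x. (real n + 1) * (f x - v n x) * p m x \<partial>M) \<longlonglongrightarrow> (\<integral>x. (real n + 1) * (f x - v n x) * f x \<partial>M)"
  shows "Qsq f \<le> c"
proof -
  note v = gen_rel_D[OF assms(4)]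
  have c: "0 \<le> c" using assms(3)[of 0] Q_nonneg[OF assms(2)[of 0]] by linarith
  have "(Q (v n) f)\<^sup>2 \<le> Qsq f * c" for n
  proof (rule LIMSEQ_le_const2)
    show "(\<lambda>m. (Q (v n) (p m))\<^sup>2) \<longlonglongrightarrow> (Q (v n) f)\<^sup>2"
      using assms(5)[of n] unfolding gen_rel_Q[OF assms(4) assms(1)] gen_rel_Q[OF assms(4) assms(2)]
      by (intro tendsto_power)
    have "(Q (v n) (p m))\<^sup>2 \<le> Qsq f * c" for m
    proof -
      have "(Q (v n) (p m))\<^sup>2 \<le> Qsq (v n) * Qsq (p m)" by (rule Q_Cauchy_Schwarz[OF v assms(2)])
      also have "\<dots> \<le> Qsq f * c"
        using resolvent_approximation(4)[OF assms(1,4)] assms(1-3) by (intro mult_mono) auto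
      finally show ?thesis .
    qed
    then show "\<exists>N. \<forall>m\<ge>N. (Q (v n) (p m))\<^sup>2 \<le> Qsq f * c" by blast
  qed
  moreover have "(\<lambda>n. (Q (v n) f)\<^sup>2) \<longlonglongrightarrow> (Qsq f)\<^sup>2"
    by (intro tendsto_power Q_tendsto_left v assms(1) resolvent_approximation(3)[OF assms(1,4)])
  ultimately have "(Qsq f)\<^sup>2 \<le> Qsq f * c" by (intro LIMSEQ_le_const2) auto
  then have "Qsq f * Qsq f \<le> Qsq f * c" by (simp add: power2_eq_square)
  then show ?thesis using Q_nonneg[OF assms(1)] c by (cases "Qsq f = 0") auto
qed

lemma ex_resolvent_sequence:
  assumes "f \<in> L2 M"
  obtains v where "\<And>n. gen (v n) (\<lambda>x. (real n + 1) * (f x - v n x))"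
proof -
  have "\<exists>v. gen v (\<lambda>x. (real n + 1) * (f x - v x))" for n :: nat
    using ex_resolvent[OF weight_const assms, of "real n + 1"] by (meson add_nonneg_pos of_nat_0_le_iff zero_less_one)
  then show ?thesis using that by metis
qed

text \<open>After soft clipping, the test functions \<open>L v\<close> lie in \<open>L\<^sup>1\<close> and the sequence is bounded, so
  dominated convergence needs nothing beyond a.e. convergence.\<close>

lemma Q_lower_semicontinuous:
  assumes "f \<in> D" "\<And>m. p m \<in> D" "\<And>m. Qsq (p m) \<le> c" "AE x in M. (\<lambda>m. p m x) \<longlonglongrightarrow> f x"
  shows "Qsq f \<le> c"
proof -
  let ?C = "\<lambda>k. soft_clip (real k + 1)"
  have CD: "(\<lambda>x. ?C k (g x)) \<in> D" if "g \<in> D" for k g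
    by (rule contraction_D[OF that, of "soft_clip (real k + 1)"]) (auto intro: soft_clip_contraction)
  note [measurable] = D_measurable[OF assms(1)] D_measurable[OF assms(2)]
  \<comment> \<open>The clip level \<open>k\<close> is fixed while \<open>m\<close> tends to
    infinity; it is removed only afterwards.\<close>
  have clipped: "Qsq (\<lambda>x. ?C k (f x)) \<le> c" for k
  proof -
    note f = CD[OF assms(1), of k]
    have int: "integrable M (\<lambda>x. ?C k (f x))"
    proof (rule Bochner_Integration.integrable_bound)
      show "integrable M (\<lambda>x. (real k + 1) * (f x)\<^sup>2)" using assms(1) by (auto intro!: L2_integrable_square)
      show "AE x in M. norm (?C k (f x)) \<le> norm ((real k + 1) * (f x)\<^sup>2)"
        using soft_clip_le_square[of "real k + 1"] by (auto intro!: AE_I2)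
    qed measurable
    obtain v where v: "\<And>n. gen (v n) (\<lambda>x. (real n + 1) * (?C k (f x) - v n x))"
      by (rule ex_resolvent_sequence[OF D_L2[OF f]]) blast
    \<comment> \<open>The dead zone puts the clipped function into L1, and the resolvent keeps it
      there.\<close>
    have w_int: "integrable M (\<lambda>x. (real n + 1) * (?C k (f x) - v n x))" for n
      using int resolvent_integrable[OF D_L2[OF f] int _ v[of n]] by auto
    show ?thesis
    proof (rule Q_le_if_resolvent_tendsto[OF f, of "\<lambda>m x. ?C k (p m x)"])
      show "(\<lambda>x. ?C k (p m x)) \<in> D" for m by (rule CD[OF assms(2)])
      show "Qsq (\<lambda>x. ?C k (p m x)) \<le> c" for m
        by (rule order_trans[OF Q_contraction[OF assms(2)] assms(3)]) (auto intro: soft_clip_contraction)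
      show "gen (v n) (\<lambda>x. (real n + 1) * (?C k (f x) - v n x))" for n by (rule v)
      fix n
      note [measurable] = D_measurable[OF gen_rel_D[OF v[of n]]]
      show "(\<lambda>m. \<integral>x. (real n + 1) * (?C k (f x) - v n x) * ?C k (p m x) \<partial>M) \<longlonglongrightarrow>
         (\<integral>x. (real n + 1) * (?C k (f x) - v n x) * ?C k (f x) \<partial>M)"
      proof (rule integral_dominated_convergence)
        show "integrable M (\<lambda>x. \<bar>(real n + 1) * (?C k (f x) - v n x)\<bar> * (real k + 1))" using w_int[of n] by simp
        show "AE x in M. norm ((real n + 1) * (?C k (f x) - v n x) * ?C k (p m x)) \<le>
          \<bar>(real n + 1) * (?C k (f x) - v n x)\<bar> * (real k + 1)" for m
        proof (rule AE_I2)
          fix x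
          have "\<bar>?C k (p m x)\<bar> \<le> real k + 1" by (intro soft_clip_bounded) simp
          then show "norm ((real n + 1) * (?C k (f x) - v n x) * ?C k (p m x)) \<le>
            \<bar>(real n + 1) * (?C k (f x) - v n x)\<bar> * (real k + 1)"
            unfolding real_norm_def abs_mult[of _ "?C k (p m x)"] by (intro mult_left_mono) auto
        qed
        show "AE x in M. (\<lambda>m. (real n + 1) * (?C k (f x) - v n x) * ?C k (p m x))
          \<longlonglongrightarrow> (real n + 1) * (?C k (f x) - v n x) * ?C k (f x)"
          using assms(4) by eventually_elim (intro tendsto_intros isCont_tendsto_compose[OF isCont_soft_clip])
      qed measurable
    qed
  qed
  \<comment> \<open>The same criterion is used a second time, now with the clipped versions of
    \<open>f\<close> as the approximating sequence; they are dominated by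
    \<open>\<bar>f\<bar>\<close>.\<close>
  obtain v where v: "\<And>n. gen (v n) (\<lambda>x. (real n + 1) * (f x - v n x))"
    by (rule ex_resolvent_sequence[OF D_L2[OF assms(1)]]) blast
  show ?thesis
  proof (rule Q_le_if_resolvent_tendsto[OF assms(1) CD[OF assms(1)] clipped v])
    fix n
    note [measurable] = D_measurable[OF gen_rel_D[OF v[of n]]]
    show "(\<lambda>m. \<integral>x. (real n + 1) * (f x - v n x) * ?C m (f x) \<partial>M) \<longlonglongrightarrow>
         (\<integral>x. (real n + 1) * (f x - v n x) * f x \<partial>M)"
    proof (rule integral_dominated_convergence)
      show "integrable M (\<lambda>x. \<bar>(real n + 1) * (f x - v n x) * f x\<bar>)"
        using L2_mult_integrable[OF gen_rel_L2[OF v[of n]] D_L2[OF assms(1)]] by simp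
      show "AE x in M. norm ((real n + 1) * (f x - v n x) * ?C m (f x)) \<le> \<bar>(real n + 1) * (f x - v n x) * f x\<bar>" for m
        unfolding real_norm_def abs_mult[of "(real n + 1) * (f _ - v n _)"]
        by (intro AE_I2 mult_left_mono soft_clip_le_abs) auto
      show "AE x in M. (\<lambda>m. (real n + 1) * (f x - v n x) * ?C m (f x)) \<longlonglongrightarrow> (real n + 1) * (f x - v n x) * f x"
        by (intro AE_I2 tendsto_intros soft_clip_tendsto)
    qed measurable
  qed
qed

section \<open>The extended Dirichlet space\<close>

lemma approx_seq_Q_Cauchy:
  "approx_seq M D Q f fs \<longleftrightarrow> (\<forall>n. fs n \<in> D) \<and> Q_Cauchy fs \<and> (AE x in M. (\<lambda>n. fs n x) \<longlonglongrightarrow> f x)"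
  by (simp add: approx_seq_def Q_Cauchy_def)

lemma Q_Cauchy_diff:
  assumes "\<And>n. u n \<in> D" "\<And>n. v n \<in> D" "Q_Cauchy u" "Q_Cauchy v"
  shows "Q_Cauchy (\<lambda>n x. u n x - v n x)"
  unfolding Q_Cauchy_def
proof (intro allI impI)
  fix e :: real assume "e > 0"
  obtain N1 where N1: "\<And>n m. n \<ge> N1 \<Longrightarrow> m \<ge> N1 \<Longrightarrow> Qsq (\<lambda>x. u n x - u m x) < e / 4"
    using assms(3)[unfolded Q_Cauchy_def, rule_format, of "e / 4"] \<open>e > 0\<close> by auto
  obtain N2 where N2: "\<And>n m. n \<ge> N2 \<Longrightarrow> m \<ge> N2 \<Longrightarrow> Qsq (\<lambda>x. v n x - v m x) < e / 4"
    using assms(4)[unfolded Q_Cauchy_def, rule_format, of "e / 4"] \<open>e > 0\<close> by auto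
  have "Qsq (\<lambda>x. u n x - v n x - (u m x - v m x)) < e"
    if "n \<ge> max N1 N2" "m \<ge> max N1 N2" for n m
  proof -
    have "(\<lambda>x. u n x - v n x - (u m x - v m x)) = (\<lambda>x. (u n x - u m x) - (v n x - v m x))" by auto
    then show ?thesis
      using Q_square_diff_le[OF D_diff[OF assms(1)[of n] assms(1)[of m]] D_diff[OF assms(2)[of n] assms(2)[of m]]]
        N1[of n m] N2[of n m] that by simp
  qed
  then show "\<exists>N. \<forall>n\<ge>N. \<forall>m\<ge>N. Qsq (\<lambda>x. u n x - v n x - (u m x - v m x)) < e"
    by blast
qed

lemma Q_Cauchy_const: "u \<in> D \<Longrightarrow> Q_Cauchy (\<lambda>n. u)"
  using Q_scale_left[of u u 0] Q_scale_left[of u "\<lambda>x. 0" 0] by (auto simp: Q_Cauchy_def)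

text \<open>This makes the extended form well defined. Each \<open>fs n\<close> is the a.e. limit of
  \<open>fs n - fs m\<close> as \<open>m\<close> grows, and these differences have small energy, so
  lower semicontinuity makes the energy of \<open>fs n\<close> small.\<close>

lemma Q_tendsto_0_if_AE_tendsto_0:
  assumes "\<And>n. fs n \<in> D" "Q_Cauchy fs" "AE x in M. (\<lambda>n. fs n x) \<longlonglongrightarrow> 0"
  shows "(\<lambda>n. Qsq (fs n)) \<longlonglongrightarrow> 0"
proof (rule LIMSEQ_I)
  fix r :: real assume "r > 0"
  then obtain N where N: "\<And>n m. n \<ge> N \<Longrightarrow> m \<ge> N \<Longrightarrow> Qsq (\<lambda>x. fs n x - fs m x) < r / 2"
    using assms(2)[unfolded Q_Cauchy_def, rule_format, of "r / 2"] by auto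
  have le: "Qsq (fs n) \<le> r / 2" if "n \<ge> N" for n
  proof (rule Q_lower_semicontinuous[OF assms(1)[of n], of "\<lambda>m x. fs n x - fs (m + N) x"])
    show "AE x in M. (\<lambda>m. fs n x - fs (m + N) x) \<longlonglongrightarrow> fs n x"
      using assms(3)
    proof eventually_elim
      case (elim x)
      then have "(\<lambda>m. fs n x - fs (m + N) x) \<longlonglongrightarrow> fs n x - 0"
        by (intro tendsto_intros LIMSEQ_ignore_initial_segment)
      then show ?case by simp
    qed
  qed (use assms(1) N[OF that] in \<open>auto intro!: less_imp_le\<close>)
  have "norm (Qsq (fs n) - 0) < r" if "n \<ge> N" for n
    using le[OF that] Q_nonneg[OF assms(1)[of n]] \<open>r > 0\<close> by simp
  then show "\<exists>no. \<forall>n\<ge>no. norm (Qsq (fs n) - 0) < r" by blast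
qed

lemma Q_sqrt_triangle:
  assumes "f \<in> D" "g \<in> D"
  shows "\<bar>sqrt (Qsq f) - sqrt (Qsq g)\<bar> \<le> sqrt (Qsq (\<lambda>x. f x - g x))"
proof -
  have "Q f g \<le> sqrt (Qsq f) * sqrt (Qsq g)"
    using real_sqrt_le_mono[OF Q_Cauchy_Schwarz[OF assms]] by (simp add: real_sqrt_mult)
  then have "(sqrt (Qsq f) - sqrt (Qsq g))\<^sup>2 \<le> Qsq (\<lambda>x. f x - g x)"
    using assms by (simp add: Q_square_diff power2_diff)
  from real_sqrt_le_mono[OF this] show ?thesis by simp
qed

text \<open>Justifies the definite description in \<open>extQ1\<close>: two approximating sequences
  differ by a \<open>Q\<close>-Cauchy sequence tending to 0 a.e., hence have the same limiting
  energy.\<close>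

lemma extQ1_tendsto:
  assumes "approx_seq M D Q f fs"
  shows "(\<lambda>n. Qsq (fs n)) \<longlonglongrightarrow> extQ1 M D Q f"
proof -
  have fs: "\<And>n. fs n \<in> D" "Q_Cauchy fs" "AE x in M. (\<lambda>n. fs n x) \<longlonglongrightarrow> f x"
    using assms by (auto simp: approx_seq_Q_Cauchy)
  have "Cauchy (\<lambda>n. sqrt (Qsq (fs n)))"
    unfolding Cauchy_def dist_real_def
  proof (intro allI impI)
    fix e :: real assume "e > 0"
    then obtain N where N: "\<And>n m. n \<ge> N \<Longrightarrow> m \<ge> N \<Longrightarrow> Qsq (\<lambda>x. fs n x - fs m x) < e\<^sup>2"
      using fs(2)[unfolded Q_Cauchy_def, rule_format, of "e\<^sup>2"] by auto
    have "\<bar>sqrt (Qsq (fs m)) - sqrt (Qsq (fs n))\<bar> < e" if "m \<ge> N" "n \<ge> N" for m n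
      using Q_sqrt_triangle[OF fs(1)[of m] fs(1)[of n]] real_sqrt_less_mono[OF N[OF that]] \<open>e > 0\<close> by simp
    then show "\<exists>M. \<forall>m\<ge>M. \<forall>n\<ge>M. \<bar>sqrt (Qsq (fs m)) - sqrt (Qsq (fs n))\<bar> < e" by blast
  qed
  then obtain l where l: "(\<lambda>n. sqrt (Qsq (fs n))) \<longlonglongrightarrow> l"
    using Cauchy_convergent unfolding convergent_def by blast
  have lim: "(\<lambda>n. Qsq (gs n)) \<longlonglongrightarrow> l\<^sup>2" if "approx_seq M D Q f gs" for gs
  proof -
    have gs: "\<And>n. gs n \<in> D" "Q_Cauchy gs" "AE x in M. (\<lambda>n. gs n x) \<longlonglongrightarrow> f x"
      using that by (auto simp: approx_seq_Q_Cauchy)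
    have ae0: "AE x in M. (\<lambda>n. gs n x - fs n x) \<longlonglongrightarrow> 0"
      using fs(3) gs(3)
    proof eventually_elim
      case (elim x)
      from tendsto_diff[OF elim(2,1)] show ?case by simp
    qed
    have "(\<lambda>n. Qsq (\<lambda>x. gs n x - fs n x)) \<longlonglongrightarrow> 0"
      by (rule Q_tendsto_0_if_AE_tendsto_0[OF _ Q_Cauchy_diff[OF gs(1) fs(1) gs(2) fs(2)] ae0])
        (intro D_diff gs fs)
    from tendsto_real_sqrt[OF this]
    have "(\<lambda>n. sqrt (Qsq (\<lambda>x. gs n x - fs n x))) \<longlonglongrightarrow> 0" by simp
    then have "(\<lambda>n. \<bar>sqrt (Qsq (gs n)) - sqrt (Qsq (fs n))\<bar>) \<longlonglongrightarrow> 0"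
      by (rule tendsto_sandwich_zero[rotated 2]) (auto intro!: always_eventually Q_sqrt_triangle gs fs)
    then have "(\<lambda>n. sqrt (Qsq (gs n)) - sqrt (Qsq (fs n))) \<longlonglongrightarrow> 0"
      by (simp add: tendsto_rabs_zero_iff)
    from tendsto_power[OF tendsto_add[OF this l], of 2] gs(1) show ?thesis by simp
  qed
  have "extQ1 M D Q f = l\<^sup>2"
    unfolding extQ1_def
  proof (rule the_equality)
    show "\<forall>fs. approx_seq M D Q f fs \<longrightarrow> (\<lambda>n. Qsq (fs n)) \<longlonglongrightarrow> l\<^sup>2" using lim by blast
    fix c assume "\<forall>fs. approx_seq M D Q f fs \<longrightarrow> (\<lambda>n. Qsq (fs n)) \<longlonglongrightarrow> c"
    then show "c = l\<^sup>2" using assms lim LIMSEQ_unique by blast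
  qed
  then show ?thesis using lim[OF assms] by simp
qed

lemma extQ_tendsto:
  assumes "approx_seq M D Q f fs" "u \<in> D"
  shows "(\<lambda>n. Q (fs n) u) \<longlonglongrightarrow> extQ M D Q f u"
proof -
  have fs: "\<And>n. fs n \<in> D" "Q_Cauchy fs" "AE x in M. (\<lambda>n. fs n x) \<longlonglongrightarrow> f x"
    using assms by (auto simp: approx_seq_Q_Cauchy)
  \<comment> \<open>The real \<open>c\<close> covers both terms of the polarisation formula: -1
    gives the sum, 1 the difference.\<close>
  have m: "approx_seq M D Q (\<lambda>x. f x - c * u x) (\<lambda>n x. fs n x - c * u x)" for c
    unfolding approx_seq_Q_Cauchy
  proof (intro conjI allI)
    show "Q_Cauchy (\<lambda>n x. fs n x - c * u x)"
      using assms(2) by (intro Q_Cauchy_diff[OF fs(1) _ fs(2) Q_Cauchy_const]) auto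
    show "AE x in M. (\<lambda>n. fs n x - c * u x) \<longlonglongrightarrow> f x - c * u x"
      using fs(3) by eventually_elim (intro tendsto_intros)
  qed (use fs assms(2) in auto)
  have "(\<lambda>n. (Qsq (\<lambda>x. fs n x - (- 1) * u x) - Qsq (\<lambda>x. fs n x - 1 * u x)) / 4)
     \<longlonglongrightarrow> (extQ1 M D Q (\<lambda>x. f x - (- 1) * u x) - extQ1 M D Q (\<lambda>x. f x - 1 * u x)) / 4"
    by (intro tendsto_intros extQ1_tendsto m) simp
  then show ?thesis
    using fs(1) assms(2) by (simp add: extQ_def Q_square_diff Q_square_add)
qed

section \<open>Approximation of the constant function 1\<close>

definition unit_approximable :: bool where
  "unit_approximable \<longleftrightarrow> (\<exists>us. (\<forall>n. us n \<in> D) \<and> (\<forall>n x. 0 \<le> us n x \<and> us n x \<le> 1)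
     \<and> (AE x in M. (\<lambda>n. us n x) \<longlonglongrightarrow> 1) \<and> (\<lambda>n. Qsq (us n)) \<longlonglongrightarrow> 0)"

text \<open>Since the generator of 1 is 0, \<open>Q (fs m) (fs n)\<close> tends to 0 as
  \<open>m\<close> grows. Expanding the energy of \<open>fs m - fs n\<close> and dropping that of
  \<open>fs m\<close> then bounds the energy of \<open>fs n\<close> by the Cauchy condition.
  Clipping to \<open>[0, 1]\<close> preserves both limits and provides the domination used
  later.\<close>

lemma unit_approximable_if_ext_gen_rel:
  assumes "ext_gen_rel M D Q (\<lambda>x. 1) (\<lambda>x. 0)"
  shows unit_approximable
proof -
  obtain fs where fs: "approx_seq M D Q (\<lambda>x. 1) fs"
    using assms by (auto simp: ext_gen_rel_def ext_space_def)
  then have fsD: "\<And>n. fs n \<in> D" "Q_Cauchy fs" "AE x in M. (\<lambda>n. fs n x) \<longlonglongrightarrow> 1"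
    by (auto simp: approx_seq_Q_Cauchy)
  have lim0: "(\<lambda>m. Q (fs m) (fs n)) \<longlonglongrightarrow> 0" for n
    using extQ_tendsto[OF fs fsD(1)[of n]] assms fsD(1)[of n] by (simp add: ext_gen_rel_def ip_def)
  have "(\<lambda>n. Qsq (fs n)) \<longlonglongrightarrow> 0"
  proof (rule LIMSEQ_I)
    fix r :: real assume "r > 0"
    then obtain N where N: "\<And>n m. n \<ge> N \<Longrightarrow> m \<ge> N \<Longrightarrow> Qsq (\<lambda>x. fs n x - fs m x) < r / 2"
      using fsD(2)[unfolded Q_Cauchy_def, rule_format, of "r / 2"] by auto
    have le: "Qsq (fs n) \<le> r / 2" if "n \<ge> N" for n
    proof (rule LIMSEQ_le_const2)
      show "(\<lambda>m. Qsq (fs n) - 2 * Q (fs m) (fs n)) \<longlonglongrightarrow> Qsq (fs n)"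
        using tendsto_diff[OF tendsto_const tendsto_mult_left[OF lim0[of n], of 2]] by auto
      have "Qsq (fs n) - 2 * Q (fs m) (fs n) \<le> r / 2" if "m \<ge> N" for m
        using N[OF that \<open>n \<ge> N\<close>] Q_nonneg[OF fsD(1)[of m]] unfolding Q_square_diff[OF fsD(1) fsD(1)] by linarith
      then show "\<exists>N. \<forall>m\<ge>N. Qsq (fs n) - 2 * Q (fs m) (fs n) \<le> r / 2" by blast
    qed
    have "norm (Qsq (fs n) - 0) < r" if "n \<ge> N" for n
      using le[OF that] Q_nonneg[OF fsD(1)[of n]] \<open>r > 0\<close> by simp
    then show "\<exists>no. \<forall>n\<ge>no. norm (Qsq (fs n) - 0) < r" by blast
  qed
  define C :: "real \<Rightarrow> real" where "C s = max 0 (min 1 s)" for s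
  have C: "C 0 = 0" "\<bar>C s - C t\<bar> \<le> \<bar>s - t\<bar>" "0 \<le> C s" "C s \<le> 1" for s t
    by (auto simp: C_def max_def min_def abs_if)
  have "AE x in M. (\<lambda>n. C (fs n x)) \<longlonglongrightarrow> 1"
    using fsD(3)
  proof eventually_elim
    case (elim x)
    have "(\<lambda>n. max 0 (min 1 (fs n x))) \<longlonglongrightarrow> max 0 (min 1 1)"
      by (intro tendsto_intros elim)
    then show ?case by (simp add: C_def)
  qed
  moreover have "(\<lambda>n. Qsq (\<lambda>x. C (fs n x))) \<longlonglongrightarrow> 0"
  proof (rule tendsto_sandwich_zero[OF _ _ \<open>(\<lambda>n. Qsq (fs n)) \<longlonglongrightarrow> 0\<close>])
    show "\<forall>\<^sub>F n in sequentially. 0 \<le> Qsq (\<lambda>x. C (fs n x))"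
      by (intro always_eventually allI Q_nonneg contraction_D[OF fsD(1) C(1,2)])
    show "\<forall>\<^sub>F n in sequentially. Qsq (\<lambda>x. C (fs n x)) \<le> Qsq (fs n)"
      by (intro always_eventually allI Q_contraction[OF fsD(1) C(1,2)])
  qed
  ultimately show ?thesis
    unfolding unit_approximable_def using contraction_D[OF fsD(1) C(1,2)] C(3,4)
    by (intro exI[of _ "\<lambda>n x. C (fs n x)"]) auto
qed

lemma ext_gen_rel_if_unit_approximation:
  assumes "\<And>n. us n \<in> D" "AE x in M. (\<lambda>n. us n x) \<longlonglongrightarrow> 1" "(\<lambda>n. Qsq (us n)) \<longlonglongrightarrow> 0"
  shows "ext_gen_rel M D Q (\<lambda>x. 1) (\<lambda>x. 0)"
proof -
  have "Q_Cauchy us"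
    unfolding Q_Cauchy_def
  proof (intro allI impI)
    fix e :: real assume "e > 0"
    then have "\<forall>\<^sub>F n in sequentially. Qsq (us n) < e / 4"
      using order_tendstoD(2)[OF assms(3), of "e / 4"] by simp
    then obtain N where N: "\<And>n. n \<ge> N \<Longrightarrow> Qsq (us n) < e / 4"
      unfolding eventually_sequentially by blast
    have "Qsq (\<lambda>x. us n x - us m x) < e" if "n \<ge> N" "m \<ge> N" for n m
      using Q_square_diff_le[OF assms(1)[of n] assms(1)[of m]] N[OF that(1)] N[OF that(2)] by linarith
    then show "\<exists>N. \<forall>n\<ge>N. \<forall>m\<ge>N. Qsq (\<lambda>x. us n x - us m x) < e" by blast
  qed
  then have a: "approx_seq M D Q (\<lambda>x. 1) us" using assms by (simp add: approx_seq_Q_Cauchy)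
  have "extQ M D Q (\<lambda>x. 1) u = 0" if u: "u \<in> D" for u
  proof (rule LIMSEQ_unique[OF extQ_tendsto[OF a u]])
    show "(\<lambda>n. Q (us n) u) \<longlonglongrightarrow> 0"
    proof (rule tendsto_zero_square)
      show "\<forall>\<^sub>F n in sequentially. (Q (us n) u)\<^sup>2 \<le> Qsq (us n) * Qsq u"
        by (intro always_eventually allI Q_Cauchy_Schwarz assms(1) u)
      show "(\<lambda>n. Qsq (us n) * Qsq u) \<longlonglongrightarrow> 0"
        by (intro tendsto_mult_left_zero assms(3))
    qed
  qed
  then show ?thesis using a by (auto simp: ext_gen_rel_def ext_space_def ip_def)
qed

lemma integral_generator_eq_0:
  assumes unit_approximable "ext_gen_rel M D Q u w" "integrable M w"
  shows "(\<integral>x. w x \<partial>M) = 0"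
proof -
  obtain us where us: "\<And>n. us n \<in> D" "\<And>n x. 0 \<le> us n x \<and> us n x \<le> 1"
    "AE x in M. (\<lambda>n. us n x) \<longlonglongrightarrow> 1" "(\<lambda>n. Qsq (us n)) \<longlonglongrightarrow> 0"
    using assms(1) by (auto simp: unit_approximable_def)
  obtain fs where fs: "approx_seq M D Q u fs"
    using assms(2) by (auto simp: ext_gen_rel_def ext_space_def)
  then have fsD: "\<And>n. fs n \<in> D" by (auto simp: approx_seq_def)
  note [measurable] = borel_measurable_integrable[OF assms(3)] D_measurable[OF us(1)]
  have "(\<lambda>n. extQ M D Q u (us n)) \<longlonglongrightarrow> 0"
  proof (rule tendsto_zero_square)
    show "\<forall>\<^sub>F n in sequentially. (extQ M D Q u (us n))\<^sup>2 \<le> extQ1 M D Q u * Qsq (us n)"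
    proof (intro always_eventually allI)
      fix n
      \<comment> \<open>Cauchy-Schwarz between an extended function and a function in
        \<open>D\<close>, obtained as a limit of the inequality in \<open>D\<close>.\<close>
      show "(extQ M D Q u (us n))\<^sup>2 \<le> extQ1 M D Q u * Qsq (us n)"
      proof (rule LIMSEQ_le)
        show "(\<lambda>k. (Q (fs k) (us n))\<^sup>2) \<longlonglongrightarrow> (extQ M D Q u (us n))\<^sup>2"
          by (intro tendsto_power extQ_tendsto fs us)
        show "(\<lambda>k. Qsq (fs k) * Qsq (us n)) \<longlonglongrightarrow> extQ1 M D Q u * Qsq (us n)"
          by (intro tendsto_mult_right extQ1_tendsto fs)
        show "\<exists>N. \<forall>k\<ge>N. (Q (fs k) (us n))\<^sup>2 \<le> Qsq (fs k) * Qsq (us n)"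
          using Q_Cauchy_Schwarz[OF fsD us(1)] by blast
      qed
    qed
    show "(\<lambda>n. extQ1 M D Q u * Qsq (us n)) \<longlonglongrightarrow> 0"
      by (intro tendsto_mult_right_zero us(4))
  qed
  then have "(\<lambda>n. pairing w (us n)) \<longlonglongrightarrow> 0"
    using assms(2) us(1) by (simp add: ext_gen_rel_def ip_def)
  \<comment> \<open>The bounds on \<open>us\<close> make \<open>\<bar>w\<bar>\<close> an integrable
    majorant.\<close>
  moreover have "(\<lambda>n. pairing w (us n)) \<longlonglongrightarrow> (\<integral>x. w x * 1 \<partial>M)"
  proof (rule integral_dominated_convergence)
    show "integrable M (\<lambda>x. \<bar>w x\<bar>)" using assms(3) by simp
    show "AE x in M. norm (w x * us n x) \<le> \<bar>w x\<bar>" for n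
      using us(2) by (auto intro!: AE_I2 mult_left_le simp: abs_mult)
    show "AE x in M. (\<lambda>n. w x * us n x) \<longlonglongrightarrow> w x * 1"
      using us(3) by eventually_elim (intro tendsto_intros)
  qed measurable
  ultimately show ?thesis using LIMSEQ_unique by fastforce
qed

end

section \<open>Equilibrium approximation\<close>

context dirichlet_space begin

lemma equilibrium_Q:
  assumes "integrable M g" "g \<in> L2 M" "\<And>x. 0 \<le> g x \<and> g x \<le> 1"
    and A: "gen A (\<lambda>x. g x * (1 - A x) - a * A x)" and B: "B \<in> D"
  shows "Q A B = pairing g B - (\<integral>x. g x * (A x * B x) \<partial>M) - a * pairing A B"
proof -
  have AD: "A \<in> D" by (rule gen_rel_D[OF A])
  have "(\<lambda>x. g x * A x) \<in> L2 M"
    using assms(2,3) AD by (intro L2_bounded_mult[of _ _ _ 1]) (auto simp: L2_measurable)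
  then have "integrable M (\<lambda>x. g x * A x * B x)" using B by (intro L2_mult_integrable) auto
  then have int: "integrable M (\<lambda>x. g x * (A x * B x))" by (simp add: mult.assoc)
  have "Q A B = (\<integral>x. g x * B x - g x * (A x * B x) - a * (A x * B x) \<partial>M)"
    unfolding gen_rel_Q[OF A B] by (intro Bochner_Integration.integral_cong) (auto simp: algebra_simps)
  also have "\<dots> = pairing g B - (\<integral>x. g x * (A x * B x) \<partial>M) - a * pairing A B"
    using int L2_mult_integrable[OF assms(2) D_L2[OF B]] L2_mult_integrable[OF D_L2[OF AD] D_L2[OF B]] by simp
  finally show ?thesis .
qed

text \<open>By symmetry of \<open>Q\<close>, testing each equation with the other solution gives
  \<open>\<integral> g (B - A) = (a - b) \<integral> A B\<close>.\<close>

lemma equilibrium_increment: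
  assumes "integrable M g" "g \<in> L2 M" "\<And>x. 0 \<le> g x \<and> g x \<le> 1"
    and A: "gen A (\<lambda>x. g x * (1 - A x) - a * A x)"
    and B: "gen B (\<lambda>x. g x * (1 - B x) - b * B x)"
    and "0 \<le> b" "b \<le> a"
  shows "Qsq (\<lambda>x. B x - A x) \<le> pairing g B - pairing g A"
proof -
  note AD = gen_rel_D[OF A] and BD = gen_rel_D[OF B]
  note QA = equilibrium_Q[OF assms(1-3) A] and QB = equilibrium_Q[OF assms(1-3) B]
  have gint: "integrable M (\<lambda>x. g x * (p x * q x))" if "p \<in> D" "q \<in> D" for p q
  proof -
    have "(\<lambda>x. g x * p x) \<in> L2 M"
      using assms(2,3) that by (intro L2_bounded_mult[of _ _ _ 1]) (auto simp: L2_measurable)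
    then show ?thesis using L2_mult_integrable[of "\<lambda>x. g x * p x" M q] that by (auto simp: mult.assoc)
  qed
  have comm: "pairing B A = pairing A B" "(\<integral>x. g x * (B x * A x) \<partial>M) = (\<integral>x. g x * (A x * B x) \<partial>M)"
    by (simp_all add: mult.commute)
  have g0: "0 \<le> (\<integral>x. g x * (A x * A x) \<partial>M) - 2 * (\<integral>x. g x * (A x * B x) \<partial>M) + (\<integral>x. g x * (B x * B x) \<partial>M)"
  proof -
    have "0 \<le> (\<integral>x. g x * ((A x - B x) * (A x - B x)) \<partial>M)"
      using assms(3) by (intro integral_nonneg_AE AE_I2 mult_nonneg_nonneg[OF _ zero_le_square]) auto
    also have "\<dots> = (\<integral>x. g x * (A x * A x) - 2 * (g x * (A x * B x)) + g x * (B x * B x) \<partial>M)"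
      by (intro Bochner_Integration.integral_cong) (auto simp: algebra_simps)
    finally show ?thesis using gint[OF AD AD] gint[OF AD BD] gint[OF BD BD] by simp
  qed
  have sq: "0 \<le> pairing A A - 2 * pairing A B + pairing B B"
  proof -
    have "0 \<le> (\<integral>x. (A x - B x) * (A x - B x) \<partial>M)" by (intro integral_nonneg_AE AE_I2 zero_le_square)
    also have "\<dots> = (\<integral>x. A x * A x - 2 * (A x * B x) + B x * B x \<partial>M)"
      by (intro Bochner_Integration.integral_cong) (auto simp: algebra_simps)
    finally show ?thesis using AD BD by (simp add: L2_mult_integrable D_L2)
  qed
  have AA: "0 \<le> pairing A A" by (intro integral_nonneg_AE AE_I2 zero_le_square)
  \<comment> \<open>With the mixed term taken from the equation of \<open>B\<close>, the energy of
    \<open>B - A\<close> is \<open>\<integral> g (B - A) - \<integral> g (A - B)\<^sup>2\<close>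
    plus \<open>2 b \<integral> A B - a \<integral> A\<^sup>2 - b \<integral> B\<^sup>2\<close>. The
    last sum is nonpositive because \<open>b \<le> a\<close>.\<close>
  have "b * (2 * pairing A B) \<le> b * (pairing A A + pairing B B)"
    using sq assms(6) by (intro mult_left_mono) auto
  moreover have "b * pairing A A \<le> a * pairing A A"
    using AA assms(7) by (intro mult_right_mono)
  ultimately have "2 * b * pairing A B \<le> a * pairing A A + b * pairing B B"
    by (simp add: algebra_simps)
  then show ?thesis
    using g0 QA[OF AD] QA[OF BD] QB[OF AD] QB[OF BD] Q_sym[OF AD BD] Q_square_diff[OF BD AD]
    by (simp add: comm algebra_simps)
qed

text \<open>Weak comparison: the difference \<open>d = A - B\<close> is tested with its positive
  part. The form value is nonnegative, while where \<open>d > 0\<close> the generator of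
  \<open>d\<close> is at most \<open>- b d\<close>, because less damping only helps
  \<open>B\<close>.\<close>

lemma equilibrium_mono:
  assumes "g \<in> L2 M" "\<And>x. 0 \<le> g x \<and> g x \<le> 1"
    and A: "gen A (\<lambda>x. g x * (1 - A x) - a * A x)"
    and B: "gen B (\<lambda>x. g x * (1 - B x) - b * B x)"
    and "0 < b" "b \<le> a" "\<And>x. 0 \<le> A x"
  shows "AE x in M. A x \<le> B x"
proof -
  let ?d = "\<lambda>x. A x - B x" and ?w = "\<lambda>x. (g x * (1 - A x) - a * A x) - (g x * (1 - B x) - b * B x)"
  note d = gen_rel_diff[OF A B]
  have dD: "?d \<in> D" by (rule gen_rel_D[OF d])
  have C: "max 0 0 = (0::real)" "\<bar>max 0 s - max 0 t\<bar> \<le> \<bar>s - t\<bar>" for s t :: real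
    by (auto simp: max_def abs_if)
  have pD: "(\<lambda>x. max 0 (?d x)) \<in> D" by (rule contraction_D[OF dD C])
  have "0 \<le> Q ?d (\<lambda>x. max 0 (?d x))"
    by (rule Q_monotone_contraction_nonneg[OF dD C]) (auto intro!: monoI)
  also have "\<dots> = (\<integral>x. ?w x * max 0 (?d x) \<partial>M)" by (rule gen_rel_Q[OF d pD])
  also have "\<dots> \<le> (\<integral>x. - b * (max 0 (?d x))\<^sup>2 \<partial>M)"
  proof (rule integral_mono)
    show "integrable M (\<lambda>x. ?w x * max 0 (?d x))"
      by (rule L2_mult_integrable[OF gen_rel_L2[OF d] D_L2[OF pD]])
    show "integrable M (\<lambda>x. - b * (max 0 (?d x))\<^sup>2)"
      using L2_integrable_square[OF D_L2[OF pD]] by simp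
    fix x
    show "?w x * max 0 (?d x) \<le> - b * (max 0 (?d x))\<^sup>2"
    proof (cases "?d x \<le> 0")
      case False
      have "?w x = - (g x * ?d x) - b * ?d x - (a - b) * A x" by (simp add: algebra_simps)
      moreover have "0 \<le> g x * ?d x" "0 \<le> (a - b) * A x" using False assms(2)[of x] assms(6,7) by auto
      ultimately have "?w x \<le> - b * ?d x" by linarith
      then have "?w x * ?d x \<le> (- b * ?d x) * ?d x" using False by (intro mult_right_mono) auto
      then show ?thesis using False by (simp add: max_def power2_eq_square)
    qed (simp add: max_def)
  qed
  also have "\<dots> = - b * Lsq (\<lambda>x. max 0 (?d x))" by simp
  finally have "Lsq (\<lambda>x. max 0 (?d x)) \<le> 0" using assms(5) by (simp add: mult_le_0_iff)
  from integral_square_eq_0_AE[OF D_L2[OF pD] this] show ?thesis by eventually_elim (simp add: max_def split: if_splits)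
qed

text \<open>With weight \<open>\<rho> = g + a\<close> and data \<open>f = g / \<rho>\<close> one has
  \<open>\<rho> (f - v) = g (1 - v) - a v\<close>, so the equation is a weighted resolvent equation.
  Positivity of \<open>a\<close> bounds \<open>\<rho>\<close> below and puts \<open>f\<close> into
  L2 through \<open>f \<le> g / a\<close>; from \<open>0 \<le> f \<le> 1\<close> come the bounds on
  the solution.\<close>

lemma ex_equilibrium:
  assumes "integrable M g" "\<And>x. 0 \<le> g x \<and> g x \<le> 1"
  obtains us u where
    "\<And>n. gen (us n) (\<lambda>x. g x * (1 - us n x) - 1 / (real n + 1) * us n x)"
    "\<And>n x. 0 \<le> us n x \<and> us n x \<le> 1"
    "u \<in> borel_measurable M" "\<And>x. 0 \<le> u x \<and> u x \<le> 1"
    "AE x in M. (\<lambda>n. us n x) \<longlonglongrightarrow> u x"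
proof -
  note [measurable] = borel_measurable_integrable[OF assms(1)]
  have g: "g \<in> L2 M" using assms by (intro L2_bounded_integrable[of _ _ 1]) auto
  have "\<exists>v. gen v (\<lambda>x. g x * (1 - v x) - 1 / (real n + 1) * v x) \<and> (\<forall>x. 0 \<le> v x \<and> v x \<le> 1)" for n
  proof -
    define a where "a = 1 / (real n + 1)"
    have a: "a > 0" by (simp add: a_def)
    have pos: "g x + a > 0" for x using assms(2)[of x] a by linarith
    let ?f = "\<lambda>x. g x / (g x + a)"
    have w: "weight (\<lambda>x. g x + a)"
      unfolding weight_def using a assms(2) by (intro conjI exI[of _ a] exI[of _ "1 + a"]) (auto simp: add_mono)
    have f: "?f \<in> L2 M"
    proof (rule L2_dominated[OF L2_scale[OF g, of "1 / a"]])
      show "AE x in M. \<bar>?f x\<bar> \<le> \<bar>1 / a * g x\<bar>"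
      proof (rule AE_I2)
        fix x
        have "g x / (g x + a) \<le> g x / a" using assms(2)[of x] a pos[of x] by (intro divide_left_mono) auto
        then show "\<bar>?f x\<bar> \<le> \<bar>1 / a * g x\<bar>" using assms(2)[of x] a pos[of x] by simp
      qed
    qed measurable
    have f01: "0 \<le> ?f x \<and> ?f x \<le> 1" for x using assms(2)[of x] a pos[of x] by auto
    obtain v where v: "gen v (\<lambda>x. (g x + a) * (?f x - v x))" "\<And>x. 0 \<le> v x \<and> v x \<le> 1"
      using ex_bounded_resolvent[OF w f, of 0 1] f01 by auto
    have "(g x + a) * (?f x - v x) = g x * (1 - v x) - a * v x" for x
      using pos[of x] by (simp add: field_simps)
    with v show ?thesis unfolding a_def by auto
  qed
  then obtain us where us: "\<And>n. gen (us n) (\<lambda>x. g x * (1 - us n x) - 1 / (real n + 1) * us n x)"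
    "\<And>n x. 0 \<le> us n x \<and> us n x \<le> 1" by metis
  note [measurable] = D_measurable[OF gen_rel_D[OF us(1)]]
  have "AE x in M. us n x \<le> us (Suc n) x" for n
    by (rule equilibrium_mono[OF g assms(2) us(1)[of n] us(1)[of "Suc n"]]) (auto simp: us(2) divide_simps)
  then have ae: "AE x in M. \<forall>n. us n x \<le> us (Suc n) x" by (simp add: AE_all_countable)
  \<comment> \<open>The clip changes nothing where the monotone sequence converges; it makes the
    bounds hold at every point.\<close>
  define u where "u x = max 0 (min 1 (lim (\<lambda>n. us n x)))" for x
  have "AE x in M. (\<lambda>n. us n x) \<longlonglongrightarrow> u x"
    using ae
  proof eventually_elim
    case (elim x)
    then have "incseq (\<lambda>n. us n x)" by (intro incseq_SucI) auto
    then obtain l where l: "(\<lambda>n. us n x) \<longlonglongrightarrow> l"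
      using incseq_convergent[of "\<lambda>n. us n x" 1] us(2) by blast
    have "0 \<le> l" "l \<le> 1" using us(2) LIMSEQ_le_const[OF l] LIMSEQ_le_const2[OF l] by blast+
    then show ?case using l limI[OF l] by (simp add: u_def)
  qed
  moreover have "u \<in> borel_measurable M" unfolding u_def by measurable
  moreover have "0 \<le> u x \<and> u x \<le> 1" for x by (simp add: u_def)
  ultimately show ?thesis using that[OF us] by blast
qed

text \<open>The integrals of \<open>us n\<close> against \<open>g\<close> increase and stay below
  \<open>\<integral> g\<close>, so the increments estimate makes \<open>us\<close> a
  \<open>Q\<close>-Cauchy sequence. What remains is the limit in the tested equation.\<close>

lemma equilibrium_ext_gen_rel:
  assumes "integrable M g" "\<And>x. 0 \<le> g x \<and> g x \<le> 1"
    and us: "\<And>n. gen (us n) (\<lambda>x. g x * (1 - us n x) - 1 / (real n + 1) * us n x)"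
      "\<And>n x. 0 \<le> us n x \<and> us n x \<le> 1"
    and u: "u \<in> borel_measurable M" "\<And>x. 0 \<le> u x \<and> u x \<le> 1" "AE x in M. (\<lambda>n. us n x) \<longlonglongrightarrow> u x"
  shows "ext_gen_rel M D Q u (\<lambda>x. g x * (1 - u x))"
proof -
  note [measurable] = borel_measurable_integrable[OF assms(1)] u(1) D_measurable[OF gen_rel_D[OF us(1)]]
  have g: "g \<in> L2 M" using assms by (intro L2_bounded_integrable[of _ _ 1]) auto
  note D = gen_rel_D[OF us(1)]
  have gle: "\<bar>g x * (1 - t)\<bar> \<le> g x" if "0 \<le> t" "t \<le> 1" for x t
    using assms(2)[of x] that by (simp add: abs_mult mult_left_le)
  have "Q_Cauchy us"
  proof (rule Q_Cauchy_if_increments[of us "\<lambda>n. pairing g (us n)" "\<integral>x. g x \<partial>M"])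
    show "us n \<in> D" for n by (rule D)
    show "Qsq (\<lambda>x. us m x - us n x) \<le> pairing g (us m) - pairing g (us n)"
      if "n \<le> m" for n m
      by (rule equilibrium_increment[OF assms(1) g assms(2) us(1)[of n] us(1)[of m]]) (use that in \<open>auto simp: divide_simps\<close>)
    show "pairing g (us n) \<le> (\<integral>x. g x \<partial>M)" for n
      using assms us(2) D[of n] g by (intro integral_mono L2_mult_integrable) (auto intro!: mult_left_le)
  qed
  then have a: "approx_seq M D Q u us" using D u(3) by (simp add: approx_seq_Q_Cauchy)
  have "ip M (\<lambda>x. g x * (1 - u x)) p = extQ M D Q u p" if p: "p \<in> D" for p
  proof -
    note [measurable] = D_measurable[OF p]
    have "(\<lambda>n. \<integral>x. g x * (1 - us n x) * p x \<partial>M) \<longlonglongrightarrow> (\<integral>x. g x * (1 - u x) * p x \<partial>M)"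
    proof (rule integral_dominated_convergence)
      show "integrable M (\<lambda>x. \<bar>g x * p x\<bar>)" using L2_mult_integrable[OF g D_L2[OF p]] by simp
      show "AE x in M. norm (g x * (1 - us n x) * p x) \<le> \<bar>g x * p x\<bar>" for n
      proof (rule AE_I2)
        fix x
        have "\<bar>g x * (1 - us n x)\<bar> \<le> \<bar>g x\<bar>" using gle[of "us n x" x] us(2)[of n x] by linarith
        then show "norm (g x * (1 - us n x) * p x) \<le> \<bar>g x * p x\<bar>"
          unfolding real_norm_def abs_mult[of _ "p x"] by (intro mult_right_mono) auto
      qed
      show "AE x in M. (\<lambda>n. g x * (1 - us n x) * p x) \<longlonglongrightarrow> g x * (1 - u x) * p x"
        using u(3) by eventually_elim (intro tendsto_intros)
    qed measurable
    \<comment> \<open>The L2 norms of \<open>us n\<close> may be unbounded. Testing equation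
      \<open>n\<close> with \<open>us n\<close> gives
      \<open>c \<integral> (us n)\<^sup>2 \<le> \<integral> g\<close> for
      \<open>c = 1 / (n + 1)\<close>, so the damping term is of order \<open>sqrt c\<close>.\<close>
    moreover have "(\<lambda>n. 1 / (real n + 1) * pairing (us n) p) \<longlonglongrightarrow> 0"
    proof (rule tendsto_zero_square)
      show "\<forall>\<^sub>F n in sequentially. (1 / (real n + 1) * pairing (us n) p)\<^sup>2 \<le>
         1 / (real n + 1) * ((\<integral>x. g x \<partial>M) * Lsq p)"
      proof (intro always_eventually allI)
        fix n
        define c where "c = 1 / (real n + 1)"
        have c: "0 < c" by (simp add: c_def)
        have "c * Lsq (us n) \<le> (\<integral>x. g x \<partial>M)"
        proof -
          have "0 \<le> (\<integral>x. g x * (us n x * us n x) \<partial>M)"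
            using assms(2) by (intro integral_nonneg_AE AE_I2 mult_nonneg_nonneg[OF _ zero_le_square]) auto
          moreover have "pairing g (us n) \<le> (\<integral>x. g x \<partial>M)"
            using assms us(2) D[of n] g by (intro integral_mono L2_mult_integrable) (auto intro!: mult_left_le)
          ultimately show ?thesis
            using equilibrium_Q[OF assms(1) g assms(2) us(1)[of n] D[of n]] Q_nonneg[OF D[of n]]
            by (simp add: c_def power2_eq_square)
        qed
        then have "c * Lsq (us n) * (c * Lsq p) \<le> (\<integral>x. g x \<partial>M) * (c * Lsq p)"
          using c by (intro mult_right_mono) auto
        moreover have "c\<^sup>2 * (pairing (us n) p)\<^sup>2 \<le> c\<^sup>2 * (Lsq (us n) * Lsq p)"
          by (intro mult_left_mono integral_Cauchy_Schwarz D_L2 D p) auto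
        ultimately have "(c * pairing (us n) p)\<^sup>2 \<le> c * ((\<integral>x. g x \<partial>M) * Lsq p)"
          by (simp add: power2_eq_square algebra_simps)
        then show "(1 / (real n + 1) * pairing (us n) p)\<^sup>2 \<le> 1 / (real n + 1) * ((\<integral>x. g x \<partial>M) * Lsq p)"
          unfolding c_def .
      qed
      show "(\<lambda>n. 1 / (real n + 1) * ((\<integral>x. g x \<partial>M) * Lsq p)) \<longlonglongrightarrow> 0"
        by (intro tendsto_mult_left_zero one_over_Suc_tendsto_0)
    qed
    ultimately have "(\<lambda>n. (\<integral>x. g x * (1 - us n x) * p x \<partial>M) - 1 / (real n + 1) * pairing (us n) p)
       \<longlonglongrightarrow> (\<integral>x. g x * (1 - u x) * p x \<partial>M) - 0" by (rule tendsto_diff)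
    moreover have "Q (us n) p = (\<integral>x. g x * (1 - us n x) * p x \<partial>M) - 1 / (real n + 1) * pairing (us n) p" for n
    proof -
      have 1: "(\<lambda>x. g x * (1 - us n x)) \<in> L2 M"
        using gle us(2) by (intro L2_dominated[OF g]) (auto intro!: AE_I2 order_trans[OF gle])
      have "Q (us n) p = (\<integral>x. g x * (1 - us n x) * p x - 1 / (real n + 1) * (us n x * p x) \<partial>M)"
        unfolding gen_rel_Q[OF us(1) p] by (intro Bochner_Integration.integral_cong) (auto simp: algebra_simps)
      then show ?thesis using L2_mult_integrable[OF 1 D_L2[OF p]] L2_mult_integrable[OF D_L2[OF D[of n]] D_L2[OF p]]
        by simp
    qed
    ultimately have "(\<lambda>n. Q (us n) p) \<longlonglongrightarrow> (\<integral>x. g x * (1 - u x) * p x \<partial>M)" by simp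
    from LIMSEQ_unique[OF this extQ_tendsto[OF a p]] show ?thesis by (simp add: ip_def)
  qed
  moreover have "(\<lambda>x. g x * (1 - u x)) \<in> L2 M"
    using gle u(2) by (intro L2_dominated[OF g]) (auto intro!: AE_I2 order_trans[OF gle])
  ultimately show ?thesis using a u(1) by (auto simp: ext_gen_rel_def ext_space_def)
qed

text \<open>Testing the equation with \<open>us n\<close> and discarding the damping bounds the
  energy by \<open>\<integral> g (1 - us n) (us n)\<close>, which tends to 0 when
  \<open>us n\<close> tends to 1.\<close>

lemma equilibrium_eq_1:
  assumes "integrable M g" "\<And>x. 0 \<le> g x \<and> g x \<le> 1"
    and us: "\<And>n. gen (us n) (\<lambda>x. g x * (1 - us n x) - 1 / (real n + 1) * us n x)"
      "\<And>n x. 0 \<le> us n x \<and> us n x \<le> 1"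
    and lim: "AE x in M. (\<lambda>n. us n x) \<longlonglongrightarrow> 1"
  shows "ext_gen_rel M D Q (\<lambda>x. 1) (\<lambda>x. 0)"
proof (rule ext_gen_rel_if_unit_approximation[OF gen_rel_D[OF us(1)] lim])
  note [measurable] = borel_measurable_integrable[OF assms(1)] D_measurable[OF gen_rel_D[OF us(1)]]
  have g: "g \<in> L2 M" using assms by (intro L2_bounded_integrable[of _ _ 1]) auto
  have "(\<lambda>n. \<integral>x. g x * (1 - us n x) * us n x \<partial>M) \<longlonglongrightarrow> (\<integral>x. g x * (1 - 1) * 1 \<partial>M)"
  proof (rule integral_dominated_convergence)
    show "AE x in M. norm (g x * (1 - us n x) * us n x) \<le> g x" for n
    proof (rule AE_I2)
      fix x
      have "g x * ((1 - us n x) * us n x) \<le> g x * 1"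
        using us(2)[of n x] assms(2)[of x] by (intro mult_left_mono mult_le_one) auto
      then show "norm (g x * (1 - us n x) * us n x) \<le> g x"
        using us(2)[of n x] assms(2)[of x] by (simp add: abs_mult mult.assoc)
    qed
    show "AE x in M. (\<lambda>n. g x * (1 - us n x) * us n x) \<longlonglongrightarrow> g x * (1 - 1) * 1"
      using lim by eventually_elim (intro tendsto_intros)
  qed (use assms(1) in measurable)
  then have lim0: "(\<lambda>n. \<integral>x. g x * (1 - us n x) * us n x \<partial>M) \<longlonglongrightarrow> 0" by simp
  show "(\<lambda>n. Qsq (us n)) \<longlonglongrightarrow> 0"
  proof (rule tendsto_sandwich_zero[OF _ _ lim0])
    show "\<forall>\<^sub>F n in sequentially. 0 \<le> Qsq (us n)"
      by (intro always_eventually allI Q_nonneg gen_rel_D[OF us(1)])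
    have "Qsq (us n) \<le> (\<integral>x. g x * (1 - us n x) * us n x \<partial>M)" for n
      unfolding gen_rel_Q[OF us(1) gen_rel_D[OF us(1)]]
    proof (rule integral_mono)
      have "(\<lambda>x. g x * (1 - us n x)) \<in> L2 M"
        using assms(2) us(2) by (intro L2_dominated[OF g]) (auto intro!: AE_I2 mult_left_le simp: abs_mult)
      then show "integrable M (\<lambda>x. g x * (1 - us n x) * us n x)"
        using D_L2[OF gen_rel_D[OF us(1)]] by (rule L2_mult_integrable)
      show "integrable M (\<lambda>x. (g x * (1 - us n x) - 1 / (real n + 1) * us n x) * us n x)"
        using gen_rel_L2[OF us(1)] D_L2[OF gen_rel_D[OF us(1)]] by (rule L2_mult_integrable)
      show "(g x * (1 - us n x) - 1 / (real n + 1) * us n x) * us n x \<le> g x * (1 - us n x) * us n x" for x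
        using us(2)[of n x] by (intro mult_right_mono) auto
    qed
    then show "\<forall>\<^sub>F n in sequentially. Qsq (us n) \<le> (\<integral>x. g x * (1 - us n x) * us n x \<partial>M)"
      by (intro always_eventually allI)
  qed
qed

lemma ext_gen_rel_one_if_integral_generator:
  assumes "\<And>u w. ext_gen_rel M D Q u w \<Longrightarrow> integrable M w \<Longrightarrow> (\<integral>x. w x \<partial>M) = 0"
  shows "ext_gen_rel M D Q (\<lambda>x. 1) (\<lambda>x. 0)"
proof -
  obtain g :: "'a \<Rightarrow> real" where g: "g \<in> borel_measurable M" "\<And>x. g x > 0" "\<And>x. g x \<le> 1" "integrable M g"
    using obtain_positive_integrable_function by blast
  have g01: "0 \<le> g x \<and> g x \<le> 1" for x using g(2,3)[of x] by simp
  obtain us u where us: "\<And>n. gen (us n) (\<lambda>x. g x * (1 - us n x) - 1 / (real n + 1) * us n x)"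
      "\<And>n x. 0 \<le> us n x \<and> us n x \<le> 1"
    and u: "u \<in> borel_measurable M" "\<And>x. 0 \<le> u x \<and> u x \<le> 1" "AE x in M. (\<lambda>n. us n x) \<longlonglongrightarrow> u x"
    by (rule ex_equilibrium[OF g(4) g01]) blast
  note [measurable] = g(1) u(1)
  have int: "integrable M (\<lambda>x. g x * (1 - u x))"
    using u(2) g01 by (intro Bochner_Integration.integrable_bound[OF g(4)]) (auto intro!: AE_I2 mult_left_le simp: abs_mult)
  have "(\<integral>x. g x * (1 - u x) \<partial>M) = 0"
    by (rule assms[OF equilibrium_ext_gen_rel[OF g(4) g01 us u] int])
  then have "AE x in M. g x * (1 - u x) = 0"
    using integral_nonneg_eq_0_iff_AE[OF int] u(2) g01 by (auto intro!: AE_I2)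
  then have "AE x in M. (\<lambda>n. us n x) \<longlonglongrightarrow> 1"
    using u(3)
  proof eventually_elim
    case (elim x)
    then have "u x = 1" using g(2)[of x] by auto
    with elim show ?case by simp
  qed
  then show ?thesis by (rule equilibrium_eq_1[OF g(4) g01 us])
qed

end

section \<open>The semigroup\<close>

text \<open>The bridge between the two descriptions of \<open>T\<close>: truncations of an
  integrable function lie in L1 and L2 and tend to it in L1, so contractivity carries facts from L2
  to L1.\<close>

definition trunc :: "nat \<Rightarrow> ('a \<Rightarrow> real) \<Rightarrow> 'a \<Rightarrow> real" where
  "trunc j f x = (if \<bar>f x\<bar> \<le> real j then f x else 0)"

lemma trunc_measurable [measurable]:
  assumes [measurable]: "f \<in> borel_measurable M" shows "trunc j f \<in> borel_measurable M"
  unfolding trunc_def[abs_def] by measurable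

lemma trunc_abs_le: "\<bar>trunc j f x\<bar> \<le> \<bar>f x\<bar>" "\<bar>f x - trunc j f x\<bar> \<le> \<bar>f x\<bar>"
  by (auto simp: trunc_def)

lemma trunc_integrable:
  assumes "integrable M f" shows "integrable M (trunc j f)"
  using borel_measurable_integrable[OF assms]
  by (intro Bochner_Integration.integrable_bound[OF assms] trunc_measurable) (auto simp: trunc_abs_le)

lemma trunc_L2:
  assumes "integrable M f" shows "trunc j f \<in> L2 M"
  by (intro L2_bounded_integrable[OF trunc_integrable[OF assms], of _ "real j"]) (auto simp: trunc_def)

lemma trunc_tendsto: "(\<lambda>j. trunc j f x) \<longlonglongrightarrow> f x"
proof -
  obtain N where "\<bar>f x\<bar> \<le> real N" using real_arch_simple by blast
  then have "trunc j f x = f x" if "j \<ge> N" for j using that by (auto simp: trunc_def)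
  then show ?thesis by (intro tendsto_eventually) (auto simp: eventually_sequentially)
qed

lemma trunc_L1_tendsto:
  assumes "integrable M f" shows "(\<lambda>j. \<integral>x. \<bar>f x - trunc j f x\<bar> \<partial>M) \<longlonglongrightarrow> 0"
proof -
  note [measurable] = borel_measurable_integrable[OF assms]
  have "(\<lambda>j. \<integral>x. \<bar>f x - trunc j f x\<bar> \<partial>M) \<longlonglongrightarrow> (\<integral>x. \<bar>f x - f x\<bar> \<partial>M)"
  proof (rule integral_dominated_convergence)
    show "integrable M (\<lambda>x. \<bar>f x\<bar>)" using assms by simp
    show "AE x in M. (\<lambda>j. \<bar>f x - trunc j f x\<bar>) \<longlonglongrightarrow> \<bar>f x - f x\<bar>"
      by (intro AE_I2 tendsto_intros trunc_tendsto)
  qed (auto simp: trunc_abs_le)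
  then show ?thesis by simp
qed

lemma integrable_mult_bounded:
  fixes f g :: "'a \<Rightarrow> real"
  assumes "integrable M f" "g \<in> borel_measurable M" "\<And>x. x \<in> space M \<Longrightarrow> \<bar>g x\<bar> \<le> B"
  shows "integrable M (\<lambda>x. f x * g x)" and "\<bar>\<integral>x. f x * g x \<partial>M\<bar> \<le> B * (\<integral>x. \<bar>f x\<bar> \<partial>M)"
proof -
  note [measurable] = borel_measurable_integrable[OF assms(1)] assms(2)
  have le: "\<bar>f x * g x\<bar> \<le> B * \<bar>f x\<bar>" if "x \<in> space M" for x
    using mult_right_mono[OF assms(3)[OF that], of "\<bar>f x\<bar>"] by (simp add: abs_mult mult.commute)
  have Bf: "integrable M (\<lambda>x. B * \<bar>f x\<bar>)" using assms(1) by simp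
  show int: "integrable M (\<lambda>x. f x * g x)"
    by (rule Bochner_Integration.integrable_bound[OF Bf]) (auto intro!: AE_I2 order_trans[OF le])
  have "\<bar>\<integral>x. f x * g x \<partial>M\<bar> \<le> (\<integral>x. \<bar>f x * g x\<bar> \<partial>M)" by (rule integral_abs_bound)
  also have "\<dots> \<le> (\<integral>x. B * \<bar>f x\<bar> \<partial>M)" using int Bf le by (intro integral_mono) auto
  finally show "\<bar>\<integral>x. f x * g x \<partial>M\<bar> \<le> B * (\<integral>x. \<bar>f x\<bar> \<partial>M)" by simp
qed

section \<open>The semigroup as given by its Cauchy problem\<close>

locale dirichlet_semigroup = dirichlet_space M D Q
  for M :: "'a measure" and D :: "('a \<Rightarrow> real) set" and Q :: "('a \<Rightarrow> real) \<Rightarrow> ('a \<Rightarrow> real) \<Rightarrow> real" +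
  fixes T :: "real \<Rightarrow> ('a \<Rightarrow> real) \<Rightarrow> 'a \<Rightarrow> real"
  assumes semigroup: "semigroup_of M D Q T"
begin

lemmas semigroup_unfolded = semigroup[unfolded semigroup_of_def]

lemma T_L2: "f \<in> L2 M \<Longrightarrow> t \<ge> 0 \<Longrightarrow> T t f \<in> L2 M"
  using semigroup_unfolded[THEN conjunct1] by blast

lemma T_0: "f \<in> L2 M \<Longrightarrow> AE x in M. T 0 f x = f x"
  using semigroup_unfolded[THEN conjunct2, THEN conjunct1] by blast

lemma T_continuous:
  assumes "f \<in> L2 M" "t \<ge> 0"
  shows "((\<lambda>s. Lsq (\<lambda>x. T s f x - T t f x)) \<longlongrightarrow> 0) (at t within {0..})"
proof -
  have "((\<lambda>s. l2norm M (\<lambda>x. T s f x - T t f x)) \<longlongrightarrow> 0) (at t within {0..})"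
    using semigroup_unfolded[THEN conjunct2, THEN conjunct2, THEN conjunct1] assms by blast
  from tendsto_power[OF this, of 2] show ?thesis by (simp add: l2norm_square)
qed

lemma T_derivative:
  assumes "f \<in> L2 M" "t > 0"
  obtains w where "gen (T t f) w"
    "((\<lambda>h. Lsq (\<lambda>x. (T (t + h) f x - T t f x) / h + w x)) \<longlongrightarrow> 0) (at 0)"
proof -
  obtain w where w: "gen (T t f) w"
    "((\<lambda>h. l2norm M (\<lambda>x. (T (t + h) f x - T t f x) / h + w x)) \<longlongrightarrow> 0) (at 0)"
    using semigroup_unfolded[THEN conjunct2, THEN conjunct2, THEN conjunct2, THEN conjunct1] assms by blast
  from tendsto_power[OF w(2), of 2] show ?thesis by (intro that[OF w(1)]) (simp add: l2norm_square)
qed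

lemma T_integrable: "integrable M f \<Longrightarrow> t \<ge> 0 \<Longrightarrow> integrable M (T t f)"
  using semigroup_unfolded[THEN conjunct2, THEN conjunct2, THEN conjunct2, THEN conjunct2, THEN conjunct1]
  unfolding L1_def by blast

lemma T_L1_contraction:
  "integrable M f \<Longrightarrow> integrable M g \<Longrightarrow> t \<ge> 0 \<Longrightarrow> (\<integral>x. \<bar>T t f x - T t g x\<bar> \<partial>M) \<le> (\<integral>x. \<bar>f x - g x\<bar> \<partial>M)"
  using semigroup_unfolded[THEN conjunct2, THEN conjunct2, THEN conjunct2, THEN conjunct2, THEN conjunct2]
  unfolding L1_def l1norm_def by blast

lemma eventually_at_0_nonneg: "t > 0 \<Longrightarrow> \<forall>\<^sub>F h in at (0::real). t + h \<ge> 0"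
  using eventually_at_filter by (auto simp: eventually_at dist_real_def intro!: exI[of _ t])

lemma pairing_continuous:
  assumes "f \<in> L2 M" "g \<in> L2 M"
  shows "continuous_on {0..} (\<lambda>s. pairing (T s f) g)"
  unfolding continuous_on_def
proof
  fix t :: real assume t: "t \<in> {0..}"
  show "((\<lambda>s. pairing (T s f) g) \<longlongrightarrow> pairing (T t f) g) (at t within {0..})"
  proof (rule integral_mult_tendsto)
    show "\<forall>\<^sub>F s in at t within {0..}. T s f \<in> L2 M"
      using T_L2[OF assms(1)] by (auto simp: eventually_at_filter)
  qed (use assms t T_L2 T_continuous in auto)
qed

lemma pairing_derivative:
  assumes "f \<in> L2 M" "g \<in> L2 M" "t > 0" "w \<in> L2 M"
    "((\<lambda>h. Lsq (\<lambda>x. (T (t + h) f x - T t f x) / h + w x)) \<longlongrightarrow> 0) (at 0)"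
  shows "((\<lambda>s. pairing (T s f) g) has_real_derivative (- pairing w g)) (at t)"
proof -
  have q: "\<forall>\<^sub>F h in at 0. (\<lambda>x. (T (t + h) f x - T t f x) / h) \<in> L2 M"
    using eventually_at_0_nonneg[OF assms(3)]
  proof eventually_elim
    case (elim h)
    have "(\<lambda>x. (1 / h) * (T (t + h) f x - T t f x)) \<in> L2 M"
      using elim assms(1,3) by (intro L2_scale L2_diff T_L2) auto
    then show ?case by simp
  qed
  have "(\<lambda>x. - 1 * w x) \<in> L2 M" by (intro L2_scale assms)
  then have "((\<lambda>h. \<integral>x. ((T (t + h) f x - T t f x) / h) * g x \<partial>M) \<longlongrightarrow> (\<integral>x. (- w x) * g x \<partial>M)) (at 0)"
    using assms(5) by (intro integral_mult_tendsto[OF q]) (auto simp: assms)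
  moreover have "\<forall>\<^sub>F h in at 0. (\<integral>x. ((T (t + h) f x - T t f x) / h) * g x \<partial>M) =
    (pairing (T (t + h) f) g - pairing (T t f) g) / h"
    using eventually_at_0_nonneg[OF assms(3)]
  proof eventually_elim
    case (elim h)
    have "(\<integral>x. ((T (t + h) f x - T t f x) / h) * g x \<partial>M) = (\<integral>x. (T (t + h) f x * g x - T t f x * g x) / h \<partial>M)"
      by (simp add: left_diff_distrib)
    then show ?case
      using elim assms(1-3) by (simp add: L2_mult_integrable T_L2)
  qed
  ultimately show ?thesis unfolding DERIV_def by (auto elim: Lim_transform_eventually)
qed

text \<open>The derivative of \<open>- \<integral> (T s f) u\<close> is \<open>Q (T s f) u\<close>,
  which symmetry turns into \<open>\<integral> (T s f) w\<close>. The fundamental theorem of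
  calculus moves the generator from the orbit to the fixed function \<open>u\<close>.\<close>

lemma weak_identity_L2:
  assumes "f \<in> L2 M" "gen u w" "r \<ge> 0"
  shows "(LBINT s:{0..r}. pairing (T s f) w) = pairing f u - pairing (T r f) u"
proof -
  note uD = gen_rel_D[OF assms(2)] and wL = gen_rel_L2[OF assms(2)]
  let ?F = "\<lambda>s. - pairing (T s f) u"
  have "((\<lambda>s. pairing (T s f) w) has_integral (?F r - ?F 0)) {0..r}"
  \<comment> \<open>The interior version, because at time 0 the orbit is only continuous.\<close>
  proof (rule fundamental_theorem_of_calculus_interior[OF assms(3)])
    show "continuous_on {0..r} ?F"
      by (intro continuous_on_minus continuous_on_subset[OF pairing_continuous[OF assms(1) D_L2[OF uD]]]) auto
    fix t assume t: "t \<in> {0<..<r}"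
    then have t0: "t > 0" by simp
    obtain v where v: "gen (T t f) v"
      "((\<lambda>h. Lsq (\<lambda>x. (T (t + h) f x - T t f x) / h + v x)) \<longlongrightarrow> 0) (at 0)"
      by (rule T_derivative[OF assms(1) t0])
    have "pairing v u = pairing w (T t f)"
      using gen_rel_Q[OF v(1) uD] gen_rel_Q[OF assms(2) gen_rel_D[OF v(1)]] Q_sym[OF uD gen_rel_D[OF v(1)]] by simp
    then have eq: "pairing v u = pairing (T t f) w" by (simp add: mult.commute)
    from DERIV_minus[OF pairing_derivative[OF assms(1) D_L2[OF uD] t0 gen_rel_L2[OF v(1)] v(2)]]
    show "(?F has_vector_derivative (pairing (T t f) w)) (at t)"
      by (simp add: eq has_real_derivative_iff_has_vector_derivative)
  qed
  then have "integral {0..r} (\<lambda>s. pairing (T s f) w) = ?F r - ?F 0" by (rule integral_unique)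
  moreover have "set_integrable lborel {0..r} (\<lambda>s. pairing (T s f) w)"
    by (intro borel_integrable_atLeastAtMost' continuous_on_subset[OF pairing_continuous[OF assms(1) wL]]) auto
  moreover have "pairing (T 0 f) u = pairing f u"
    using T_0[OF assms(1)] L2_measurable[OF T_L2[OF assms(1)], of 0] L2_measurable[OF assms(1)] D_measurable[OF uD]
    by (intro integral_cong_AE) auto
  ultimately show ?thesis by (simp add: set_borel_integral_eq_integral)
qed

text \<open>With \<open>\<theta> = C\<^sup>2\<close> one has \<open>\<theta>' = 2 C\<close>, so \<open>\<Phi> t = \<integral> \<theta> (T t f)\<close> has derivative \<open>- 2 Q (T t f) (C (T t f)) \<le> 0\<close>.\<close>

lemma T_preserves_zero_set:
  fixes C :: "real \<Rightarrow> real"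
  assumes C: "C 0 = 0" "\<And>s t. \<bar>C s - C t\<bar> \<le> \<bar>s - t\<bar>" "mono C"
    and C2: "\<And>a b. \<bar>(C b)\<^sup>2 - (C a)\<^sup>2 - 2 * C a * (b - a)\<bar> \<le> (b - a)\<^sup>2"
    and f: "f \<in> L2 M" "AE x in M. C (f x) = 0" and "t \<ge> 0"
  shows "AE x in M. C (T t f x) = 0"
proof -
  have [measurable]: "C \<in> borel_measurable borel"
  proof (rule borel_measurable_continuous_onI)
    show "continuous_on UNIV C"
      using C(2) by (intro lipschitz_on_continuous_on[of 1] lipschitz_onI) (auto simp: dist_real_def)
  qed
  have CL2: "(\<lambda>x. C (p x)) \<in> L2 M" if "p \<in> L2 M" for p
    proof (rule L2_dominated[OF that])
    show "(\<lambda>x. C (p x)) \<in> borel_measurable M" using L2_measurable[OF that] by measurable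
    show "AE x in M. \<bar>C (p x)\<bar> \<le> \<bar>p x\<bar>" using C(2)[of _ 0] by (intro AE_I2) (simp add: C(1))
  qed
  define \<Phi> where "\<Phi> s = Lsq (\<lambda>x. C (T s f x))" for s
  \<comment> \<open>The integrated form of the Taylor bound \<open>C2\<close>. Both the derivative
    and the continuity of \<open>\<Phi>\<close> follow from it.\<close>
  have est: "\<bar>\<Phi> b - \<Phi> a - 2 * (\<integral>x. C (T a f x) * (T b f x - T a f x) \<partial>M)\<bar> \<le> Lsq (\<lambda>x. T b f x - T a f x)"
    if "a \<ge> 0" "b \<ge> 0" for a b
  proof -
    note a = T_L2[OF f(1) that(1)] and b = T_L2[OF f(1) that(2)]
    have i: "integrable M (\<lambda>x. (C (T b f x))\<^sup>2)" "integrable M (\<lambda>x. (C (T a f x))\<^sup>2)"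
      "integrable M (\<lambda>x. C (T a f x) * (T b f x - T a f x))" "integrable M (\<lambda>x. (T b f x - T a f x)\<^sup>2)"
      using CL2 a b by (auto intro!: L2_integrable_square L2_mult_integrable)
    have eq: "\<Phi> b - \<Phi> a - 2 * (\<integral>x. C (T a f x) * (T b f x - T a f x) \<partial>M) =
      (\<integral>x. (C (T b f x))\<^sup>2 - (C (T a f x))\<^sup>2 - 2 * (C (T a f x) * (T b f x - T a f x)) \<partial>M)"
      unfolding \<Phi>_def using i by simp
    have "\<bar>\<Phi> b - \<Phi> a - 2 * (\<integral>x. C (T a f x) * (T b f x - T a f x) \<partial>M)\<bar> \<le> (\<integral>x. \<bar>(C (T b f x))\<^sup>2 - (C (T a f x))\<^sup>2 - 2 * (C (T a f x) * (T b f x - T a f x))\<bar> \<partial>M)"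
      unfolding eq by (rule integral_abs_bound)
    also have "\<dots> \<le> Lsq (\<lambda>x. T b f x - T a f x)"
      using i C2 by (intro integral_mono) (auto simp: mult.assoc)
    finally show ?thesis .
  qed
  have der: "\<exists>y. (\<Phi> has_real_derivative y) (at s) \<and> y \<le> 0" if s: "s > 0" for s
  proof -
    obtain w where w: "gen (T s f) w"
      "((\<lambda>h. Lsq (\<lambda>x. (T (s + h) f x - T s f x) / h + w x)) \<longlongrightarrow> 0) (at 0)"
      by (rule T_derivative[OF f(1) s])
    note TD = gen_rel_D[OF w(1)] and wL = gen_rel_L2[OF w(1)]
    have CD: "(\<lambda>x. C (T s f x)) \<in> D" by (rule contraction_D[OF TD C(1,2)])
    let ?A = "\<lambda>h. ((\<integral>x. T (s + h) f x * C (T s f x) \<partial>M) - (\<integral>x. T s f x * C (T s f x) \<partial>M)) / h"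
    let ?R = "\<lambda>h. (\<Phi> (s + h) - \<Phi> s) / h - 2 * ?A h"
    have A: "(?A \<longlongrightarrow> - (\<integral>x. w x * C (T s f x) \<partial>M)) (at 0)"
      using pairing_derivative[OF f(1) D_L2[OF CD] s wL w(2)] unfolding DERIV_def .
    have "((\<lambda>h. \<bar>?R h\<bar>) \<longlongrightarrow> 0) (at 0)"
    proof (rule tendsto_sandwich_zero)
      \<comment> \<open>The difference quotient converges to \<open>- w\<close> in L2, so its
        squared norm stays bounded and the Taylor remainder divided by \<open>h\<close> is of order
        \<open>h\<close>.\<close>
      let ?B = "\<lambda>h. \<bar>h\<bar> * (2 * Lsq (\<lambda>x. (T (s + h) f x - T s f x) / h + w x) + 2 * Lsq w)"
      have "(?B \<longlongrightarrow> \<bar>0\<bar> * (2 * 0 + 2 * Lsq w)) (at 0)"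
        by (intro tendsto_intros w(2))
      then show "(?B \<longlongrightarrow> 0) (at 0)" by simp
      have "\<forall>\<^sub>F h in at (0::real). h \<noteq> 0" by (simp add: eventually_at_filter)
      with eventually_at_0_nonneg[OF s] show "\<forall>\<^sub>F h in at 0. \<bar>?R h\<bar> \<le> ?B h"
      proof eventually_elim
        case (elim h)
        note a = T_L2[OF f(1) less_imp_le[OF s]] and b = T_L2[OF f(1) elim(1)]
        have e1: "(\<integral>x. C (T s f x) * (T (s + h) f x - T s f x) \<partial>M) = h * ?A h"
        proof -
          have "(\<integral>x. C (T s f x) * (T (s + h) f x - T s f x) \<partial>M) =
            (\<integral>x. T (s + h) f x * C (T s f x) - T s f x * C (T s f x) \<partial>M)"
            by (intro Bochner_Integration.integral_cong) (auto simp: algebra_simps)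
          then show ?thesis using elim(2) L2_mult_integrable[OF a CL2[OF a]] L2_mult_integrable[OF b CL2[OF a]] by simp
        qed
        have q: "(\<lambda>x. (T (s + h) f x - T s f x) / h) \<in> L2 M"
          using L2_scale[OF L2_diff[OF b a], of "1 / h"] by simp
        have m: "(\<lambda>x. - 1 * w x) \<in> L2 M" by (rule L2_scale[OF wL])
        have "Lsq (\<lambda>x. T (s + h) f x - T s f x) = h\<^sup>2 * Lsq (\<lambda>x. (T (s + h) f x - T s f x) / h)"
          using elim(2) by (simp add: power_divide)
        also have "Lsq (\<lambda>x. (T (s + h) f x - T s f x) / h) \<le>
          2 * Lsq (\<lambda>x. (T (s + h) f x - T s f x) / h + w x) + 2 * Lsq w"
          using integral_square_add_le[OF L2_add[OF q wL] m] by simp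
        finally have e2: "Lsq (\<lambda>x. T (s + h) f x - T s f x) \<le> \<bar>h\<bar> * ?B h"
          by (simp add: power2_eq_square mult_left_mono mult.assoc[symmetric])
        have "h * (p / h - 2 * q) = p - 2 * (h * q)" for p q :: real
          using elim(2) by (simp add: right_diff_distrib)
        then have "\<bar>h\<bar> * \<bar>?R h\<bar> = \<bar>\<Phi> (s + h) - \<Phi> s - 2 * (h * ?A h)\<bar>"
          unfolding abs_mult[symmetric] by (rule arg_cong)
        also have "\<dots> \<le> \<bar>h\<bar> * ?B h" using est[of s "s + h"] e1 e2 s elim(1) by simp
        finally show ?case using elim(2) by simp
      qed
    qed auto
    then have "(?R \<longlongrightarrow> 0) (at 0)" by (simp only: tendsto_rabs_zero_iff)
    from tendsto_add[OF this tendsto_mult_left[OF A, of 2]]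
    have "(\<Phi> has_real_derivative (0 + 2 * - (\<integral>x. w x * C (T s f x) \<partial>M))) (at s)"
      unfolding DERIV_def by simp
    moreover have "0 \<le> (\<integral>x. w x * C (T s f x) \<partial>M)"
      using Q_monotone_contraction_nonneg[OF TD C] gen_rel_Q[OF w(1) CD] by simp
    ultimately show ?thesis by (intro exI conjI) auto
  qed
  have cont: "continuous_on {0..t} \<Phi>"
    unfolding continuous_on_def
  proof
    fix s assume s: "s \<in> {0..t}"
    note a = T_L2[OF f(1), of s]
    have "((\<lambda>b. \<integral>x. T b f x * C (T s f x) \<partial>M) \<longlongrightarrow> (\<integral>x. T s f x * C (T s f x) \<partial>M)) (at s within {0..t})"
      using pairing_continuous[OF f(1) CL2[OF a]] s unfolding continuous_on_def
      by (auto intro: tendsto_within_subset)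
    then have p: "((\<lambda>b. 2 * \<bar>(\<integral>x. T b f x * C (T s f x) \<partial>M) - (\<integral>x. T s f x * C (T s f x) \<partial>M)\<bar>) \<longlongrightarrow>
       2 * \<bar>(\<integral>x. T s f x * C (T s f x) \<partial>M) - (\<integral>x. T s f x * C (T s f x) \<partial>M)\<bar>) (at s within {0..t})"
      by (intro tendsto_intros)
    have n: "((\<lambda>b. Lsq (\<lambda>x. T b f x - T s f x)) \<longlongrightarrow> 0) (at s within {0..t})"
      by (rule tendsto_within_subset[OF T_continuous[OF f(1)]]) (use s in auto)
    have "((\<lambda>b. \<bar>\<Phi> b - \<Phi> s\<bar>) \<longlongrightarrow> 0) (at s within {0..t})"
    proof (rule tendsto_sandwich_zero)
      show "((\<lambda>b. 2 * \<bar>(\<integral>x. T b f x * C (T s f x) \<partial>M) - (\<integral>x. T s f x * C (T s f x) \<partial>M)\<bar>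
        + Lsq (\<lambda>x. T b f x - T s f x)) \<longlongrightarrow> 0) (at s within {0..t})"
        using tendsto_add[OF p n] by simp
      have "\<forall>\<^sub>F b in at s within {0..t}. b \<in> {0..t}" by (auto simp: eventually_at_filter)
      then show "\<forall>\<^sub>F b in at s within {0..t}. \<bar>\<Phi> b - \<Phi> s\<bar> \<le>
        2 * \<bar>(\<integral>x. T b f x * C (T s f x) \<partial>M) - (\<integral>x. T s f x * C (T s f x) \<partial>M)\<bar> + Lsq (\<lambda>x. T b f x - T s f x)"
      proof eventually_elim
        case (elim b)
        have s0: "s \<ge> 0" and b0: "b \<ge> 0" using s elim by auto
        have "(\<integral>x. C (T s f x) * (T b f x - T s f x) \<partial>M) = (\<integral>x. T b f x * C (T s f x) - T s f x * C (T s f x) \<partial>M)"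
          by (intro Bochner_Integration.integral_cong) (auto simp: algebra_simps)
        also have "\<dots> = (\<integral>x. T b f x * C (T s f x) \<partial>M) - (\<integral>x. T s f x * C (T s f x) \<partial>M)"
          using L2_mult_integrable[OF T_L2[OF f(1) b0] CL2[OF a[OF s0]]] L2_mult_integrable[OF a[OF s0] CL2[OF a[OF s0]]]
          by simp
        finally have e: "(\<integral>x. C (T s f x) * (T b f x - T s f x) \<partial>M) = \<dots>" .
        have "\<bar>p\<bar> \<le> 2 * \<bar>q\<bar> + v" if "\<bar>p - 2 * q\<bar> \<le> v" for p q v :: real
          using that by linarith
        then show ?case using est[OF s0 b0] unfolding e .
      qed
    qed auto
    then have "((\<lambda>b. \<Phi> b - \<Phi> s) \<longlongrightarrow> 0) (at s within {0..t})" by (simp only: tendsto_rabs_zero_iff)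
    then show "(\<Phi> \<longlongrightarrow> \<Phi> s) (at s within {0..t})" by (rule LIM_zero_cancel)
  qed
  have "\<Phi> t \<le> \<Phi> 0"
    by (rule DERIV_nonpos_imp_decreasing_open[OF \<open>t \<ge> 0\<close> _ cont]) (use der in auto)
  also have "\<Phi> 0 = (\<integral>x. (0::real) \<partial>M)"
  proof -
    have "AE x in M. (C (T 0 f x))\<^sup>2 = 0" using T_0[OF f(1)] f(2) by eventually_elim simp
    then show ?thesis unfolding \<Phi>_def using L2_measurable[OF T_L2[OF f(1)], of 0] by (intro integral_cong_AE) auto
  qed
  finally show ?thesis
    using T_L2[OF f(1) \<open>t \<ge> 0\<close>] by (intro integral_square_eq_0_AE[OF CL2]) (auto simp: \<Phi>_def)
qed

lemma square_increment: "b\<^sup>2 - a\<^sup>2 - 2 * a * (b - a) = (b - a)\<^sup>2" for a b :: real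
  by (simp add: power2_eq_square algebra_simps)

text \<open>\<open>T_preserves_zero_set\<close> for \<open>C = min 0\<close>, which vanishes exactly
  on nonnegative values. In the Taylor bound only arguments of opposite sign need an
  argument.\<close>

lemma T_nonneg_L2:
  assumes "f \<in> L2 M" "AE x in M. 0 \<le> f x" "t \<ge> 0"
  shows "AE x in M. 0 \<le> T t f x"
proof -
  have C2: "\<bar>(min 0 b)\<^sup>2 - (min 0 a)\<^sup>2 - 2 * min 0 a * (b - a)\<bar> \<le> (b - a)\<^sup>2" for a b :: real
  proof -
    consider "a \<le> 0" "b \<le> 0" | "a \<le> 0" "b > 0" | "a > 0" "b \<le> 0" | "a > 0" "b > 0" by linarith
    then show ?thesis
    proof cases
      case 2
      have "- a\<^sup>2 - 2 * a * (b - a) = a * (a - 2 * b)" by (simp add: algebra_simps power2_eq_square)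
      moreover have "0 \<le> a * (a - 2 * b)" using 2 by (intro mult_nonpos_nonpos) auto
      moreover have "a * (a - 2 * b) \<le> (b - a)\<^sup>2" by (simp add: algebra_simps power2_eq_square)
      ultimately show ?thesis using 2 by (simp add: min_def)
    next
      case 3
      then show ?thesis using abs_le_square_iff[of b "b - a"] by (simp add: min_def)
    qed (simp_all add: min_def square_increment)
  qed
  have "AE x in M. min 0 (T t f x) = 0"
    by (rule T_preserves_zero_set[OF _ _ _ C2 assms(1) _ assms(3)])
      (use assms(2) in \<open>auto simp: min_def abs_if intro!: monoI elim!: AE_mp\<close>)
  then show ?thesis by eventually_elim (simp add: min_def split: if_splits)
qed

text \<open>Linearity of \<open>T\<close> is not among the assumptions; the identity as
  \<open>C\<close> gives this fact from the decay of the L2 norm. It turns L1 contractivity into a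
  bound on the L1 norm.\<close>

lemma T_zero:
  assumes "t \<ge> 0" shows "AE x in M. T t (\<lambda>x. 0) x = 0"
  by (rule T_preserves_zero_set[of "\<lambda>s. s"])
    (use assms in \<open>auto simp: square_increment intro!: monoI\<close>)

lemma T_L1_norm_le:
  assumes "integrable M f" "t \<ge> 0"
  shows "(\<integral>x. \<bar>T t f x\<bar> \<partial>M) \<le> (\<integral>x. \<bar>f x\<bar> \<partial>M)"
proof -
  note [measurable] = borel_measurable_integrable[OF T_integrable[OF assms]]
    borel_measurable_integrable[OF T_integrable[of "\<lambda>x. 0" t, OF integrable_zero assms(2)]]
  have "(\<integral>x. \<bar>T t f x\<bar> \<partial>M) = (\<integral>x. \<bar>T t f x - T t (\<lambda>x. 0) x\<bar> \<partial>M)"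
    using T_zero[OF assms(2)] by (intro integral_cong_AE) (auto elim!: AE_mp)
  also have "\<dots> \<le> (\<integral>x. \<bar>f x\<bar> \<partial>M)" using T_L1_contraction[OF assms(1) integrable_zero assms(2)] by simp
  finally show ?thesis .
qed

text \<open>The images of the truncations are nonnegative by the L2 case, so the negative part of
  \<open>T t f\<close> is no larger in L1 than the truncation error.\<close>

lemma T_nonneg:
  assumes "integrable M f" "AE x in M. 0 \<le> f x" "t \<ge> 0"
  shows "AE x in M. 0 \<le> T t f x"
proof -
  note Tf = T_integrable[OF assms(1,3)]
  have "(\<integral>x. \<bar>min 0 (T t f x)\<bar> \<partial>M) \<le> (\<integral>x. \<bar>f x - trunc j f x\<bar> \<partial>M)" for j
  proof -
    note Tj = T_integrable[OF trunc_integrable[OF assms(1)] assms(3), of j]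
    have "AE x in M. 0 \<le> T t (trunc j f) x"
      using assms(2) by (intro T_nonneg_L2 trunc_L2 assms(1,3)) (auto simp: trunc_def elim!: AE_mp)
    then have "AE x in M. \<bar>min 0 (T t f x)\<bar> \<le> \<bar>T t f x - T t (trunc j f) x\<bar>" by eventually_elim auto
    then have "(\<integral>x. \<bar>min 0 (T t f x)\<bar> \<partial>M) \<le> (\<integral>x. \<bar>T t f x - T t (trunc j f) x\<bar> \<partial>M)"
      using Tf Tj by (intro integral_mono_AE) auto
    also have "\<dots> \<le> (\<integral>x. \<bar>f x - trunc j f x\<bar> \<partial>M)"
      by (rule T_L1_contraction[OF assms(1) trunc_integrable[OF assms(1)] assms(3)])
    finally show ?thesis .
  qed
  then have "(\<integral>x. \<bar>min 0 (T t f x)\<bar> \<partial>M) \<le> 0"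
    by (intro LIMSEQ_le_const[OF trunc_L1_tendsto[OF assms(1)]]) auto
  moreover have "0 \<le> (\<integral>x. \<bar>min 0 (T t f x)\<bar> \<partial>M)" by (rule integral_nonneg_AE) simp
  ultimately have "(\<integral>x. \<bar>min 0 (T t f x)\<bar> \<partial>M) = 0" by (rule antisym)
  then have "AE x in M. \<bar>min 0 (T t f x)\<bar> = 0"
    using Tf by (subst (asm) integral_nonneg_eq_0_iff_AE) auto
  then show ?thesis by eventually_elim (simp add: min_def split: if_splits)
qed

lemma pairing_bounded:
  assumes "integrable M f" "g \<in> borel_measurable M" "\<And>x. x \<in> space M \<Longrightarrow> \<bar>g x\<bar> \<le> B" "0 \<le> B" "t \<ge> 0"
  shows "\<bar>pairing (T t f) g\<bar> \<le> B * (\<integral>x. \<bar>f x\<bar> \<partial>M)"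
  using integrable_mult_bounded(2)[OF T_integrable[OF assms(1,5)] assms(2,3)]
    mult_left_mono[OF T_L1_norm_le[OF assms(1,5)] assms(4)] by simp

text \<open>The bound is free of \<open>t\<close>. It therefore gives uniform convergence in time,
  whence continuity in \<open>pairing_continuous_L1\<close>.\<close>

lemma pairing_trunc:
  assumes "integrable M f" "g \<in> borel_measurable M" "\<And>x. x \<in> space M \<Longrightarrow> \<bar>g x\<bar> \<le> B" "0 \<le> B" "t \<ge> 0"
  shows "\<bar>pairing (T t (trunc j f)) g - pairing (T t f) g\<bar> \<le> B * (\<integral>x. \<bar>f x - trunc j f x\<bar> \<partial>M)"
proof -
  note Tf = T_integrable[OF assms(1,5)] and Tj = T_integrable[OF trunc_integrable[OF assms(1)] assms(5), of j]
  have d: "integrable M (\<lambda>x. T t (trunc j f) x - T t f x)" using Tf Tj by simp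
  have "pairing (T t (trunc j f)) g - pairing (T t f) g = (\<integral>x. (T t (trunc j f) x - T t f x) * g x \<partial>M)"
    using integrable_mult_bounded(1)[OF Tf assms(2,3)] integrable_mult_bounded(1)[OF Tj assms(2,3)]
    by (simp add: left_diff_distrib)
  also have "\<bar>\<dots>\<bar> \<le> B * (\<integral>x. \<bar>T t (trunc j f) x - T t f x\<bar> \<partial>M)"
    by (rule integrable_mult_bounded(2)[OF d assms(2,3)])
  also have "\<dots> \<le> B * (\<integral>x. \<bar>f x - trunc j f x\<bar> \<partial>M)"
    using T_L1_contraction[OF trunc_integrable[OF assms(1)] assms(1,5), of j] assms(4)
    by (intro mult_left_mono) (simp_all add: abs_minus_commute)
  finally show ?thesis .
qed

lemma pairing_trunc_tendsto:
  assumes "integrable M f" "g \<in> borel_measurable M" "\<And>x. x \<in> space M \<Longrightarrow> \<bar>g x\<bar> \<le> B" "0 \<le> B" "t \<ge> 0"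
  shows "(\<lambda>j. pairing (T t (trunc j f)) g) \<longlonglongrightarrow> pairing (T t f) g"
proof -
  have "(\<lambda>j. \<bar>pairing (T t (trunc j f)) g - pairing (T t f) g\<bar>) \<longlonglongrightarrow> 0"
  proof (rule tendsto_sandwich_zero)
    show "\<forall>\<^sub>F j in sequentially. \<bar>pairing (T t (trunc j f)) g - pairing (T t f) g\<bar>
        \<le> B * (\<integral>x. \<bar>f x - trunc j f x\<bar> \<partial>M)"
      by (intro always_eventually allI pairing_trunc assms)
    show "(\<lambda>j. B * (\<integral>x. \<bar>f x - trunc j f x\<bar> \<partial>M)) \<longlonglongrightarrow> 0"
      by (intro tendsto_mult_right_zero trunc_L1_tendsto assms(1))
  qed auto
  then show ?thesis by (intro LIM_zero_cancel[of "\<lambda>j. pairing (T t (trunc j f)) g"]) (simp only: tendsto_rabs_zero_iff)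
qed

lemma pairing_continuous_L1:
  assumes "integrable M f" "g \<in> L2 M" "\<And>x. x \<in> space M \<Longrightarrow> \<bar>g x\<bar> \<le> B" "0 \<le> B"
  shows "continuous_on {0..} (\<lambda>s. pairing (T s f) g)"
proof (rule uniform_limit_theorem)
  show "\<forall>\<^sub>F j in sequentially. continuous_on {0..} (\<lambda>s. pairing (T s (trunc j f)) g)"
    by (intro always_eventually allI pairing_continuous trunc_L2 assms)
  show "uniform_limit {0..} (\<lambda>j s. pairing (T s (trunc j f)) g) (\<lambda>s. pairing (T s f) g) sequentially"
  proof (rule uniform_limitI)
    fix e :: real assume "e > 0"
    have "(\<lambda>j. B * (\<integral>x. \<bar>f x - trunc j f x\<bar> \<partial>M)) \<longlonglongrightarrow> 0"
      by (intro tendsto_mult_right_zero trunc_L1_tendsto assms(1))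
    from order_tendstoD(2)[OF this \<open>e > 0\<close>]
    show "\<forall>\<^sub>F j in sequentially. \<forall>s\<in>{0..}. dist (pairing (T s (trunc j f)) g) (pairing (T s f) g) < e"
    proof eventually_elim
      case (elim j)
      then show ?case
        using pairing_trunc[OF assms(1) L2_measurable[OF assms(2)] assms(3,4), of _ j] unfolding dist_real_def by fastforce
    qed
  qed
qed simp

text \<open>A bounded \<open>g\<close> need not lie in L2. Its restrictions to sets of finite
  measure give continuous functions of time with the right pointwise limit, which settles
  measurability; the L1 bound settles integrability.\<close>

lemma pairing_set_integrable:
  assumes "integrable M f" "g \<in> borel_measurable M" "\<And>x. x \<in> space M \<Longrightarrow> \<bar>g x\<bar> \<le> B" "0 \<le> B"
  shows "set_integrable lborel {0..r} (\<lambda>s. pairing (T s f) g)"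
proof -
  obtain A :: "nat \<Rightarrow> 'a set" where A: "range A \<subseteq> sets M" "(\<Union>i. A i) = space M"
    "\<And>i. emeasure M (A i) \<noteq> \<infinity>" "incseq A"
    using sigma_finite_incseq by blast
  have [measurable]: "A i \<in> sets M" for i using A(1) by auto
  note [measurable] = assms(2)
  let ?g = "\<lambda>i x. g x * indicat_real (A i) x"
  have gb: "\<bar>?g i x\<bar> \<le> B" if "x \<in> space M" for i x
    using assms(3)[OF that] assms(4) by (auto simp: indicator_def)
  have gL: "?g i \<in> L2 M" for i
  proof (rule L2_bounded_integrable[of _ _ B])
    have "integrable M (\<lambda>x. B * indicat_real (A i) x)" using A(3)[of i] by (simp add: less_top)
    then show "integrable M (?g i)"
      by (rule Bochner_Integration.integrable_bound) (use assms(3,4) in \<open>auto simp: indicator_def intro!: AE_I2\<close>)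
  qed (use gb in auto)
  have lim: "(\<lambda>i. indicator {0..r} s *\<^sub>R (pairing (T s f) (?g i))) \<longlonglongrightarrow> indicator {0..r} s *\<^sub>R (pairing (T s f) g)" for s
  proof (cases "s \<in> {0..r}")
    case True
    then have s: "s \<ge> 0" by simp
    note [measurable] = borel_measurable_integrable[OF T_integrable[OF assms(1) s]]
    have "(\<lambda>i. pairing (T s f) (?g i)) \<longlonglongrightarrow> pairing (T s f) g"
    proof (rule integral_dominated_convergence)
      show "integrable M (\<lambda>x. \<bar>T s f x * g x\<bar>)"
        using integrable_mult_bounded(1)[OF T_integrable[OF assms(1) s] assms(2,3)] by simp
      show "AE x in M. (\<lambda>i. T s f x * ?g i x) \<longlonglongrightarrow> T s f x * g x"
      proof (rule AE_I2)
        fix x assume "x \<in> space M"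
        then obtain i where "x \<in> A i" using A(2) by auto
        then have "x \<in> A j" if "j \<ge> i" for j using A(4) that by (auto simp: incseq_def)
        then have "\<forall>\<^sub>F j in sequentially. T s f x * ?g j x = T s f x * g x"
          unfolding eventually_sequentially by (intro exI[of _ i]) auto
        then show "(\<lambda>i. T s f x * ?g i x) \<longlonglongrightarrow> T s f x * g x" by (rule tendsto_eventually)
      qed
    qed (auto simp: indicator_def)
    with True show ?thesis by simp
  qed simp
  have meas: "(\<lambda>s. indicator {0..r} s *\<^sub>R (pairing (T s f) g)) \<in> borel_measurable lborel"
  proof (rule borel_measurable_LIMSEQ_real[OF lim])
    fix i
    have "(\<lambda>s. indicator {0..r} s *\<^sub>R (pairing (T s f) (?g i))) \<in> borel_measurable borel"
      by (intro borel_measurable_continuous_on_indicator continuous_on_subset[OF pairing_continuous_L1[OF assms(1) gL gb assms(4)]]) auto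
    then show "(\<lambda>s. indicator {0..r} s *\<^sub>R (pairing (T s f) (?g i))) \<in> borel_measurable lborel" by simp
  qed
  show ?thesis unfolding set_integrable_def
  proof (rule Bochner_Integration.integrable_bound[OF _ meas])
    show "integrable lborel (\<lambda>s. indicator {0..r} s *\<^sub>R (B * (\<integral>x. \<bar>f x\<bar> \<partial>M)))"
      by (intro integrable_real_indicator integrable_scaleR_left impI) (auto simp: emeasure_lborel_Icc_eq)
    show "AE s in lborel. norm (indicator {0..r} s *\<^sub>R (pairing (T s f) g)) \<le>
       norm (indicator {0..r} s *\<^sub>R (B * (\<integral>x. \<bar>f x\<bar> \<partial>M)))"
    proof (rule AE_I2)
      fix s
      show "norm (indicator {0..r} s *\<^sub>R (pairing (T s f) g)) \<le> norm (indicator {0..r} s *\<^sub>R (B * (\<integral>x. \<bar>f x\<bar> \<partial>M)))"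
        using order_trans[OF pairing_bounded[OF assms, of s] abs_ge_self] by (auto simp: indicator_def)
    qed
  qed
qed

text \<open>The L2 identity for truncations of \<open>f\<close>; the bounds on \<open>u\<close> and
  \<open>w\<close> let both sides pass to the limit.\<close>

lemma weak_identity:
  assumes "integrable M f" "gen u w" "r \<ge> 0" "0 \<le> B"
    and "\<And>x. x \<in> space M \<Longrightarrow> \<bar>u x\<bar> \<le> B" "\<And>x. x \<in> space M \<Longrightarrow> \<bar>w x\<bar> \<le> B"
  shows "(LBINT s:{0..r}. pairing (T s f) w) = pairing f u - pairing (T r f) u"
proof -
  note um = D_measurable[OF gen_rel_D[OF assms(2)]] and wm = L2_measurable[OF gen_rel_L2[OF assms(2)]]
  have "(\<lambda>j. LBINT s:{0..r}. pairing (T s (trunc j f)) w) \<longlonglongrightarrow> (LBINT s:{0..r}. pairing (T s f) w)"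
    unfolding set_lebesgue_integral_def
  proof (rule integral_dominated_convergence)
    show "(\<lambda>s. indicator {0..r} s *\<^sub>R (pairing (T s f) w)) \<in> borel_measurable lborel"
      using pairing_set_integrable[OF assms(1) wm assms(6,4), of r] unfolding set_integrable_def by (rule borel_measurable_integrable)
    show "(\<lambda>s. indicator {0..r} s *\<^sub>R (pairing (T s (trunc j f)) w)) \<in> borel_measurable lborel" for j
      using pairing_set_integrable[OF trunc_integrable[OF assms(1)] wm assms(6,4), of r] unfolding set_integrable_def
      by (rule borel_measurable_integrable)
    show "integrable lborel (\<lambda>s. indicator {0..r} s *\<^sub>R (B * (\<integral>x. \<bar>f x\<bar> \<partial>M)))"
      by (intro integrable_real_indicator integrable_scaleR_left impI) (auto simp: emeasure_lborel_Icc_eq)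
    show "AE s in lborel. norm (indicator {0..r} s *\<^sub>R (pairing (T s (trunc j f)) w)) \<le>
       indicator {0..r} s *\<^sub>R (B * (\<integral>x. \<bar>f x\<bar> \<partial>M))" for j
    proof (rule AE_I2)
      fix s
      have "(\<integral>x. \<bar>trunc j f x\<bar> \<partial>M) \<le> (\<integral>x. \<bar>f x\<bar> \<partial>M)"
        using assms(1) trunc_integrable[OF assms(1), of j] by (intro integral_mono) (auto simp: trunc_abs_le)
      from mult_left_mono[OF this assms(4)]
      show "norm (indicator {0..r} s *\<^sub>R (pairing (T s (trunc j f)) w)) \<le> indicator {0..r} s *\<^sub>R (B * (\<integral>x. \<bar>f x\<bar> \<partial>M))"
        using pairing_bounded[OF trunc_integrable[OF assms(1)] wm assms(6,4), of s j] by (auto simp: indicator_def)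
    qed
    show "AE s in lborel. (\<lambda>j. indicator {0..r} s *\<^sub>R (pairing (T s (trunc j f)) w)) \<longlonglongrightarrow>
       indicator {0..r} s *\<^sub>R (pairing (T s f) w)"
    proof (rule AE_I2)
      fix s
      show "(\<lambda>j. indicator {0..r} s *\<^sub>R (pairing (T s (trunc j f)) w)) \<longlonglongrightarrow> indicator {0..r} s *\<^sub>R (pairing (T s f) w)"
        using pairing_trunc_tendsto[OF assms(1) wm assms(6,4), of s] by (cases "s \<in> {0..r}") auto
    qed
  qed
  moreover have "(\<lambda>j. pairing (trunc j f) u - pairing (T r (trunc j f)) u)
    \<longlonglongrightarrow> pairing f u - pairing (T r f) u"
  proof (rule tendsto_diff)
    note [measurable] = borel_measurable_integrable[OF assms(1)] um
    show "(\<lambda>j. pairing (trunc j f) u) \<longlonglongrightarrow> pairing f u"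
    proof (rule integral_dominated_convergence)
      show "integrable M (\<lambda>x. \<bar>f x * u x\<bar>)"
        using integrable_mult_bounded(1)[OF assms(1) um assms(5)] by simp
      show "AE x in M. (\<lambda>j. trunc j f x * u x) \<longlonglongrightarrow> f x * u x"
        by (intro AE_I2 tendsto_intros trunc_tendsto)
      show "AE x in M. norm (trunc j f x * u x) \<le> \<bar>f x * u x\<bar>" for j
        by (auto simp: trunc_def)
    qed measurable
    show "(\<lambda>j. pairing (T r (trunc j f)) u) \<longlonglongrightarrow> pairing (T r f) u"
      by (rule pairing_trunc_tendsto[OF assms(1) um assms(5,4,3)])
  qed
  ultimately show ?thesis
    unfolding weak_identity_L2[OF trunc_L2[OF assms(1)] assms(2,3)] by (rule LIMSEQ_unique)
qed

end

section \<open>Finite-time potentials\<close>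

lemma AE_le_if_integral_le:
  fixes F H :: "'a \<Rightarrow> real"
  assumes "integrable M F" "integrable M H"
    and "\<And>A. A \<in> sets M \<Longrightarrow> (\<integral>x. F x * indicator A x \<partial>M) \<le> (\<integral>x. H x * indicator A x \<partial>M)"
  shows "AE x in M. F x \<le> H x"
proof -
  note [measurable] = borel_measurable_integrable[OF assms(1)] borel_measurable_integrable[OF assms(2)]
  define A where "A = {x \<in> space M. H x < F x}"
  have A: "A \<in> sets M" unfolding A_def by measurable
  have i: "integrable M (\<lambda>x. F x * indicator A x)" "integrable M (\<lambda>x. H x * indicator A x)"
    using integrable_real_mult_indicator[OF A] assms(1,2) by auto
  have n: "AE x in M. 0 \<le> F x * indicator A x - H x * indicator A x"
    by (auto simp: A_def indicator_def)
  have d: "integrable M (\<lambda>x. F x * indicator A x - H x * indicator A x)" using i by simp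
  have "(\<integral>x. F x * indicator A x - H x * indicator A x \<partial>M) \<le> 0" using i assms(3)[OF A] by simp
  then have "(\<integral>x. F x * indicator A x - H x * indicator A x \<partial>M) = 0"
    using integral_nonneg_AE[OF n] by linarith
  then have "AE x in M. F x * indicator A x - H x * indicator A x = 0"
    using integral_nonneg_eq_0_iff_AE[OF d n] by blast
  then show ?thesis using AE_space by eventually_elim (auto simp: A_def indicator_def split: if_splits)
qed

text \<open>By monotone convergence the supremum of \<open>F n * p\<close> has integral at most
  \<open>K\<close>, so it is finite a.e., which excludes \<open>p > 0\<close> where
  \<open>F n\<close> is unbounded. Used for resolvents in the invariance argument and for
  \<open>g (1 - u)\<close> under recurrence.\<close>

lemma AE_zero_where_unbounded:
  fixes F :: "nat \<Rightarrow> 'a \<Rightarrow> real" and p :: "'a \<Rightarrow> real"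
  assumes "\<And>n. F n \<in> borel_measurable M" "p \<in> borel_measurable M" "\<And>x. 0 \<le> p x"
    and mono: "AE x in M. \<forall>n. 0 \<le> F n x \<and> F n x \<le> F (Suc n) x"
    and "\<And>n. integrable M (\<lambda>x. F n x * p x)" "\<And>n. (\<integral>x. F n x * p x \<partial>M) \<le> K"
  shows "AE x in M. (\<forall>k::nat. \<exists>n. real k < F n x) \<longrightarrow> p x = 0"
proof -
  note [measurable] = assms(1,2)
  have "(\<integral>\<^sup>+x. (SUP n. ennreal (F n x * p x)) \<partial>M) = (SUP n. \<integral>\<^sup>+x. ennreal (F n x * p x) \<partial>M)"
  proof (rule nn_integral_monotone_convergence_SUP_AE)
    show "AE x in M. ennreal (F i x * p x) \<le> ennreal (F (Suc i) x * p x)" for i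
      using mono by eventually_elim (intro ennreal_leI mult_right_mono assms(3), auto)
  qed measurable
  also have "\<dots> \<le> ennreal K"
  proof (rule SUP_least)
    fix n
    have "AE x in M. 0 \<le> F n x * p x" using mono by eventually_elim (auto simp: assms(3))
    then show "(\<integral>\<^sup>+x. ennreal (F n x * p x) \<partial>M) \<le> ennreal K"
      using assms(6)[of n] by (subst nn_integral_eq_integral[OF assms(5)]) (auto intro: ennreal_leI)
  qed
  also have "\<dots> < \<infinity>" by simp
  finally have "AE x in M. (SUP n. ennreal (F n x * p x)) \<noteq> \<infinity>"
    by (intro nn_integral_noteq_infinite) auto
  then show ?thesis
  proof eventually_elim
    case (elim x)
    show ?case
    proof (intro impI, rule ccontr)
      assume unb: "\<forall>k::nat. \<exists>n. real k < F n x" and "p x \<noteq> 0"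
      then have p: "p x > 0" using assms(3)[of x] by simp
      obtain c where c: "0 \<le> c" "(SUP n. ennreal (F n x * p x)) = ennreal c" using elim by (cases "SUP n. ennreal (F n x * p x)") auto
      obtain k :: nat where k: "c / p x < real k" using reals_Archimedean2 by blast
      obtain n where n: "real k < F n x" using unb by blast
      have "c / p x < F n x" using k n by linarith
      then have "c < F n x * p x" using p by (simp add: field_simps)
      then have "ennreal c < ennreal (F n x * p x)" using c(1) by (simp add: ennreal_lessI)
      also have "\<dots> \<le> ennreal c" unfolding c(2)[symmetric] by (rule SUP_upper) simp
      finally show False by simp
    qed
  qed
qed

context dirichlet_semigroup begin

lemma int_semigroup_integrable: "is_int_semigroup M T f r F \<Longrightarrow> integrable M F"
  by (simp add: is_int_semigroup_def L1_def)

lemma int_semigroup_pairing: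
  assumes "is_int_semigroup M T f r F" "g \<in> borel_measurable M" "\<And>x. x \<in> space M \<Longrightarrow> \<bar>g x\<bar> \<le> B"
  shows "pairing F g = (LBINT s:{0..r}. pairing (T s f) g)"
  using assms unfolding is_int_semigroup_def by blast

lemma pairing_nonneg:
  assumes "integrable M f" "AE x in M. 0 \<le> f x" "\<And>x. x \<in> space M \<Longrightarrow> 0 \<le> g x" "t \<ge> 0"
  shows "0 \<le> pairing (T t f) g"
proof (rule integral_nonneg_AE)
  show "AE x in M. 0 \<le> T t f x * g x"
    using T_nonneg[OF assms(1,2,4)] AE_space by eventually_elim (auto simp: assms(3))
qed

lemma pairing_integral_mono:
  assumes "integrable M f" "AE x in M. 0 \<le> f x" "r \<le> r'"
    and "g \<in> borel_measurable M" "\<And>x. x \<in> space M \<Longrightarrow> 0 \<le> g x \<and> g x \<le> B" "0 \<le> B"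
  shows "(LBINT s:{0..r}. pairing (T s f) g) \<le> (LBINT s:{0..r'}. pairing (T s f) g)"
proof -
  have B: "\<bar>g x\<bar> \<le> B" if "x \<in> space M" for x using assms(5)[OF that] by simp
  show ?thesis
    unfolding set_lebesgue_integral_def
  proof (rule integral_mono)
    show "integrable lborel (\<lambda>s. indicator {0..r} s *\<^sub>R (pairing (T s f) g))"
      "integrable lborel (\<lambda>s. indicator {0..r'} s *\<^sub>R (pairing (T s f) g))"
      using pairing_set_integrable[OF assms(1,4) B assms(6)] unfolding set_integrable_def by auto
    show "indicator {0..r} s *\<^sub>R (pairing (T s f) g) \<le> indicator {0..r'} s *\<^sub>R (pairing (T s f) g)" for s
      using pairing_nonneg[OF assms(1,2), of g s] assms(3,5) by (auto simp: indicator_def)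
  qed
qed

lemma int_semigroup_mono:
  assumes "integrable M f" "AE x in M. 0 \<le> f x" "r \<le> r'"
    and "is_int_semigroup M T f r F" "is_int_semigroup M T f r' F'"
  shows "AE x in M. F x \<le> F' x"
proof (rule AE_le_if_integral_le[OF int_semigroup_integrable[OF assms(4)] int_semigroup_integrable[OF assms(5)]])
  fix A assume A: "A \<in> sets M"
  have g: "indicat_real A \<in> borel_measurable M" "\<And>x. x \<in> space M \<Longrightarrow> 0 \<le> indicat_real A x \<and> indicat_real A x \<le> 1"
    "\<And>x. x \<in> space M \<Longrightarrow> \<bar>indicat_real A x\<bar> \<le> 1"
    using A by auto
  show "pairing F (indicator A) \<le> pairing F' (indicator A)"
    using pairing_integral_mono[OF assms(1-3) g(1,2)] int_semigroup_pairing[OF assms(4) g(1,3)]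
      int_semigroup_pairing[OF assms(5) g(1,3)] by simp
qed

lemma int_semigroup_nonneg:
  assumes "integrable M f" "AE x in M. 0 \<le> f x" "is_int_semigroup M T f r F"
  shows "AE x in M. 0 \<le> F x"
proof (rule AE_le_if_integral_le[OF integrable_zero int_semigroup_integrable[OF assms(3)]])
  fix A assume A: "A \<in> sets M"
  have g: "indicat_real A \<in> borel_measurable M" "\<And>x. x \<in> space M \<Longrightarrow> \<bar>indicat_real A x\<bar> \<le> 1"
    using A by auto
  have "0 \<le> (LBINT s:{0..r}. pairing (T s f) (indicat_real A))"
    unfolding set_lebesgue_integral_def
  proof (intro integral_nonneg_AE AE_I2)
    fix s
    show "0 \<le> indicat_real {0..r} s *\<^sub>R (pairing (T s f) (indicat_real A))"
      using pairing_nonneg[OF assms(1,2), of "indicat_real A" s] by (cases "s \<in> {0..r}") auto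
  qed
  then show "(\<integral>x. 0 * indicator A x \<partial>M) \<le> pairing F (indicator A)"
    using int_semigroup_pairing[OF assms(3) g] by simp
qed

lemma int_semigroup_zero:
  assumes "integrable M f" "AE x in M. f x = 0" "is_int_semigroup M T f r F"
  shows "AE x in M. F x = 0"
proof -
  note [measurable] = borel_measurable_integrable[OF assms(1)]
  have "(\<integral>x. \<bar>f x\<bar> \<partial>M) = (\<integral>x. (0::real) \<partial>M)"
    using assms(2) by (intro integral_cong_AE) auto
  then have f0: "(\<integral>x. \<bar>f x\<bar> \<partial>M) = 0" by simp
  have "AE x in M. F x \<le> 0"
  proof (rule AE_le_if_integral_le[OF int_semigroup_integrable[OF assms(3)] integrable_zero])
    fix A assume A: "A \<in> sets M"
    have g: "indicat_real A \<in> borel_measurable M" "\<And>x. x \<in> space M \<Longrightarrow> \<bar>indicat_real A x\<bar> \<le> 1"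
      using A by auto
    have "pairing (T s f) (indicat_real A) = 0" if "s \<in> {0..r}" for s
      using pairing_bounded[OF assms(1) g, of s] that f0 by simp
    then have "(LBINT s:{0..r}. pairing (T s f) (indicat_real A)) = (LBINT s:{0..r}. (0::real))"
      by (intro set_lebesgue_integral_cong) auto
    then show "pairing F (indicator A) \<le> (\<integral>x. 0 * indicator A x \<partial>M)"
      using int_semigroup_pairing[OF assms(3) g] by simp
  qed
  moreover have "AE x in M. 0 \<le> F x"
    using assms(2) by (intro int_semigroup_nonneg[OF assms(1) _ assms(3)]) auto
  ultimately show ?thesis by eventually_elim simp
qed

lemma int_semigroup_sequence_mono:
  assumes "integrable M f" "AE x in M. 0 \<le> f x" "\<And>n. is_int_semigroup M T f (real n) (F n)"
  shows "AE x in M. \<forall>n. 0 \<le> F n x \<and> F n x \<le> F (Suc n) x"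
proof -
  have "AE x in M. 0 \<le> F n x \<and> F n x \<le> F (Suc n) x" for n
    using int_semigroup_nonneg[OF assms(1,2) assms(3)[of n]]
      int_semigroup_mono[OF assms(1,2) _ assms(3)[of n] assms(3)[of "Suc n"]]
    by (auto elim!: AE_mp)
  then show ?thesis by (simp add: AE_all_countable)
qed

text \<open>Recurrence quantifies over Green functions, so one must exist before it yields anything.
  The functions \<open>T s f\<close> are unrelated representatives for different \<open>s\<close>,
  hence nothing gives joint measurability. The measures with density \<open>T s f\<close> are
  instead integrated over \<open>s\<close> as a kernel, and \<open>F\<close> is the Radon-Nikodym
  density of the result. The norm bound and the nonempty space make the kernel
  sub-probabilistic.\<close>

lemma ex_int_semigroup:
  assumes "integrable M f" "AE x in M. 0 \<le> f x" "(\<integral>x. \<bar>f x\<bar> \<partial>M) \<le> 1" "r \<ge> 0" "space M \<noteq> {}"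
  obtains F where "is_int_semigroup M T f r F"
proof -
  define L where "L = restrict_space lborel {0..r}"
  define K where "K s = density M (\<lambda>x. ennreal (T s f x))" for s
  have spL: "space L = {0..r}" by (simp add: L_def space_restrict_space)
  have Tm: "T s f \<in> borel_measurable M" if "s \<ge> 0" for s
    using T_integrable[OF assms(1) that] by (rule borel_measurable_integrable)
  have K: "(\<integral>\<^sup>+x. ennreal (g x) \<partial>K s) = ennreal (pairing (T s f) g)"
    if s: "s \<in> {0..r}" and g: "g \<in> borel_measurable M" "\<And>x. x \<in> space M \<Longrightarrow> 0 \<le> g x \<and> g x \<le> B" for s g B
  proof -
    have s0: "s \<ge> 0" using s by simp
    note [measurable] = g(1) Tm[OF s0]
    have gB: "\<bar>g x\<bar> \<le> B" if "x \<in> space M" for x using g(2)[OF that] by simp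
    have pos: "AE x in M. 0 \<le> T s f x" by (rule T_nonneg[OF assms(1,2) s0])
    have "(\<integral>\<^sup>+x. ennreal (g x) \<partial>K s) = (\<integral>\<^sup>+x. ennreal (T s f x) * ennreal (g x) \<partial>M)"
      unfolding K_def by (subst nn_integral_density) auto
    also have "\<dots> = (\<integral>\<^sup>+x. ennreal (T s f x * g x) \<partial>M)"
      using pos AE_space by (intro nn_integral_cong_AE, eventually_elim) (auto simp: ennreal_mult g(2))
    also have "\<dots> = ennreal (pairing (T s f) g)"
    proof (rule nn_integral_eq_integral[OF integrable_mult_bounded(1)[OF T_integrable[OF assms(1) s0] g(1) gB]])
      show "AE x in M. 0 \<le> T s f x * g x" using pos AE_space by eventually_elim (auto simp: g(2))
    qed
    finally show ?thesis .
  qed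
  have Km: "(\<lambda>s. ennreal (pairing (T s f) g)) \<in> borel_measurable L"
    if g: "g \<in> borel_measurable M" "\<And>x. x \<in> space M \<Longrightarrow> \<bar>g x\<bar> \<le> B" "0 \<le> B" for g and B :: real
  proof -
    have "(\<lambda>s. indicator {0..r} s *\<^sub>R (pairing (T s f) g)) \<in> borel_measurable lborel"
      using pairing_set_integrable[OF assms(1) g, of r] unfolding set_integrable_def by (rule borel_measurable_integrable)
    then have "(\<lambda>s. pairing (T s f) g) \<in> borel_measurable L"
      unfolding L_def by (subst borel_measurable_restrict_space_iff) auto
    then show ?thesis by measurable
  qed
  have emK: "emeasure (K s) A = ennreal (pairing (T s f) (indicator A))" if "s \<in> {0..r}" "A \<in> sets M" for s A
  proof -
    have "emeasure (K s) A = (\<integral>\<^sup>+x. indicator A x \<partial>K s)" using that(2) by (simp add: K_def)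
    also have "\<dots> = (\<integral>\<^sup>+x. ennreal (indicat_real A x) \<partial>K s)" by (intro nn_integral_cong) (auto simp: indicator_def)
    also have "\<dots> = ennreal (pairing (T s f) (indicator A))"
      using that by (intro K[of _ _ 1]) auto
    finally show ?thesis .
  qed
  \<comment> \<open>For a kernel only the mass of each single set must be measurable in
    \<open>s\<close>, and that is a pairing with an indicator.\<close>
  have Kk: "K \<in> measurable L (subprob_algebra M)"
  proof (rule measurable_subprob_algebra)
    fix s assume "s \<in> space L"
    then have s: "s \<in> {0..r}" by (simp add: spL)
    show "subprob_space (K s)"
    proof (rule subprob_spaceI)
      have "\<bar>\<integral>x. T s f x * indicator (space M) x \<partial>M\<bar> \<le> 1 * (\<integral>x. \<bar>f x\<bar> \<partial>M)"
        using s by (intro pairing_bounded[OF assms(1)]) auto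
      then have "(\<integral>x. T s f x * indicator (space M) x \<partial>M) \<le> 1" using assms(3) by simp
      then show "emeasure (K s) (space (K s)) \<le> 1"
        using emK[OF s, of "space M"] by (simp add: K_def ennreal_le_1)
      show "space (K s) \<noteq> {}" using assms(5) by (simp add: K_def)
    qed
    show "sets (K s) = sets M" by (simp add: K_def)
  next
    fix A assume A: "A \<in> sets M"
    have "(\<lambda>s. ennreal (pairing (T s f) (indicator A))) \<in> borel_measurable L"
      using A by (intro Km[of _ 1]) auto
    then show "(\<lambda>s. emeasure (K s) A) \<in> borel_measurable L"
      by (rule measurable_cong[THEN iffD1, rotated]) (use A emK in \<open>auto simp: spL\<close>)
  qed
  define N where "N = L \<bind> K"
  have ne: "space L \<noteq> {}" using assms(4) by (simp add: spL)
  have setsN: "sets N = sets M" unfolding N_def by (rule sets_bind_measurable[OF Kk ne])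
  have "absolutely_continuous M N"
    unfolding absolutely_continuous_def
  proof
    fix A assume A: "A \<in> null_sets M"
    then have As: "A \<in> sets M" by auto
    have "emeasure N A = (\<integral>\<^sup>+s. emeasure (K s) A \<partial>L)"
      unfolding N_def by (rule emeasure_bind[OF ne Kk As])
    also have "\<dots> = (\<integral>\<^sup>+s. 0 \<partial>L)"
    proof (rule nn_integral_cong)
      fix s assume "s \<in> space L"
      then have s: "s \<in> {0..r}" by (simp add: spL)
      have "pairing (T s f) (indicator A) = (\<integral>x. (0::real) \<partial>M)"
        using AE_not_in[OF A] Tm[of s] s As by (intro integral_cong_AE) (auto elim!: AE_mp)
      then show "emeasure (K s) A = 0" using emK[OF s As] by simp
    qed
    finally show "A \<in> null_sets N" using As setsN by (auto simp: null_sets_def)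
  qed
  then obtain h where h: "h \<in> borel_measurable M" "density M h = N"
    using Radon_Nikodym[OF _ setsN] by blast
  note [measurable] = h(1)
  have key: "(\<integral>\<^sup>+x. h x * ennreal (g x) \<partial>M) = ennreal (LBINT s:{0..r}. pairing (T s f) g)"
    if g: "g \<in> borel_measurable M" "\<And>x. x \<in> space M \<Longrightarrow> 0 \<le> g x \<and> g x \<le> B" "0 \<le> B" for g and B :: real
  proof -
    note [measurable] = g(1)
    have gB: "\<bar>g x\<bar> \<le> B" if "x \<in> space M" for x using g(2)[OF that] by simp
    have "(\<integral>\<^sup>+x. h x * ennreal (g x) \<partial>M) = (\<integral>\<^sup>+x. ennreal (g x) \<partial>N)"
      unfolding h(2)[symmetric] by (subst nn_integral_density) auto
    also have "\<dots> = (\<integral>\<^sup>+s. \<integral>\<^sup>+x. ennreal (g x) \<partial>K s \<partial>L)"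
      unfolding N_def by (rule nn_integral_bind[OF _ Kk]) measurable
    also have "\<dots> = (\<integral>\<^sup>+s. ennreal (pairing (T s f) g) \<partial>L)"
      by (intro nn_integral_cong K[OF _ g(1,2)]) (auto simp: spL)
    also have "\<dots> = (\<integral>\<^sup>+s. ennreal (pairing (T s f) g) * indicator {0..r} s \<partial>lborel)"
      unfolding L_def by (subst nn_integral_restrict_space) auto
    also have "\<dots> = (\<integral>\<^sup>+s. ennreal (indicator {0..r} s *\<^sub>R (pairing (T s f) g)) \<partial>lborel)"
      by (intro nn_integral_cong) (auto simp: indicator_def)
    also have "\<dots> = ennreal (LBINT s:{0..r}. pairing (T s f) g)"
      unfolding set_lebesgue_integral_def
    proof (rule nn_integral_eq_integral)
      show "integrable lborel (\<lambda>s. indicator {0..r} s *\<^sub>R (pairing (T s f) g))"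
        using pairing_set_integrable[OF assms(1) g(1) gB g(3)] unfolding set_integrable_def by auto
      show "AE s in lborel. 0 \<le> indicator {0..r} s *\<^sub>R (pairing (T s f) g)"
        using pairing_nonneg[OF assms(1,2), of g] g(2) by (auto intro!: AE_I2 simp: indicator_def)
    qed
    finally show ?thesis .
  qed
  have "(\<integral>\<^sup>+x. h x \<partial>M) = ennreal (LBINT s:{0..r}. \<integral>x. T s f x * 1 \<partial>M)"
    using key[of "\<lambda>x. 1" 1] by simp
  then have hfin: "(\<integral>\<^sup>+x. h x \<partial>M) < \<infinity>" by simp
  then have hAE: "AE x in M. h x \<noteq> \<infinity>" by (intro nn_integral_noteq_infinite) auto
  define F where "F x = enn2real (h x)" for x
  have [measurable]: "F \<in> borel_measurable M" unfolding F_def by measurable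
  have Fh: "AE x in M. ennreal (F x) = h x"
    using hAE by eventually_elim (simp add: F_def less_top)
  have F0: "0 \<le> F x" for x by (simp add: F_def)
  have Fint: "integrable M F"
  proof (rule integrableI_bounded)
    have "(\<integral>\<^sup>+x. ennreal (norm (F x)) \<partial>M) = (\<integral>\<^sup>+x. h x \<partial>M)"
      using Fh by (intro nn_integral_cong_AE, eventually_elim) (simp add: F0)
    then show "(\<integral>\<^sup>+x. ennreal (norm (F x)) \<partial>M) < \<infinity>" using hfin by simp
  qed measurable
  have pos: "pairing F g = (LBINT s:{0..r}. pairing (T s f) g)"
    if g: "g \<in> borel_measurable M" "\<And>x. x \<in> space M \<Longrightarrow> 0 \<le> g x \<and> g x \<le> B" "0 \<le> B" for g and B :: real
  proof -
    note [measurable] = g(1)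
    have gB: "\<bar>g x\<bar> \<le> B" if "x \<in> space M" for x using g(2)[OF that] by simp
    have "ennreal (pairing F g) = (\<integral>\<^sup>+x. ennreal (F x * g x) \<partial>M)"
      using integrable_mult_bounded(1)[OF Fint g(1) gB]
      by (intro nn_integral_eq_integral[symmetric]) (auto intro!: AE_I2 simp: F0 g(2))
    also have "\<dots> = (\<integral>\<^sup>+x. h x * ennreal (g x) \<partial>M)"
      using Fh AE_space by (intro nn_integral_cong_AE, eventually_elim) (simp add: ennreal_mult' F0 g(2))
    also have "\<dots> = ennreal (LBINT s:{0..r}. pairing (T s f) g)" by (rule key[OF g])
    finally have e: "ennreal (pairing F g) = ennreal (LBINT s:{0..r}. pairing (T s f) g)" .
    have "0 \<le> pairing F g" by (intro integral_nonneg_AE AE_I2 mult_nonneg_nonneg F0) (simp add: g(2))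
    moreover have "0 \<le> (LBINT s:{0..r}. pairing (T s f) g)"
      unfolding set_lebesgue_integral_def using pairing_nonneg[OF assms(1,2), of g] g(2)
      by (auto intro!: integral_nonneg_AE AE_I2 simp: indicator_def)
    ultimately show ?thesis using e by (simp add: ennreal_inj)
  qed
  have "is_int_semigroup M T f r F"
    unfolding is_int_semigroup_def
  proof (intro conjI ballI impI)
    show "F \<in> L1 M" using Fint by (simp add: L1_def)
    fix g :: "'a \<Rightarrow> real" assume g: "g \<in> borel_measurable M" and "\<exists>B. \<forall>x\<in>space M. \<bar>g x\<bar> \<le> B"
    then obtain B where B: "\<And>x. x \<in> space M \<Longrightarrow> \<bar>g x\<bar> \<le> B" by blast
    note [measurable] = g
    have B0: "0 \<le> B" using assms(5) B by force
    \<comment> \<open>The nonnegative integral determines pairings with nonnegative functions only,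
      so a signed test function is split.\<close>
    let ?p = "\<lambda>x. max 0 (g x)" and ?q = "\<lambda>x. max 0 (- g x)"
    have p: "?p \<in> borel_measurable M" "\<And>x. x \<in> space M \<Longrightarrow> 0 \<le> ?p x \<and> ?p x \<le> B" "\<And>x. x \<in> space M \<Longrightarrow> \<bar>?p x\<bar> \<le> B"
      using B B0 by (auto simp: abs_le_iff)
    have q: "?q \<in> borel_measurable M" "\<And>x. x \<in> space M \<Longrightarrow> 0 \<le> ?q x \<and> ?q x \<le> B" "\<And>x. x \<in> space M \<Longrightarrow> \<bar>?q x\<bar> \<le> B"
      using B B0 by (auto simp: abs_le_iff)
    have split: "k * g x = k * ?p x - k * ?q x" for k x by (auto simp: max_def)
    have dec: "pairing k g = pairing k ?p - pairing k ?q" if "integrable M k" for k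
      unfolding split using integrable_mult_bounded(1)[OF that p(1,3)] integrable_mult_bounded(1)[OF that q(1,3)]
      by (rule Bochner_Integration.integral_diff)
    have "(LBINT s:{0..r}. pairing (T s f) g) =
      (LBINT s:{0..r}. pairing (T s f) ?p - pairing (T s f) ?q)"
      by (intro set_lebesgue_integral_cong) (auto intro!: dec T_integrable assms(1))
    also have "\<dots> = (LBINT s:{0..r}. pairing (T s f) ?p) - (LBINT s:{0..r}. pairing (T s f) ?q)"
      by (intro set_integral_diff pairing_set_integrable[OF assms(1) p(1,3) B0] pairing_set_integrable[OF assms(1) q(1,3) B0])
    also have "\<dots> = pairing F g"
      using dec[OF Fint] pos[OF p(1,2) B0] pos[OF q(1,2) B0] by simp
    finally show "pairing F g = (LBINT s:{0..r}. pairing (T s f) g)" ..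
  qed
  then show ?thesis by (rule that)
qed

end

section \<open>Invariance and recurrence\<close>

context dirichlet_space begin

text \<open>If the resolvents map functions supported in \<open>A\<close> to functions supported in \<open>A\<close>, then by symmetry
  they also preserve functions supported off \<open>A\<close>, so they commute with multiplication by the indicator.\<close>

lemma invariant_set_if_resolvent_supported:
  assumes A: "A \<in> sets M"
    and loc: "\<And>\<beta> p v. \<beta> > 0 \<Longrightarrow> p \<in> L2 M \<Longrightarrow> gen v (\<lambda>x. \<beta> * (indicator A x * p x - v x)) \<Longrightarrow>
       AE x in M. x \<notin> A \<longrightarrow> v x = 0"
  shows "invariant_set M D Q A"
proof -
  note [measurable] = A
  have ind: "(\<lambda>x. indicator A x * p x) \<in> L2 M" if "p \<in> L2 M" for p
    using that by (intro L2_bounded_mult[of _ _ _ 1]) auto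
  have loc': "AE x in M. x \<in> A \<longrightarrow> v x = 0"
    if \<beta>: "\<beta> > 0" and p: "p \<in> L2 M" and v: "gen v (\<lambda>x. \<beta> * ((p x - indicator A x * p x) - v x))" for \<beta> p v
  proof -
    note vL = D_L2[OF gen_rel_D[OF v]]
    \<comment> \<open>The data contain the solution \<open>v\<close> under study, so symmetry
      produces \<open>\<integral> v\<^sup>2\<close> over \<open>A\<close> on one side; on the other,
      \<open>y\<close> vanishes off \<open>A\<close> and the data of \<open>v\<close> vanish on
      \<open>A\<close>.\<close>
    obtain y where y: "gen y (\<lambda>x. \<beta> * (indicator A x * v x - y x))"
      using ex_resolvent[OF weight_const[OF \<beta>] ind[OF vL]] .
    note [measurable] = L2_measurable[OF vL] L2_measurable[OF p] D_measurable[OF gen_rel_D[OF y]]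
    have "(\<integral>x. (indicator A x * v x) * v x \<partial>M) = (\<integral>x. (p x - indicator A x * p x) * y x \<partial>M)"
      by (rule resolvent_symmetric[OF ind[OF vL] L2_diff[OF p ind[OF p]] \<beta> y v])
    also have "\<dots> = (\<integral>x. (0::real) \<partial>M)"
    proof (rule integral_cong_AE)
      show "AE x in M. (p x - indicator A x * p x) * y x = 0"
        using loc[OF \<beta> vL y] by eventually_elim (auto simp: indicator_def)
    qed measurable
    also have "(\<lambda>x. (indicator A x * v x) * v x) = (\<lambda>x. (indicator A x * v x)\<^sup>2)"
      by (auto simp: indicator_def power2_eq_square)
    finally have "Lsq (\<lambda>x. indicator A x * v x) \<le> 0" by simp
    from integral_square_eq_0_AE[OF ind[OF vL] this] show ?thesis by eventually_elim (auto simp: indicator_def)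
  qed
  have "(\<lambda>x. indicator A x * p x) \<in> D \<and> Qsq p = Qsq (\<lambda>x. indicator A x * p x)
       + Qsq (\<lambda>x. indicator (space M - A) x * p x)" if p: "p \<in> D" for p
  proof -
    note pL = D_L2[OF p]
    let ?pA = "\<lambda>x. indicator A x * p x" and ?pB = "\<lambda>x. p x - indicator A x * p x"
    note pA = ind[OF pL] and pB = L2_diff[OF pL ind[OF pL]]
    obtain v where v: "\<And>n. gen (v n) (\<lambda>x. (real n + 1) * (p x - v n x))"
      by (rule ex_resolvent_sequence[OF pL]) blast
    obtain a where a: "\<And>n. gen (a n) (\<lambda>x. (real n + 1) * (?pA x - a n x))"
      by (rule ex_resolvent_sequence[OF pA]) blast
    define b where "b n x = v n x - a n x" for n x
    have b: "gen (b n) (\<lambda>x. (real n + 1) * (?pB x - b n x))" for n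
    proof -
      have "(\<lambda>x. (real n + 1) * (p x - v n x) - (real n + 1) * (?pA x - a n x)) = (\<lambda>x. (real n + 1) * (?pB x - b n x))"
        by (auto simp: b_def algebra_simps)
      with gen_rel_diff[OF v[of n] a[of n]] show ?thesis by (simp add: b_def[abs_def])
    qed
    note vD = gen_rel_D[OF v] and aD = gen_rel_D[OF a] and bD = gen_rel_D[OF b]
    note [measurable] = D_measurable[OF p] D_measurable[OF vD] D_measurable[OF aD] D_measurable[OF bD]
    have pos: "real n + 1 > 0" for n by simp
    have a0: "AE x in M. x \<notin> A \<longrightarrow> a n x = 0" for n by (rule loc[OF pos pL a])
    have b0: "AE x in M. x \<in> A \<longrightarrow> b n x = 0" for n by (rule loc'[OF pos pL b])
    \<comment> \<open>The generator applied to \<open>a n\<close> vanishes off \<open>A\<close>,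
      while \<open>b m\<close> vanishes on \<open>A\<close>. Energies hence add, and the Cauchy
      property of \<open>v\<close> passes to both parts.\<close>
    have cross: "Q (a n) (b m) = 0" for n m
    proof -
      have "Q (a n) (b m) = (\<integral>x. (real n + 1) * (?pA x - a n x) * b m x \<partial>M)" by (rule gen_rel_Q[OF a bD])
      also have "\<dots> = (\<integral>x. (0::real) \<partial>M)"
      proof (rule integral_cong_AE)
        show "AE x in M. (real n + 1) * (?pA x - a n x) * b m x = 0"
          using a0[of n] b0[of m] by eventually_elim (auto simp: indicator_def)
      qed measurable
      finally show ?thesis by simp
    qed
    have split: "Qsq (\<lambda>x. v n x - v m x) =
      Qsq (\<lambda>x. a n x - a m x) + Qsq (\<lambda>x. b n x - b m x)" for n m
    proof -
      have e: "(\<lambda>x. v n x - v m x) = (\<lambda>x. (a n x - a m x) + (b n x - b m x))" by (auto simp: b_def)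
      show ?thesis
        unfolding e Q_square_add[OF D_diff[OF aD aD] D_diff[OF bD bD]]
        by (simp add: Q_diff_left Q_diff_right aD bD cross)
    qed
    note vlim = resolvent_approximation[OF p v]
    have Qa: "Q_Cauchy a"
      unfolding Q_Cauchy_def
    proof (intro allI impI)
      fix e :: real assume "e > 0"
      then obtain N where N: "\<And>n m. n \<ge> N \<Longrightarrow> m \<ge> N \<Longrightarrow> Qsq (\<lambda>x. v n x - v m x) < e"
        using vlim(1)[unfolded Q_Cauchy_def, rule_format, of e] by auto
      have "Qsq (\<lambda>x. a n x - a m x) < e" if "n \<ge> N" "m \<ge> N" for n m
        using N[OF that] split[of n m] Q_nonneg[OF D_diff[OF bD[of n] bD[of m]]] by linarith
      then show "\<exists>N. \<forall>n\<ge>N. \<forall>m\<ge>N. Qsq (\<lambda>x. a n x - a m x) < e" by blast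
    qed
    have Qb: "Q_Cauchy b" using Q_Cauchy_diff[OF vD aD vlim(1) Qa] by (simp add: b_def[abs_def])
    \<comment> \<open>On \<open>A\<close> the functions \<open>a n\<close> and \<open>v n\<close>
      agree a.e.; off \<open>A\<close> both \<open>a n\<close> and the restricted \<open>p\<close>
      vanish.\<close>
    have aL: "(\<lambda>n. Lsq (\<lambda>x. a n x - ?pA x)) \<longlonglongrightarrow> 0"
    proof (rule tendsto_sandwich_zero[OF _ _ vlim(2)])
      have "Lsq (\<lambda>x. a n x - ?pA x) \<le> Lsq (\<lambda>x. v n x - p x)" for n
      proof (rule integral_mono_AE)
        show "AE x in M. (a n x - ?pA x)\<^sup>2 \<le> (v n x - p x)\<^sup>2"
          using a0[of n] b0[of n] by eventually_elim (auto simp: b_def indicator_def)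
      qed (intro L2_integrable_square L2_diff pA pL D_L2[OF aD] D_L2[OF vD])+
      then show "\<forall>\<^sub>F n in sequentially. Lsq (\<lambda>x. a n x - ?pA x) \<le> Lsq (\<lambda>x. v n x - p x)"
        by (intro always_eventually allI)
    qed (auto intro!: always_eventually)
    have bL: "(\<lambda>n. Lsq (\<lambda>x. b n x - ?pB x)) \<longlonglongrightarrow> 0"
    proof (rule tendsto_sandwich_zero[OF _ _ vlim(2)])
      have "Lsq (\<lambda>x. b n x - ?pB x) \<le> Lsq (\<lambda>x. v n x - p x)" for n
      proof (rule integral_mono_AE)
        show "AE x in M. (b n x - ?pB x)\<^sup>2 \<le> (v n x - p x)\<^sup>2"
          using a0[of n] b0[of n] by eventually_elim (auto simp: b_def indicator_def)
      qed (intro L2_integrable_square L2_diff pA pL D_L2[OF bD] D_L2[OF vD])+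
      then show "\<forall>\<^sub>F n in sequentially. Lsq (\<lambda>x. b n x - ?pB x) \<le> Lsq (\<lambda>x. v n x - p x)"
        by (intro always_eventually allI)
    qed (auto intro!: always_eventually)
    note ca = D_closed[OF aD Qa pA aL] and cb = D_closed[OF bD Qb pB bL]
    have "(\<lambda>n. Q (a n) (b n)) \<longlonglongrightarrow> Q ?pA ?pB" by (rule Q_tendsto[OF aD ca bD cb])
    then have "Q ?pA ?pB = 0" by (simp add: cross LIMSEQ_const_iff)
    moreover have "(\<lambda>x. ?pA x + ?pB x) = p" by auto
    ultimately have "Qsq p = Qsq ?pA + Qsq ?pB"
      using Q_square_add[OF ca(1) cb(1)] by simp
    moreover have "Qsq (\<lambda>x. indicator (space M - A) x * p x) = Qsq ?pB"
      by (rule Q_cong[OF cb(1)]) (auto intro!: AE_I2 simp: indicator_def)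
    ultimately show ?thesis using ca(1) by simp
  qed
  then show ?thesis using A by (simp add: invariant_set_def)
qed

end

section \<open>Potentials and recurrence\<close>

context dirichlet_semigroup begin

text \<open>The weak identity gives \<open>\<beta> \<integral> F (p - u) = \<integral> f u -
  \<integral> (T r f) u\<close>, and the right side is at least \<open>- B \<integral> f\<close>.
  This error is independent of \<open>r\<close>, so a uniform bound for potentials paired with
  \<open>p\<close> passes to the resolvent of \<open>p\<close>.\<close>

lemma potential_pairing_bound:
  assumes f: "integrable M f" "AE x in M. 0 \<le> f x" and F: "is_int_semigroup M T f r F" "r \<ge> 0"
    and u: "gen u (\<lambda>x. \<beta> * (p x - u x))" "\<beta> > 0" "\<And>x. 0 \<le> u x \<and> u x \<le> B"
    and p: "p \<in> borel_measurable M" "\<And>x. 0 \<le> p x \<and> p x \<le> B"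
  shows "\<beta> * pairing F u \<le> \<beta> * pairing F p + B * (\<integral>x. f x \<partial>M)"
proof -
  note um = D_measurable[OF gen_rel_D[OF u(1)]] and Fi = int_semigroup_integrable[OF F(1)]
  have B0: "0 \<le> B" using u(3)[of undefined] by linarith
  have ub: "\<bar>u x\<bar> \<le> B" "\<bar>p x\<bar> \<le> B" for x using u(3)[of x] p(2)[of x] by auto
  have wb: "\<bar>\<beta> * (p x - u x)\<bar> \<le> \<beta> * B" for x
    using u(2) ub u(3)[of x] p(2)[of x] by (auto simp: abs_mult intro!: mult_left_mono)
  have wm: "(\<lambda>x. \<beta> * (p x - u x)) \<in> borel_measurable M" using um p(1) by measurable
  have "(\<integral>x. F x * (\<beta> * (p x - u x)) \<partial>M) = (LBINT s:{0..r}. \<integral>x. T s f x * (\<beta> * (p x - u x)) \<partial>M)"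
    by (rule int_semigroup_pairing[OF F(1) wm wb])
  also have "\<dots> = pairing f u - pairing (T r f) u"
  proof (rule weak_identity[OF f(1) u(1) F(2)])
    show "0 \<le> max B (\<beta> * B)" using B0 by simp
    show "\<bar>u x\<bar> \<le> max B (\<beta> * B)" "\<bar>\<beta> * (p x - u x)\<bar> \<le> max B (\<beta> * B)" for x using ub[of x] wb[of x] by auto
  qed
  finally have eq: "(\<integral>x. F x * (\<beta> * (p x - u x)) \<partial>M) = pairing f u - pairing (T r f) u" .
  have "(\<integral>x. F x * (\<beta> * (p x - u x)) \<partial>M) = (\<integral>x. \<beta> * (F x * p x) - \<beta> * (F x * u x) \<partial>M)"
    by (simp add: algebra_simps)
  also have "\<dots> = \<beta> * pairing F p - \<beta> * pairing F u"
    using integrable_mult_bounded(1)[OF Fi p(1) ub(2)] integrable_mult_bounded(1)[OF Fi um ub(1)] by simp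
  finally have eq2: "(\<integral>x. F x * (\<beta> * (p x - u x)) \<partial>M) = \<beta> * pairing F p - \<beta> * pairing F u" .
  have "0 \<le> pairing f u" using f(2) u(3) by (intro integral_nonneg_AE) (auto elim!: AE_mp)
  moreover have "pairing (T r f) u \<le> B * (\<integral>x. f x \<partial>M)"
  proof -
    have "(\<integral>x. \<bar>f x\<bar> \<partial>M) = (\<integral>x. f x \<partial>M)"
      using f by (intro integral_cong_AE) (auto elim!: AE_mp)
    then show ?thesis using pairing_bounded[OF f(1) um ub(1) B0 F(2)] by simp
  qed
  ultimately show ?thesis using eq eq2 by linarith
qed

text \<open>Up to a null set, the set below is \<open>{G f = \<infinity>}\<close>.\<close>

lemma infinite_potential_invariant:
  assumes f: "integrable M f" "AE x in M. 0 \<le> f x" and F: "\<And>n. is_int_semigroup M T f (real n) (F n)"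
  shows "invariant_set M D Q {x \<in> space M. \<forall>k::nat. \<exists>n. real k < F n x}"
proof -
  let ?A = "{x \<in> space M. \<forall>k::nat. \<exists>n. real k < F n x}"
  note Fi = int_semigroup_integrable[OF F]
  note [measurable] = borel_measurable_integrable[OF Fi]
  have mono: "AE x in M. \<forall>n. 0 \<le> F n x \<and> F n x \<le> F (Suc n) x" by (rule int_semigroup_sequence_mono[OF f F])
  \<comment> \<open>If potentials are bounded against \<open>p\<close>, they are bounded against its
    resolvent, which must then vanish where they blow up.\<close>
  have pos: "AE x in M. x \<in> ?A \<longrightarrow> u x = 0"
    if \<beta>: "\<beta> > 0" and p: "p \<in> L2 M" "\<And>x. 0 \<le> p x \<and> p x \<le> 1" and K: "\<And>n. pairing (F n) p \<le> K"
      and u: "gen u (\<lambda>x. \<beta> * (p x - u x))" for \<beta> p u K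
  proof -
    note pm = L2_measurable[OF p(1)]
    obtain y where y: "gen y (\<lambda>x. \<beta> * (p x - y x))" "\<And>x. 0 \<le> y x \<and> y x \<le> 1"
      using ex_bounded_resolvent[OF weight_const[OF \<beta>] p(1), of 0 1] p(2) by auto
    note ym = D_measurable[OF gen_rel_D[OF y(1)]]
    have yb: "\<bar>y x\<bar> \<le> 1" for x using y(2)[of x] by simp
    have "AE x in M. (\<forall>k::nat. \<exists>n. real k < F n x) \<longrightarrow> y x = 0"
    proof (rule AE_zero_where_unbounded[OF borel_measurable_integrable[OF Fi] ym _ mono])
      show "0 \<le> y x" for x using y(2)[of x] by simp
      show "integrable M (\<lambda>x. F n x * y x)" for n by (rule integrable_mult_bounded(1)[OF Fi ym yb])
      fix n
      have "\<beta> * pairing (F n) y \<le> \<beta> * pairing (F n) p + 1 * (\<integral>x. f x \<partial>M)"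
        by (rule potential_pairing_bound[OF f F _ y(1) \<beta> y(2) pm p(2)]) simp
      also have "\<dots> \<le> \<beta> * K + (\<integral>x. f x \<partial>M)" using K[of n] \<beta> by simp
      finally show "pairing (F n) y \<le> (\<beta> * K + (\<integral>x. f x \<partial>M)) / \<beta>"
        using \<beta> by (simp add: field_simps)
    qed
    then show ?thesis
      using resolvent_unique[OF weight_const[OF \<beta>] u y(1)] by eventually_elim auto
  qed
  obtain S :: "nat \<Rightarrow> 'a set" where S: "range S \<subseteq> sets M" "(\<Union>i. S i) = space M"
    "\<And>i. emeasure M (S i) \<noteq> \<infinity>" "incseq S"
    using sigma_finite_incseq by blast
  have [measurable]: "S i \<in> sets M" for i using S(1) by auto
  \<comment> \<open>These sets exhaust the complement of \<open>?A\<close>. Finite measure puts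
    their indicators into L2, and the bound \<open>k\<close> on all \<open>F n\<close> bounds the
    pairings.\<close>
  define R where "R k i = {x \<in> space M. \<forall>n. F n x \<le> real k} \<inter> S i" for k i :: nat
  have [measurable]: "R k i \<in> sets M" for k i unfolding R_def by measurable
  have Rint: "integrable M (indicat_real (R k i))" for k i
  proof -
    have "emeasure M (R k i) \<le> emeasure M (S i)" by (intro emeasure_mono) (auto simp: R_def)
    then have "emeasure M (R k i) < \<infinity>" using S(3)[of i] by (auto simp: less_top)
    then show ?thesis by simp
  qed
  show ?thesis
  proof (rule invariant_set_if_resolvent_supported)
    show "?A \<in> sets M" by measurable
    fix \<beta> :: real and p v
    assume \<beta>: "\<beta> > 0" and p: "p \<in> L2 M" and v: "gen v (\<lambda>x. \<beta> * (indicator ?A x * p x - v x))"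
    note [measurable] = D_measurable[OF gen_rel_D[OF v]] L2_measurable[OF p]
    have Ap: "(\<lambda>x. indicator ?A x * p x) \<in> L2 M"
      using p by (intro L2_bounded_mult[of _ _ _ 1]) auto
    have "AE x in M. x \<in> R k i \<longrightarrow> v x = 0" for k i
    proof -
      \<comment> \<open>The sign of \<open>v\<close> on \<open>R k i\<close>, so that its pairing
        with \<open>v\<close> is the integral of \<open>\<bar>v\<bar>\<close> there. It is split
        below because \<open>pos\<close> takes data in \<open>[0, 1]\<close>.\<close>
      define s where "s x = (if 0 \<le> v x then 1 else - 1) * indicat_real (R k i) x" for x
      have [measurable]: "s \<in> borel_measurable M" unfolding s_def by measurable
      have sL2: "h \<in> L2 M" if "h \<in> borel_measurable M" "\<And>x. \<bar>h x\<bar> \<le> indicat_real (R k i) x" for h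
      proof (rule L2_bounded_integrable[of _ _ 1])
        show "integrable M h"
          using that by (intro Bochner_Integration.integrable_bound[OF Rint[of k i]]) auto
        show "AE x in M. \<bar>h x\<bar> \<le> 1" using order_trans[OF that(2)] by (auto simp: indicator_def)
      qed
      let ?sp = "\<lambda>x. max 0 (s x)" and ?sn = "\<lambda>x. max 0 (- s x)"
      have s: "s \<in> L2 M" by (rule sL2) (auto simp: s_def indicator_def)
      have sp: "?sp \<in> L2 M" by (rule sL2) (auto simp: s_def indicator_def)
      have sn: "?sn \<in> L2 M" by (rule sL2) (auto simp: s_def indicator_def)
      have sb: "0 \<le> ?sp x \<and> ?sp x \<le> 1" "0 \<le> ?sn x \<and> ?sn x \<le> 1" for x by (auto simp: s_def indicator_def)
      have K: "pairing (F n) h \<le> real k * (\<integral>x. indicat_real (R k i) x \<partial>M)"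
        if h: "h \<in> borel_measurable M" "\<And>x. 0 \<le> h x \<and> h x \<le> indicat_real (R k i) x" for n h
      proof -
        have h1: "\<bar>h x\<bar> \<le> 1" for x using h(2)[of x] by (cases "x \<in> R k i") auto
        have "F n x * h x \<le> real k * indicat_real (R k i) x" for x
        proof (cases "x \<in> R k i")
          case True
          then have "F n x \<le> real k" by (auto simp: R_def)
          then have "F n x * h x \<le> real k * h x" using h(2)[of x] by (intro mult_right_mono) auto
          also have "\<dots> \<le> real k * indicat_real (R k i) x" using h(2)[of x] by (intro mult_left_mono) auto
          finally show ?thesis .
        next
          case False
          then have "h x = 0" using h(2)[of x] by simp
          then show ?thesis using False by simp
        qed
        then have "pairing (F n) h \<le> (\<integral>x. real k * indicat_real (R k i) x \<partial>M)"
          using integrable_mult_bounded(1)[OF Fi h(1) h1, of n] Rint by (intro integral_mono) auto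
        then show ?thesis by simp
      qed
      obtain up where up: "gen up (\<lambda>x. \<beta> * (?sp x - up x))"
        using ex_resolvent[OF weight_const[OF \<beta>] sp] .
      obtain un where un: "gen un (\<lambda>x. \<beta> * (?sn x - un x))"
        using ex_resolvent[OF weight_const[OF \<beta>] sn] .
      have up0: "AE x in M. x \<in> ?A \<longrightarrow> up x = 0"
        by (rule pos[OF \<beta> sp sb(1) K up]) (auto simp: s_def indicator_def)
      have un0: "AE x in M. x \<in> ?A \<longrightarrow> un x = 0"
        by (rule pos[OF \<beta> sn sb(2) K un]) (auto simp: s_def indicator_def)
      have "(\<lambda>x. \<beta> * (?sp x - up x) - \<beta> * (?sn x - un x)) = (\<lambda>x. \<beta> * (s x - (up x - un x)))"
        by (auto simp: max_def algebra_simps)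
      with gen_rel_diff[OF up un] have ud: "gen (\<lambda>x. up x - un x) (\<lambda>x. \<beta> * (s x - (up x - un x)))" by simp
      note [measurable] = D_measurable[OF gen_rel_D[OF up]] D_measurable[OF gen_rel_D[OF un]]
      have sv: "s x * v x = \<bar>v x\<bar> * indicat_real (R k i) x" for x by (auto simp: s_def indicator_def)
      \<comment> \<open>Symmetry moves the resolvent from the data supported in \<open>?A\<close> to
        \<open>s\<close>, whose resolvent vanishes on \<open>?A\<close>.\<close>
      have "pairing s v = (\<integral>x. indicator ?A x * p x * (up x - un x) \<partial>M)"
        by (rule resolvent_symmetric[OF Ap s \<beta> v ud, symmetric])
      also have "\<dots> = (\<integral>x. (0::real) \<partial>M)"
      proof (rule integral_cong_AE)
        show "AE x in M. indicator ?A x * p x * (up x - un x) = 0"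
          using up0 un0 by eventually_elim (auto simp: indicator_def)
      qed measurable
      finally have "pairing s v = 0" by simp
      moreover have "integrable M (\<lambda>x. s x * v x)" by (rule L2_mult_integrable[OF s D_L2[OF gen_rel_D[OF v]]])
      moreover have "AE x in M. 0 \<le> s x * v x" by (simp add: sv)
      ultimately have "AE x in M. s x * v x = 0" using integral_nonneg_eq_0_iff_AE by blast
      then show ?thesis by eventually_elim (auto simp: sv)
    qed
    then have "AE x in M. \<forall>k i. x \<in> R k i \<longrightarrow> v x = 0" unfolding AE_all_countable by blast
    then show "AE x in M. x \<notin> ?A \<longrightarrow> v x = 0"
      using AE_space
    proof eventually_elim
      case (elim x)
      show ?case
      proof
        assume "x \<notin> ?A"
        then obtain k where "\<And>n. F n x \<le> real k" using elim(2) by (auto simp: not_less)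
        moreover obtain i where "x \<in> S i" using elim(2) S(2) by auto
        ultimately have "x \<in> R k i" using elim(2) by (auto simp: R_def)
        then show "v x = 0" using elim(1) by blast
      qed
    qed
  qed
qed

lemma recurrent_if_unit_approximable:
  assumes irr: "irreducible_form M D Q" and unit: unit_approximable
  shows "recurrent M T"
  unfolding recurrent_def
proof (intro ballI impI allI)
  fix f G assume "f \<in> L1 M" and f0: "AE x in M. 0 \<le> f x" and "is_Green M T f G"
  then have f: "integrable M f" by (simp add: L1_def)
  obtain F where F: "\<And>n::nat. is_int_semigroup M T f (real n) (F n)"
    and lim: "AE x in M. (\<lambda>n. ereal (F n x)) \<longlonglongrightarrow> G x"
    using \<open>is_Green M T f G\<close> by (auto simp: is_Green_def)
  let ?A = "{x \<in> space M. \<forall>k::nat. \<exists>n. real k < F n x}"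
  note Fi = int_semigroup_integrable[OF F]
  note [measurable] = borel_measurable_integrable[OF Fi] borel_measurable_integrable[OF f]
  have mono: "AE x in M. \<forall>n. 0 \<le> F n x \<and> F n x \<le> F (Suc n) x" by (rule int_semigroup_sequence_mono[OF f f0 F])
  have "emeasure M ?A = 0 \<or> emeasure M (space M - ?A) = 0"
    using irr infinite_potential_invariant[OF f f0 F] by (auto simp: irreducible_form_def)
  then show "(AE x in M. G x = 0) \<or> (AE x in M. G x = \<infinity>)"
  proof
    assume "emeasure M (space M - ?A) = 0"
    then have "AE x in M. x \<in> ?A" by (intro AE_I[of _ _ "space M - ?A"]) auto
    then have "AE x in M. G x = \<infinity>"
      using lim mono
    proof eventually_elim
      case (elim x)
      then have inc: "incseq (\<lambda>n. ereal (F n x))" by (intro incseq_SucI) simp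
      show ?case
      proof (rule ereal_top)
        fix c :: real
        obtain k :: nat where k: "c \<le> real k" using real_arch_simple by blast
        obtain n where "real k < F n x" using elim(1) by auto
        then have "ereal c \<le> ereal (F n x)" using k by simp
        also have "\<dots> \<le> G x" by (rule incseq_le[OF inc elim(2)])
        finally show "ereal c \<le> G x" .
      qed
    qed
    then show ?thesis ..
  next
    assume "emeasure M ?A = 0"
    then have notA: "AE x in M. x \<notin> ?A" by (intro AE_I[of _ _ ?A]) auto
    \<comment> \<open>A real-valued representative of \<open>G f\<close>; \<open>max 0\<close> keeps
      it nonnegative on the exceptional null set too.\<close>
    define S where "S x = max 0 (real_of_ereal (SUP n. ereal (F n x)))" for x
    have [measurable]: "S \<in> borel_measurable M" unfolding S_def by measurable
    have S0: "0 \<le> S x" for x by (simp add: S_def)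
    have FS: "AE x in M. \<forall>n. F n x \<le> S x"
      using notA AE_space
    proof eventually_elim
      case (elim x)
      then obtain k where k: "\<And>n. F n x \<le> real k" by (auto simp: not_less)
      let ?s = "SUP n. ereal (F n x)"
      have 1: "ereal (F n x) \<le> ?s" for n by (rule SUP_upper) simp
      have 2: "?s \<le> ereal (real k)" by (rule SUP_least) (simp add: k)
      have "\<bar>?s\<bar> \<noteq> \<infinity>" using 1[of 0] 2 by auto
      then have "?s = ereal (real_of_ereal ?s)" by (simp add: ereal_real)
      then have "F n x \<le> real_of_ereal ?s" for n using 1[of n] by (metis ereal_less_eq(3))
      then show ?case unfolding S_def by (simp add: le_max_iff_disj)
    qed
    \<comment> \<open>The divisor yields \<open>F n * h \<le> f\<close> a.e., the minimum puts
      \<open>h\<close> into L2, and \<open>h\<close> stays positive wherever \<open>f\<close>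
      is.\<close>
    define h where "h x = max 0 (min (f x) 1) / (1 + S x)" for x
    have [measurable]: "h \<in> borel_measurable M" unfolding h_def by measurable
    have h01: "0 \<le> h x \<and> h x \<le> 1" for x
      using S0[of x] by (auto simp: h_def divide_simps)
    have hf: "h x \<le> f x" if "0 \<le> f x" for x
    proof -
      have "h x \<le> max 0 (min (f x) 1) / 1" unfolding h_def using S0[of x] by (intro divide_left_mono) auto
      then show ?thesis using that by auto
    qed
    have hint: "integrable M h"
      using f0 by (intro Bochner_Integration.integrable_bound[OF f]) (auto elim!: AE_mp simp: h01 hf)
    have hL: "h \<in> L2 M" using h01 by (intro L2_bounded_integrable[OF hint, of 1]) auto
    let ?c = "\<integral>x. f x \<partial>M"
    have c0: "0 \<le> ?c" using f0 by (rule integral_nonneg_AE)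
    have hb: "\<bar>h x\<bar> \<le> 1" for x using h01[of x] by simp
    have Fh: "pairing (F n) h \<le> ?c" for n
    proof (rule integral_mono_AE[OF _ f])
      show "integrable M (\<lambda>x. F n x * h x)" by (rule integrable_mult_bounded(1)[OF Fi _ hb]) measurable
      show "AE x in M. F n x * h x \<le> f x"
        using FS f0
      proof eventually_elim
        case (elim x)
        have "F n x * h x \<le> (1 + S x) * h x" using elim(1) h01[of x] by (intro mult_right_mono) (auto intro: add_increasing)
        also have "\<dots> = max 0 (min (f x) 1)" using S0[of x] by (simp add: h_def)
        also have "\<dots> \<le> f x" using elim(2) by simp
        finally show ?case .
      qed
    qed
    obtain us where us: "\<And>n. us n \<in> D" "\<And>n x. 0 \<le> us n x \<and> us n x \<le> 1"
      "AE x in M. (\<lambda>n. us n x) \<longlonglongrightarrow> 1" "(\<lambda>n. Qsq (us n)) \<longlonglongrightarrow> 0"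
      using unit by (auto simp: unit_approximable_def)
    note [measurable] = D_measurable[OF us(1)]
    \<comment> \<open>For \<open>(L + \<alpha>) v = h\<close> the left side is
      \<open>Q v (us n) + \<alpha> \<integral> v (us n)\<close>. Both terms are estimated by
      Cauchy-Schwarz from
      \<open>Q v + \<alpha> \<integral> v\<^sup>2 \<le> \<integral> f\<close>.\<close>
    have bound: "pairing h (us n) \<le> sqrt (?c * Qsq (us n)) + sqrt (\<alpha> * (?c * Lsq (us n)))"
      if \<alpha>: "\<alpha> > 0" for \<alpha> n
    proof -
      \<comment> \<open>The factor \<open>1 / \<alpha>\<close> offsets the normalisation of the
        resolvents: \<open>\<alpha> (p - v)\<close> becomes \<open>h - \<alpha> v\<close>.\<close>
      let ?p = "\<lambda>x. 1 / \<alpha> * h x"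
      have pL: "?p \<in> L2 M" by (rule L2_scale[OF hL])
      have p01: "0 \<le> ?p x \<and> ?p x \<le> 1 / \<alpha>" for x using h01[of x] \<alpha> by (simp add: divide_right_mono)
      obtain v where v': "gen v (\<lambda>x. \<alpha> * (?p x - v x))" and v01: "\<And>x. 0 \<le> v x \<and> v x \<le> 1 / \<alpha>"
        using ex_bounded_resolvent[OF weight_const[OF \<alpha>] pL, of 0 "1 / \<alpha>"] p01 \<alpha> by auto
      note vD = gen_rel_D[OF v']
      note [measurable] = D_measurable[OF vD]
      have vb: "\<bar>v x\<bar> \<le> 1 / \<alpha>" for x using v01[of x] by simp
      have weq: "\<alpha> * (?p x - v x) = h x - \<alpha> * v x" for x using \<alpha> by (simp add: field_simps)
      have wb: "\<bar>h x - \<alpha> * v x\<bar> \<le> 1" for x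
      proof -
        have "0 \<le> \<alpha> * v x" "\<alpha> * v x \<le> 1" using v01[of x] \<alpha> by (auto simp: field_simps)
        then show ?thesis using h01[of x] by linarith
      qed
      have Fv: "\<alpha> * pairing (F n) v \<le> ?c + 1 / \<alpha> * ?c" for n
      proof -
        have "\<alpha> * pairing (F n) v \<le> \<alpha> * pairing (F n) ?p + 1 / \<alpha> * ?c"
          by (rule potential_pairing_bound[OF f f0 F _ v' \<alpha> v01 _ p01]) auto
        also have "\<alpha> * pairing (F n) ?p = pairing (F n) h"
          using \<alpha> by (simp add: mult.left_commute)
        finally show ?thesis using Fh[of n] by linarith
      qed
      \<comment> \<open>The crucial bound is free of \<open>\<alpha>\<close>. If it failed by
        \<open>e\<close>, the weak identity and \<open>Fh\<close> would keep
        \<open>\<integral> (T r f) v\<close> above \<open>e\<close> for all \<open>r\<close>. Then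
        \<open>\<integral> (F n) v\<close> would be at least \<open>n e\<close>, contradicting
        \<open>Fv\<close>, whose bound depends on \<open>\<alpha>\<close> but not on
        \<open>n\<close>.\<close>
      have fv: "pairing f v \<le> ?c"
      proof (rule ccontr)
        assume neg: "\<not> pairing f v \<le> ?c"
        define e where "e = pairing f v - ?c"
        have e: "e > 0" using neg by (simp add: e_def)
        have ge: "e \<le> pairing (T r f) v" if r: "r \<ge> 0" for r
        proof -
          obtain n :: nat where n: "r \<le> real n" using real_arch_simple by blast
          have "pairing f v - pairing (T r f) v = (LBINT s:{0..r}. \<integral>x. T s f x * (h x - \<alpha> * v x) \<partial>M)"
          proof (rule weak_identity[symmetric, OF f _ r])
            show "gen v (\<lambda>x. h x - \<alpha> * v x)" using v' unfolding weq .
            show "0 \<le> max 1 (1 / \<alpha>)" by simp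
            show "\<bar>v x\<bar> \<le> max 1 (1 / \<alpha>)" "\<bar>h x - \<alpha> * v x\<bar> \<le> max 1 (1 / \<alpha>)" for x
              using vb[of x] wb[of x] by auto
          qed
          also have "\<dots> \<le> (LBINT s:{0..r}. pairing (T s f) h)"
          proof (rule set_integral_mono)
            show "set_integrable lborel {0..r} (\<lambda>s. \<integral>x. T s f x * (h x - \<alpha> * v x) \<partial>M)"
              by (rule pairing_set_integrable[OF f _ wb]) auto
            show "set_integrable lborel {0..r} (\<lambda>s. pairing (T s f) h)"
              by (rule pairing_set_integrable[OF f _ hb]) auto
            fix s assume "s \<in> {0..r}"
            then have s: "s \<ge> 0" by simp
            show "(\<integral>x. T s f x * (h x - \<alpha> * v x) \<partial>M) \<le> pairing (T s f) h"
            proof (rule integral_mono_AE)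
              show "integrable M (\<lambda>x. T s f x * (h x - \<alpha> * v x))"
                by (rule integrable_mult_bounded(1)[OF T_integrable[OF f s] _ wb]) measurable
              show "integrable M (\<lambda>x. T s f x * h x)"
                by (rule integrable_mult_bounded(1)[OF T_integrable[OF f s] _ hb]) measurable
              show "AE x in M. T s f x * (h x - \<alpha> * v x) \<le> T s f x * h x"
                using T_nonneg[OF f f0 s] by eventually_elim (use v01 \<alpha> in \<open>auto intro!: mult_left_mono\<close>)
            qed
          qed
          also have "\<dots> \<le> (LBINT s:{0..real n}. pairing (T s f) h)"
            using h01 by (intro pairing_integral_mono[OF f f0 n, of _ 1]) auto
          also have "\<dots> = pairing (F n) h"
            by (rule int_semigroup_pairing[OF F _ hb, symmetric]) measurable
          also have "\<dots> \<le> ?c" by (rule Fh)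
          finally show ?thesis by (simp add: e_def)
        qed
        have ne: "real n * e \<le> pairing (F n) v" for n
        proof -
          have "real n * e = (LBINT s:{0..real n}. e)" by (simp add: set_lebesgue_integral_def)
          also have "\<dots> \<le> (LBINT s:{0..real n}. pairing (T s f) v)"
          proof (rule set_integral_mono)
            show "set_integrable lborel {0..real n} (\<lambda>s. e)"
              by (rule borel_integrable_atLeastAtMost') (rule continuous_on_const)
            show "set_integrable lborel {0..real n} (\<lambda>s. pairing (T s f) v)"
              by (rule pairing_set_integrable[OF f _ vb]) (use \<alpha> in auto)
          qed (use ge in auto)
          also have "\<dots> = pairing (F n) v"
            by (rule int_semigroup_pairing[OF F _ vb, symmetric]) measurable
          finally show ?thesis .
        qed
        obtain n :: nat where n: "(?c + 1 / \<alpha> * ?c) / (\<alpha> * e) < real n" using reals_Archimedean2 by blast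
        have "\<alpha> * (real n * e) \<le> ?c + 1 / \<alpha> * ?c"
          using mult_left_mono[OF ne less_imp_le[OF \<alpha>]] Fv by (rule order_trans)
        moreover have "?c + 1 / \<alpha> * ?c < real n * (\<alpha> * e)"
          using n \<alpha> e by (subst (asm) pos_divide_less_eq) auto
        ultimately show False by (simp add: mult.left_commute)
      qed
      have vv: "Qsq v + \<alpha> * Lsq v \<le> ?c"
      proof -
        have "Qsq v = (\<integral>x. h x * v x - \<alpha> * (v x)\<^sup>2 \<partial>M)"
          unfolding gen_rel_Q[OF v' vD] weq by (simp add: power2_eq_square algebra_simps)
        also have "\<dots> = pairing h v - \<alpha> * Lsq v"
          using L2_mult_integrable[OF hL D_L2[OF vD]] L2_integrable_square[OF D_L2[OF vD]] by simp
        also have "pairing h v \<le> pairing f v"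
        proof (rule integral_mono_AE[OF L2_mult_integrable[OF hL D_L2[OF vD]]])
          show "integrable M (\<lambda>x. f x * v x)" by (rule integrable_mult_bounded(1)[OF f _ vb]) measurable
          show "AE x in M. h x * v x \<le> f x * v x"
            using f0 by eventually_elim (use v01 in \<open>auto intro!: mult_right_mono hf\<close>)
        qed
        finally show ?thesis using fv by simp
      qed
      have Qv0: "0 \<le> Qsq v" by (rule Q_nonneg[OF vD])
      have v20: "0 \<le> \<alpha> * Lsq v" using \<alpha> by simp
      have "pairing h (us n) = Q v (us n) + \<alpha> * pairing v (us n)"
      proof -
        have "Q v (us n) = (\<integral>x. h x * us n x - \<alpha> * (v x * us n x) \<partial>M)"
          unfolding gen_rel_Q[OF v' us(1)] weq by (simp add: algebra_simps)
        then show ?thesis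
          using L2_mult_integrable[OF hL D_L2[OF us(1)[of n]]] L2_mult_integrable[OF D_L2[OF vD] D_L2[OF us(1)[of n]]] by simp
      qed
      moreover have "Q v (us n) \<le> sqrt (?c * Qsq (us n))"
      proof (rule real_le_rsqrt)
        have "(Q v (us n))\<^sup>2 \<le> Qsq v * Qsq (us n)" by (rule Q_Cauchy_Schwarz[OF vD us(1)])
        also have "\<dots> \<le> ?c * Qsq (us n)" using vv v20 Q_nonneg[OF us(1)[of n]] by (intro mult_right_mono) auto
        finally show "(Q v (us n))\<^sup>2 \<le> ?c * Qsq (us n)" .
      qed
      moreover have "\<alpha> * pairing v (us n) \<le> sqrt (\<alpha> * (?c * Lsq (us n)))"
      proof (rule real_le_rsqrt)
        have "(\<alpha> * pairing v (us n))\<^sup>2 \<le> \<alpha>\<^sup>2 * (Lsq v * Lsq (us n))"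
          unfolding power_mult_distrib by (intro mult_left_mono integral_Cauchy_Schwarz D_L2[OF vD] D_L2[OF us(1)]) auto
        also have "\<dots> = \<alpha> * ((\<alpha> * Lsq v) * Lsq (us n))" by (simp add: power2_eq_square)
        also have "\<dots> \<le> \<alpha> * (?c * Lsq (us n))"
          using vv Qv0 \<alpha> by (intro mult_left_mono mult_right_mono) auto
        finally show "(\<alpha> * pairing v (us n))\<^sup>2 \<le> \<alpha> * (?c * Lsq (us n))" .
      qed
      ultimately show ?thesis by linarith
    qed
    \<comment> \<open>The limit in \<open>\<alpha>\<close> is taken with \<open>n\<close> fixed,
      because the L2 norm of \<open>us n\<close> may grow with \<open>n\<close>.\<close>
    have bound0: "pairing h (us n) \<le> sqrt (?c * Qsq (us n))" for n
    proof (rule LIMSEQ_le_const)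
      have "(\<lambda>k. sqrt (?c * Qsq (us n)) + sqrt (1 / (real k + 1) * (?c * Lsq (us n))))
        \<longlonglongrightarrow> sqrt (?c * Qsq (us n)) + sqrt (0 * (?c * Lsq (us n)))"
        by (intro tendsto_intros one_over_Suc_tendsto_0)
      then show "(\<lambda>k. sqrt (?c * Qsq (us n)) + sqrt (1 / (real k + 1) * (?c * Lsq (us n))))
        \<longlonglongrightarrow> sqrt (?c * Qsq (us n))" by simp
      have "pairing h (us n) \<le> sqrt (?c * Qsq (us n)) + sqrt (1 / (real k + 1) * (?c * Lsq (us n)))" for k :: nat
        by (rule bound) simp
      then show "\<exists>N. \<forall>k\<ge>N. pairing h (us n) \<le> sqrt (?c * Qsq (us n)) + sqrt (1 / (real k + 1) * (?c * Lsq (us n)))"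
        by blast
    qed
    have hlim: "(\<lambda>n. pairing h (us n)) \<longlonglongrightarrow> (\<integral>x. h x * 1 \<partial>M)"
    proof (rule integral_dominated_convergence[OF _ _ hint])
      show "AE x in M. norm (h x * us n x) \<le> h x" for n
        using h01 us(2) by (auto intro!: AE_I2 mult_left_le simp: abs_mult)
      show "AE x in M. (\<lambda>n. h x * us n x) \<longlonglongrightarrow> h x * 1"
        using us(3) by eventually_elim (intro tendsto_intros)
    qed measurable
    have "(\<lambda>n. sqrt (?c * Qsq (us n))) \<longlonglongrightarrow> sqrt (?c * 0)"
      by (intro tendsto_intros us(4))
    from LIMSEQ_le[OF hlim this] bound0 have "(\<integral>x. h x \<partial>M) \<le> 0" by simp
    moreover have "0 \<le> (\<integral>x. h x \<partial>M)" using h01 by (intro integral_nonneg_AE) simp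
    ultimately have "(\<integral>x. h x \<partial>M) = 0" by (rule antisym)
    then have "AE x in M. h x = 0"
      using integral_nonneg_eq_0_iff_AE[OF hint] h01 by simp
    then have "AE x in M. f x = 0"
      using f0
    proof eventually_elim
      case (elim x)
      have "1 + S x \<noteq> 0" using S0[of x] by linarith
      then have "max 0 (min (f x) 1) = 0" using elim(1) by (simp add: h_def)
      then show ?case using elim(2) by (auto simp: max_def min_def split: if_splits)
    qed
    then have "AE x in M. F n x = 0" for n by (rule int_semigroup_zero[OF f _ F])
    then have "AE x in M. \<forall>n. F n x = 0" by (simp add: AE_all_countable)
    then have "AE x in M. G x = 0"
      using lim
    proof eventually_elim
      case (elim x)
      then have "(\<lambda>n. 0) \<longlonglongrightarrow> G x" by (simp add: zero_ereal_def)
      then show ?case by (simp add: LIMSEQ_const_iff)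
    qed
    then show ?thesis ..
  qed
qed

lemma ext_gen_rel_one_if_recurrent:
  assumes rec: "recurrent M T"
  shows "ext_gen_rel M D Q (\<lambda>x. 1) (\<lambda>x. 0)"
proof (cases "emeasure M (space M) = 0")
  case True
  \<comment> \<open>On a space of measure 0 every a.e. statement holds, so even the zero sequence
    approximates 1. The other case supplies the nonempty space and the positive measure that the
    argument needs.\<close>
  have Q0: "Qsq (\<lambda>x. 0) = 0" using Q_scale_left[of "\<lambda>x. 0" "\<lambda>x. 0" 0] by simp
  have ae: "AE x in M. P x" for P using True by (intro AE_I[of _ _ "space M"]) auto
  show ?thesis
    by (rule ext_gen_rel_if_unit_approximation[of "\<lambda>n x. 0"]) (auto simp: Q0 intro: ae)
next
  case False
  then have ne: "space M \<noteq> {}" by auto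
  obtain g0 :: "'a \<Rightarrow> real" where g0: "g0 \<in> borel_measurable M" "\<And>x. g0 x > 0" "\<And>x. g0 x \<le> 1" "integrable M g0"
    using obtain_positive_integrable_function by blast
  \<comment> \<open>Division by \<open>c\<close> gives \<open>\<integral> g \<le> 1\<close>, as
    \<open>ex_int_semigroup\<close> requires; the summand 1 keeps \<open>c \<ge> 1\<close>, hence
    \<open>g \<le> 1\<close>.\<close>
  define c where "c = 1 + (\<integral>x. g0 x \<partial>M)"
  have i0: "0 \<le> (\<integral>x. g0 x \<partial>M)" using g0(2) by (intro integral_nonneg_AE AE_I2 less_imp_le)
  then have c: "c \<ge> 1" by (simp add: c_def)
  define g where "g x = g0 x / c" for x
  have gpos: "0 < g x" for x using g0(2)[of x] c by (simp add: g_def)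
  have g01: "0 \<le> g x \<and> g x \<le> 1" for x
    using gpos[of x] g0(3)[of x] c by (simp add: g_def divide_le_eq)
  have gint: "integrable M g" unfolding g_def using g0(4) by simp
  have gae: "AE x in M. 0 \<le> g x" using g01 by simp
  have gle: "(\<integral>x. \<bar>g x\<bar> \<partial>M) \<le> 1"
  proof -
    have "(\<integral>x. \<bar>g x\<bar> \<partial>M) = (\<integral>x. g x \<partial>M)" using g01 by simp
    also have "\<dots> = (\<integral>x. g0 x \<partial>M) / c" by (simp add: g_def)
    also have "\<dots> \<le> 1" using c by (simp add: c_def)
    finally show ?thesis .
  qed
  note [measurable] = borel_measurable_integrable[OF gint]
  have gL: "g \<in> L2 M" using g01 by (intro L2_bounded_integrable[OF gint, of 1]) auto
  obtain us u where us: "\<And>n. gen (us n) (\<lambda>x. g x * (1 - us n x) - 1 / (real n + 1) * us n x)"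
      "\<And>n x. 0 \<le> us n x \<and> us n x \<le> 1"
    and u: "u \<in> borel_measurable M" "\<And>x. 0 \<le> u x \<and> u x \<le> 1" "AE x in M. (\<lambda>n. us n x) \<longlonglongrightarrow> u x"
    by (rule ex_equilibrium[OF gint g01]) blast
  note [measurable] = u(1) D_measurable[OF gen_rel_D[OF us(1)]]
  have "\<exists>F. is_int_semigroup M T g (real n) F" for n
    by (rule ex_int_semigroup[OF gint gae gle _ ne, of "real n"]) auto
  then obtain F where F: "\<And>n. is_int_semigroup M T g (real n) (F n)" by metis
  note Fi = int_semigroup_integrable[OF F]
  note [measurable] = borel_measurable_integrable[OF Fi]
  have mono: "AE x in M. \<forall>n. 0 \<le> F n x \<and> F n x \<le> F (Suc n) x" by (rule int_semigroup_sequence_mono[OF gint gae F])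
  define G where "G x = (SUP n. ereal (F n x))" for x
  have FG: "AE x in M. (\<lambda>n. ereal (F n x)) \<longlonglongrightarrow> G x"
    using mono
  proof eventually_elim
    case (elim x)
    then have "incseq (\<lambda>n. ereal (F n x))" by (intro incseq_SucI) simp
    then show ?case unfolding G_def by (rule LIMSEQ_SUP)
  qed
  have "is_Green M T g G" unfolding is_Green_def using F FG by blast
  with rec gint gae have "(AE x in M. G x = 0) \<or> (AE x in M. G x = \<infinity>)"
    unfolding recurrent_def L1_def by blast
  \<comment> \<open>Otherwise \<open>\<integral> (F 1) g\<close>, the time integral over
    \<open>[0, 1]\<close> of the nonnegative continuous pairing of \<open>T s g\<close> with
    \<open>g\<close>, would be 0. At time 0 this forces \<open>\<integral> g\<^sup>2 = 0\<close>,
    although \<open>g > 0\<close> and the space has positive measure.\<close>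
  moreover have "\<not> (AE x in M. G x = 0)"
  proof
    assume "AE x in M. G x = 0"
    then have "AE x in M. F 1 x * g x = 0"
      using mono
    proof eventually_elim
      case (elim x)
      have "ereal (F 1 x) \<le> G x" unfolding G_def by (rule SUP_upper) simp
      then have "F 1 x \<le> 0" using elim(1) by (simp add: zero_ereal_def)
      then show ?case using elim(2) by (metis antisym mult_zero_left)
    qed
    then have "pairing (F 1) g = (\<integral>x. (0::real) \<partial>M)" by (intro integral_cong_AE) auto
    moreover have "pairing (F 1) g = (LBINT s:{0..real 1}. pairing (T s g) g)"
      by (rule int_semigroup_pairing[OF F, of _ 1]) (use g01 in auto)
    ultimately have zero: "(LBINT s:{0..1}. pairing (T s g) g) = 0" by simp
    have cont: "continuous_on {0..1} (\<lambda>s. pairing (T s g) g)"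
      by (rule continuous_on_subset[OF pairing_continuous[OF gL gL]]) auto
    have si: "set_integrable lborel {0..1} (\<lambda>s. pairing (T s g) g)"
      by (rule borel_integrable_atLeastAtMost'[OF cont])
    have "((\<lambda>s. pairing (T s g) g) has_integral 0) (cbox 0 1)"
      using set_borel_integral_eq_integral[OF si] zero by (simp add: has_integral_integrable_integral)
    then have "pairing (T 0 g) g = 0"
      using cont pairing_nonneg[OF gint gae, of g] g01
      by (intro has_integral_0_cbox_imp_0[of 0 1 "\<lambda>s. pairing (T s g) g"]) auto
    moreover have "pairing (T 0 g) g = Lsq g"
      using T_0[OF gL] L2_measurable[OF T_L2[OF gL], of 0]
      by (intro integral_cong_AE) (auto simp: power2_eq_square elim!: AE_mp)
    ultimately have "AE x in M. g x = 0" by (intro integral_square_eq_0_AE[OF gL]) simp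
    then have "AE x in M. False" by eventually_elim (metis gpos less_irrefl)
    then show False using False using AE_iff_measurable[of "space M" M "\<lambda>x. False"] by simp
  qed
  ultimately have Ginf: "AE x in M. G x = \<infinity>" by blast
  let ?w = "\<lambda>x. g x * (1 - u x)"
  have wb: "\<bar>g x * (1 - t)\<bar> \<le> 1" if "0 \<le> t" "t \<le> 1" for x t
    using g01[of x] that by (auto simp: abs_mult intro!: mult_le_one)
  \<comment> \<open>The weak identity applies to \<open>us k\<close>, not to \<open>u\<close>. For
    fixed \<open>n\<close> the damping term contributes at most
    \<open>\<integral> \<bar>F n\<bar> / (k + 1)\<close>, which disappears as \<open>k\<close>
    grows; the resulting bound is uniform in \<open>n\<close>.\<close>
  have "pairing (F n) ?w \<le> (\<integral>x. g x \<partial>M)" for n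
  proof (rule LIMSEQ_le[of "\<lambda>k. \<integral>x. F n x * (g x * (1 - us k x)) \<partial>M" _ "\<lambda>k. (\<integral>x. g x \<partial>M) + 1 / (real k + 1) * (\<integral>x. \<bar>F n x\<bar> \<partial>M)"])
    show "(\<lambda>k. \<integral>x. F n x * (g x * (1 - us k x)) \<partial>M) \<longlonglongrightarrow> pairing (F n) ?w"
    proof (rule integral_dominated_convergence)
      show "integrable M (\<lambda>x. \<bar>F n x\<bar>)" using Fi by simp
      show "AE x in M. norm (F n x * (g x * (1 - us k x))) \<le> \<bar>F n x\<bar>" for k
      proof (rule AE_I2)
        fix x
        have "\<bar>F n x\<bar> * \<bar>g x * (1 - us k x)\<bar> \<le> \<bar>F n x\<bar> * 1" using wb us(2)[of k x] by (intro mult_left_mono) auto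
        then show "norm (F n x * (g x * (1 - us k x))) \<le> \<bar>F n x\<bar>" by (simp add: abs_mult)
      qed
      show "AE x in M. (\<lambda>k. F n x * (g x * (1 - us k x))) \<longlonglongrightarrow> F n x * ?w x"
        using u(3) by eventually_elim (intro tendsto_intros)
    qed measurable
    have "(\<lambda>k. (\<integral>x. g x \<partial>M) + 1 / (real k + 1) * (\<integral>x. \<bar>F n x\<bar> \<partial>M)) \<longlonglongrightarrow> (\<integral>x. g x \<partial>M) + 0 * (\<integral>x. \<bar>F n x\<bar> \<partial>M)"
      by (intro tendsto_intros one_over_Suc_tendsto_0)
    then show "(\<lambda>k. (\<integral>x. g x \<partial>M) + 1 / (real k + 1) * (\<integral>x. \<bar>F n x\<bar> \<partial>M)) \<longlonglongrightarrow> (\<integral>x. g x \<partial>M)" by simp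
    have "(\<integral>x. F n x * (g x * (1 - us k x)) \<partial>M) \<le> (\<integral>x. g x \<partial>M) + 1 / (real k + 1) * (\<integral>x. \<bar>F n x\<bar> \<partial>M)" for k
    proof -
      define a where "a = 1 / (real k + 1)"
      have a: "0 \<le> a" "a \<le> 1" by (auto simp: a_def)
      let ?wk = "\<lambda>x. g x * (1 - us k x) - a * us k x"
      have gr: "gen (us k) ?wk" using us(1)[of k] by (simp add: a_def)
      have ub: "\<bar>us k x\<bar> \<le> 1" for x using us(2)[of k x] by simp
      have gb: "\<bar>g x * (1 - us k x)\<bar> \<le> 1" for x using wb us(2)[of k x] by blast
      have wkb: "\<bar>?wk x\<bar> \<le> 2" for x
      proof -
        have "0 \<le> a * us k x" "a * us k x \<le> 1" using a us(2)[of k x] by (auto intro: mult_le_one)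
        then show ?thesis using gb[of x] by linarith
      qed
      have "pairing (F n) ?wk = (LBINT s:{0..real n}. pairing (T s g) ?wk)"
        by (rule int_semigroup_pairing[OF F _ wkb]) measurable
      also have "\<dots> = pairing g (us k) - pairing (T (real n) g) (us k)"
        by (rule weak_identity[OF gint gr, of _ 2]) (use wkb in \<open>auto intro: order_trans[OF ub]\<close>)
      also have "\<dots> \<le> (\<integral>x. g x \<partial>M)"
      proof -
        have "0 \<le> pairing (T (real n) g) (us k)" using us(2) by (intro pairing_nonneg[OF gint gae]) auto
        moreover have "pairing g (us k) \<le> (\<integral>x. g x \<partial>M)"
          using integrable_mult_bounded(1)[OF gint _ ub] gint g01 us(2)
          by (intro integral_mono) (auto intro!: mult_left_le)
        ultimately show ?thesis by linarith
      qed
      finally have 1: "pairing (F n) ?wk \<le> (\<integral>x. g x \<partial>M)" .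
      have i1: "integrable M (\<lambda>x. F n x * (g x * (1 - us k x)))" by (rule integrable_mult_bounded(1)[OF Fi _ gb]) measurable
      have i2: "integrable M (\<lambda>x. F n x * us k x)" by (rule integrable_mult_bounded(1)[OF Fi _ ub]) measurable
      have "pairing (F n) ?wk = (\<integral>x. F n x * (g x * (1 - us k x)) - a * (F n x * us k x) \<partial>M)"
        by (intro Bochner_Integration.integral_cong) (auto simp: algebra_simps)
      also have "\<dots> = (\<integral>x. F n x * (g x * (1 - us k x)) \<partial>M) - a * pairing (F n) (us k)"
        using i1 i2 by simp
      finally have 2: "pairing (F n) ?wk = (\<integral>x. F n x * (g x * (1 - us k x)) \<partial>M) - a * pairing (F n) (us k)" .
      have "pairing (F n) (us k) \<le> 1 * (\<integral>x. \<bar>F n x\<bar> \<partial>M)"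
        using integrable_mult_bounded(2)[OF Fi[of n] D_measurable[OF gen_rel_D[OF us(1)]] ub] by (simp add: abs_le_iff)
      then have "a * pairing (F n) (us k) \<le> a * (\<integral>x. \<bar>F n x\<bar> \<partial>M)" using a by (intro mult_left_mono) auto
      then show ?thesis using 1 2 by (simp add: a_def)
    qed
    then show "\<exists>N. \<forall>k\<ge>N. (\<integral>x. F n x * (g x * (1 - us k x)) \<partial>M) \<le> (\<integral>x. g x \<partial>M) + 1 / (real k + 1) * (\<integral>x. \<bar>F n x\<bar> \<partial>M)" by blast
  qed
  moreover have wb': "\<bar>?w x\<bar> \<le> 1" for x using wb u(2)[of x] by blast
  ultimately have "AE x in M. (\<forall>k::nat. \<exists>n. real k < F n x) \<longrightarrow> ?w x = 0"
    using g01 u(2)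
    by (intro AE_zero_where_unbounded[OF borel_measurable_integrable[OF Fi] _ _ mono] integrable_mult_bounded(1)[OF Fi _ wb']) auto
  then have "AE x in M. (\<lambda>n. us n x) \<longlonglongrightarrow> 1"
    using Ginf u(3)
  proof eventually_elim
    case (elim x)
    have "\<exists>n. real k < F n x" for k :: nat
    proof -
      have "ereal (real k) < (SUP n. ereal (F n x))" using elim(2) by (simp add: G_def)
      then show ?thesis by (auto simp: less_SUP_iff)
    qed
    with elim(1) have "u x = 1" using gpos[of x] by auto
    with elim(3) show ?case by simp
  qed
  then show ?thesis by (rule equilibrium_eq_1[OF gint g01 us])
qed

end

theorem mainTheorem6:
  fixes M :: "'a measure" and D :: "('a \<Rightarrow> real) set"
    and Q :: "('a \<Rightarrow> real) \<Rightarrow> ('a \<Rightarrow> real) \<Rightarrow> real"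
    and T :: "real \<Rightarrow> ('a \<Rightarrow> real) \<Rightarrow> ('a \<Rightarrow> real)"
  assumes "sigma_finite_measure M"
    and "dirichlet_form M D Q"
    and "irreducible_form M D Q"
    and "semigroup_of M D Q T"
  shows "(recurrent M T \<longleftrightarrow>
           (\<forall>u w. ext_gen_rel M D Q u w \<and> integrable M w \<longrightarrow> (\<integral>x. w x \<partial>M) = 0))
       \<and> (recurrent M T \<longleftrightarrow> ext_gen_rel M D Q (\<lambda>x. 1) (\<lambda>x. 0))"
proof -
  interpret sigma_finite_measure M by (rule assms(1))
  interpret dirichlet_semigroup M D Q T
    by unfold_locales (rule assms(2), rule assms(4))
  have "recurrent M T \<Longrightarrow> ext_gen_rel M D Q (\<lambda>x. 1) (\<lambda>x. 0)"
    by (rule ext_gen_rel_one_if_recurrent)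
  moreover have "ext_gen_rel M D Q (\<lambda>x. 1) (\<lambda>x. 0) \<Longrightarrow> recurrent M T"
    by (rule recurrent_if_unit_approximable[OF assms(3) unit_approximable_if_ext_gen_rel])
  moreover have "(\<integral>x. w x \<partial>M) = 0"
    if "ext_gen_rel M D Q (\<lambda>x. 1) (\<lambda>x. 0)" "ext_gen_rel M D Q u w" "integrable M w" for u w
    by (rule integral_generator_eq_0[OF unit_approximable_if_ext_gen_rel[OF that(1)] that(2,3)])
  moreover have "\<forall>u w. ext_gen_rel M D Q u w \<and> integrable M w \<longrightarrow> (\<integral>x. w x \<partial>M) = 0 \<Longrightarrow>
      ext_gen_rel M D Q (\<lambda>x. 1) (\<lambda>x. 0)"
    by (rule ext_gen_rel_one_if_integral_generator) blast
  ultimately show ?thesis by blast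
qed

end
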